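(* Over any field $\mathbb K$, $(As,Dup,Mag)$ is a good triple of operads. That is: the primitive operad $\mathrm{Prim}_{As}Dup$ of duplicial bialgebras ($As^c\text{-}Dup$-bialgebras) is $Mag$, and for any duplicial bialgebra $\mathcal H$ the following are equivalent: (a) $\mathcal H$ is connected; (b) there is an isomorphism of duplicial bialgebras $\mathcal H\cong U(\mathrm{Prim}\,\mathcal H)$; (c) there is an isomorphism of connected coassociative coalgebras $\mathcal H\cong As^c(\mathrm{Prim}\,\mathcal H)$.
   Context: A duplicial algebra ($Dup$-algebra) is a $\mathbb K$-vector space with two binary operations $\prec,\succ$ satisfying $(x\prec y)\prec z=x\prec(y\prec z)$, $(x\succ y)\prec z=x\succ(y\prec z)$, $(x\succ y)\succ z=x\succ(y\succ z)$. $Dup$ is the corresponding operad and $Dup(V)$ the free duplicial algebra. A magmatic algebra ($Mag$-algebra) is a vector space with one binary operation subject to no relation. $As$ is the operad of (nonunital) associative algebras. A duplicial bialgebra is a duplicial algebra $\mathcal H$ with a coassociative linear map $\delta:\mathcal H\to\mathcal H\otimes\mathcal H$, $\delta(x)=x_{(1)}\otimes x_{(2)}$ (summation understood), such that for $\circ={\prec}$ and $\circ={\succ}$: $\delta(x\circ y)=x\otimes y+x_{(1)}\otimes(x_{(2)}\circ y)+(x\circ y_{(1)})\otimes y_{(2)}$. The free duplicial algebra $Dup(V)$ has a functorial duplicial bialgebra structure with $\delta(V)=0$. $\mathrm{Prim}\,\mathcal H=\ker\delta$. With $\delta^{r}:\mathcal H\to\mathcal H^{\otimes(r+1)}$ the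 iterated coproduct and $F_r\mathcal H=\ker\delta^{r}$, $\mathcal H$ is connected if $\mathcal H=\bigcup_{r\ge1}F_r\mathcal H$. $As^c(V)=\bigoplus_{n\ge1}V^{\otimes n}$ with deconcatenation $v_1\cdots v_n\mapsto\sum_{i=1}^{n-1}v_1\cdots v_i\otimes v_{i+1}\cdots v_n$ is the cofree connected coassociative coalgebra. $\mathrm{Prim}_{As}Dup$ is the suboperad of $Dup$ consisting of the operations $\mu\in Dup(n)$ such that $\mu(x_1,\dots,x_n)\in Dup(\mathbb Kx_1\oplus\cdots\oplus\mathbb Kx_n)$ is primitive; it is identified with $Mag$ via the generating operation $x\cdot y:=x\prec y-x\succ y$. The primitive part of a duplicial bialgebra is thus a magmatic algebra for this operation. $U:Mag\text{-alg}\to Dup\text{-alg}$ is the left adjoint of the forgetful functor $(A,\prec,\succ)\mapsto(A,\cdot)$; $U(L)$ carries the bialgebra structure induced from $Dup(L)$. *)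

theory Defs
  imports
    "Jordan_Normal_Form.VS_Connect"
    "HOL-Algebra.AbelCoset"
    "HOL-Library.Poly_Mapping"
    "HOL-Combinatorics.Permutations"
begin

section \<open>Free vector spaces, quotients, direct sums\<close>

text \<open>
  The ground field is an arbitrary type \<open>'k\<close> of class \<open>field\<close>; vector spaces over it are
  HOL-Algebra modules over \<^const>\<open>class_ring\<close>, that is \<^term>\<open>vectorspace class_ring V\<close>.
  The record type of modules inherits the ring fields \<open>mult\<close> and \<open>one\<close>, which play no role for
  modules and are left undefined.
\<close>

definition free_space :: "'x set \<Rightarrow> ('k::field, 'x \<Rightarrow>\<^sub>0 'k) module" where
  "free_space X = \<lparr>carrier = {p. Poly_Mapping.keys p \<subseteq> X}, mult = undefined, one = undefined,
     zero = 0, add = (+), smult = (\<lambda>c. Poly_Mapping.map ((*) c))\<rparr>"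

definition quotient_space ::
    "('k::field, 'a, 'm) module_scheme \<Rightarrow> 'a set \<Rightarrow> ('k, 'a set) module" where
  "quotient_space M N = \<lparr>carrier = a_rcosets\<^bsub>M\<^esub> N, mult = undefined, one = undefined,
     zero = N, add = set_add M, smult = (\<lambda>c X. \<Union>x\<in>X. N +>\<^bsub>M\<^esub> (c \<odot>\<^bsub>M\<^esub> x))\<rparr>"

definition direct_sum ::
    "'i set \<Rightarrow> ('i \<Rightarrow> ('k::field, 'a, 'm) module_scheme) \<Rightarrow> ('k, 'i \<Rightarrow> 'a) module" where
  "direct_sum I M =
     \<lparr>carrier = {f \<in> \<Pi>\<^sub>E i\<in>I. carrier (M i). finite {i\<in>I. f i \<noteq> \<zero>\<^bsub>M i\<^esub>}},
      mult = undefined, one = undefined,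
      zero = (\<lambda>i\<in>I. \<zero>\<^bsub>M i\<^esub>),
      add = (\<lambda>f g. \<lambda>i\<in>I. f i \<oplus>\<^bsub>M i\<^esub> g i),
      smult = (\<lambda>c f. \<lambda>i\<in>I. c \<odot>\<^bsub>M i\<^esub> f i)\<rparr>"

definition lin_ext ::
    "('k::field, 'a, 'm) module_scheme \<Rightarrow> ('x \<Rightarrow> 'a) \<Rightarrow> ('x \<Rightarrow>\<^sub>0 'k) \<Rightarrow> 'a" where
  "lin_ext W f p = (\<Oplus>\<^bsub>W\<^esub> x \<in> Poly_Mapping.keys p. Poly_Mapping.lookup p x \<odot>\<^bsub>W\<^esub> f x)"

text \<open>
  The linear map on a quotient of a free vector space that is induced by a function \<open>f\<close> on the
  free generators. It is meant for functions \<open>f\<close> whose linear extension is constant on cosets.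
\<close>

definition quot_lift ::
    "('k::field, 'a, 'm) module_scheme \<Rightarrow> ('x \<Rightarrow> 'a) \<Rightarrow> ('x \<Rightarrow>\<^sub>0 'k) set \<Rightarrow> 'a" where
  "quot_lift W f X = the_elem (lin_ext W f ` X)"

definition linear_iso ::
    "('k::field, 'a, 'm) module_scheme \<Rightarrow> ('k, 'b, 'n) module_scheme \<Rightarrow> ('a \<Rightarrow> 'b) \<Rightarrow> bool" where
  "linear_iso V W f \<longleftrightarrow> linear_map class_ring V W f \<and> bij_betw f (carrier V) (carrier W)"


section \<open>Tensor powers\<close>

text \<open>
  \<open>V\<^sup>\<otimes>\<^sup>n\<close> is the free vector space on the lists of length \<open>n\<close> over \<open>V\<close>, modulo multilinearity.
  In particular \<open>V \<otimes> V\<close> is \<open>tensor_power 2 V\<close>.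
\<close>

definition tensor_words :: "nat \<Rightarrow> ('k::field, 'a, 'm) module_scheme \<Rightarrow> 'a list set" where
  "tensor_words n V = {vs. length vs = n \<and> set vs \<subseteq> carrier V}"

definition tensor_rels ::
    "nat \<Rightarrow> ('k::field, 'a, 'm) module_scheme \<Rightarrow> ('a list \<Rightarrow>\<^sub>0 'k) set" where
  "tensor_rels n V =
     {Poly_Mapping.single (us @ (x \<oplus>\<^bsub>V\<^esub> y) # ws) 1
        - Poly_Mapping.single (us @ x # ws) 1 - Poly_Mapping.single (us @ y # ws) 1 | us x y ws.
        us @ x # ws \<in> tensor_words n V \<and> y \<in> carrier V} \<union>
     {Poly_Mapping.single (us @ (c \<odot>\<^bsub>V\<^esub> x) # ws) 1 - Poly_Mapping.single (us @ x # ws) c | us c x ws.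
        us @ x # ws \<in> tensor_words n V}"

definition tensor_null ::
    "nat \<Rightarrow> ('k::field, 'a, 'm) module_scheme \<Rightarrow> ('a list \<Rightarrow>\<^sub>0 'k) set" where
  "tensor_null n V = LinearCombinations.module.span class_ring (free_space (tensor_words n V)) (tensor_rels n V)"

definition tensor_power ::
    "nat \<Rightarrow> ('k::field, 'a, 'm) module_scheme \<Rightarrow> ('k, ('a list \<Rightarrow>\<^sub>0 'k) set) module" where
  "tensor_power n V = quotient_space (free_space (tensor_words n V)) (tensor_null n V)"

definition tensor :: "('k::field, 'a, 'm) module_scheme \<Rightarrow> 'a list \<Rightarrow> ('a list \<Rightarrow>\<^sub>0 'k) set" where
  "tensor V vs = tensor_null (length vs) V
     +>\<^bsub>free_space (tensor_words (length vs) V)\<^esub> Poly_Mapping.single vs 1"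

definition tensor_map ::
    "('k::field, 'b, 'n) module_scheme \<Rightarrow> ('a \<Rightarrow> 'b) \<Rightarrow> ('a list \<Rightarrow>\<^sub>0 'k) set \<Rightarrow> ('b list \<Rightarrow>\<^sub>0 'k) set"
    \<comment> \<open>the map \<open>f \<otimes> f\<close> from \<open>V \<otimes> V\<close> to \<open>W \<otimes> W\<close>\<close> where
  "tensor_map W f = quot_lift (tensor_power 2 W) (\<lambda>vs. tensor W (map f vs))"


section \<open>Coassociative coalgebras\<close>

text \<open>
  A coalgebra is given by a vector space \<open>V\<close> and a linear map \<open>\<delta>\<close> from \<open>V\<close> to \<open>V \<otimes> V\<close>; there is no
  counit. \<open>comult_first V \<delta> r\<close> is \<open>\<delta> \<otimes> id \<otimes> \<dots> \<otimes> id\<close> on \<open>V\<^sup>\<otimes>\<^sup>(\<^sup>r\<^sup>+\<^sup>1\<^sup>)\<close>, and \<open>comult_second V \<delta>\<close> is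
  \<open>id \<otimes> \<delta>\<close> on \<open>V \<otimes> V\<close>.
\<close>

definition comult_first ::
    "('k::field, 'a, 'm) module_scheme \<Rightarrow> ('a \<Rightarrow> ('a list \<Rightarrow>\<^sub>0 'k) set) \<Rightarrow> nat
       \<Rightarrow> ('a list \<Rightarrow>\<^sub>0 'k) set \<Rightarrow> ('a list \<Rightarrow>\<^sub>0 'k) set" where
  "comult_first V \<delta> r = quot_lift (tensor_power (r + 2) V)
     (\<lambda>vs. quot_lift (tensor_power (r + 2) V) (\<lambda>ws. tensor V (ws @ tl vs)) (\<delta> (hd vs)))"

definition comult_second ::
    "('k::field, 'a, 'm) module_scheme \<Rightarrow> ('a \<Rightarrow> ('a list \<Rightarrow>\<^sub>0 'k) set)
       \<Rightarrow> ('a list \<Rightarrow>\<^sub>0 'k) set \<Rightarrow> ('a list \<Rightarrow>\<^sub>0 'k) set" where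
  "comult_second V \<delta> = quot_lift (tensor_power 3 V)
     (\<lambda>vs. quot_lift (tensor_power 3 V) (\<lambda>ws. tensor V ((vs ! 0) # ws)) (\<delta> (vs ! 1)))"

definition coassociative ::
    "('k::field, 'a, 'm) module_scheme \<Rightarrow> ('a \<Rightarrow> ('a list \<Rightarrow>\<^sub>0 'k) set) \<Rightarrow> bool" where
  "coassociative V \<delta> \<longleftrightarrow>
     (\<forall>x\<in>carrier V. comult_first V \<delta> 1 (\<delta> x) = comult_second V \<delta> (\<delta> x))"

primrec iter_comult ::
    "('k::field, 'a, 'm) module_scheme \<Rightarrow> ('a \<Rightarrow> ('a list \<Rightarrow>\<^sub>0 'k) set) \<Rightarrow> nat
       \<Rightarrow> 'a \<Rightarrow> ('a list \<Rightarrow>\<^sub>0 'k) set" where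
  "iter_comult V \<delta> 0 x = tensor V [x]"
| "iter_comult V \<delta> (Suc r) x = comult_first V \<delta> r (iter_comult V \<delta> r x)"

definition filtration ::
    "('k::field, 'a, 'm) module_scheme \<Rightarrow> ('a \<Rightarrow> ('a list \<Rightarrow>\<^sub>0 'k) set) \<Rightarrow> nat \<Rightarrow> 'a set" where
  "filtration V \<delta> r = {x \<in> carrier V. iter_comult V \<delta> r x = \<zero>\<^bsub>tensor_power (r + 1) V\<^esub>}"

definition connected_coalgebra ::
    "('k::field, 'a, 'm) module_scheme \<Rightarrow> ('a \<Rightarrow> ('a list \<Rightarrow>\<^sub>0 'k) set) \<Rightarrow> bool" where
  "connected_coalgebra V \<delta> \<longleftrightarrow> carrier V = (\<Union>r\<in>{1..}. filtration V \<delta> r)"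

definition coalgebra_iso ::
    "('k::field, 'a, 'm) module_scheme \<Rightarrow> ('a \<Rightarrow> ('a list \<Rightarrow>\<^sub>0 'k) set)
       \<Rightarrow> ('k, 'b, 'n) module_scheme \<Rightarrow> ('b \<Rightarrow> ('b list \<Rightarrow>\<^sub>0 'k) set) \<Rightarrow> ('a \<Rightarrow> 'b) \<Rightarrow> bool" where
  "coalgebra_iso V \<delta> W \<epsilon> f \<longleftrightarrow>
     linear_iso V W f \<and> (\<forall>x\<in>carrier V. \<epsilon> (f x) = tensor_map W f (\<delta> x))"


subsection \<open>The cofree connected coalgebra\<close>

definition Asc :: "('k::field, 'a, 'm) module_scheme \<Rightarrow> ('k, nat \<Rightarrow> ('a list \<Rightarrow>\<^sub>0 'k) set) module" where
  "Asc V = direct_sum {1..} (\<lambda>n. tensor_power n V)"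

definition Asc_word ::
    "('k::field, 'a, 'm) module_scheme \<Rightarrow> 'a list \<Rightarrow> nat \<Rightarrow> ('a list \<Rightarrow>\<^sub>0 'k) set" where
  "Asc_word V vs = (\<lambda>n\<in>{1..}. if n = length vs then tensor V vs else \<zero>\<^bsub>tensor_power n V\<^esub>)"

definition deconcatenation ::
    "('k::field, 'a, 'm) module_scheme \<Rightarrow> (nat \<Rightarrow> ('a list \<Rightarrow>\<^sub>0 'k) set)
       \<Rightarrow> ((nat \<Rightarrow> ('a list \<Rightarrow>\<^sub>0 'k) set) list \<Rightarrow>\<^sub>0 'k) set" where
  "deconcatenation V f =
     (\<Oplus>\<^bsub>tensor_power 2 (Asc V)\<^esub> n \<in> {n\<in>{1..}. f n \<noteq> \<zero>\<^bsub>tensor_power n V\<^esub>}.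
        quot_lift (tensor_power 2 (Asc V))
          (\<lambda>vs. \<Oplus>\<^bsub>tensor_power 2 (Asc V)\<^esub> i \<in> {1..<length vs}.
             tensor (Asc V) [Asc_word V (take i vs), Asc_word V (drop i vs)])
          (f n))"


section \<open>Algebras with binary operations\<close>

text \<open>A vector space with a family of bilinear operations, indexed by the type \<open>'o\<close>.\<close>

record ('k, 'a, 'o) balg = "('k, 'a) module" +
  bop :: "'o \<Rightarrow> 'a \<Rightarrow> 'a \<Rightarrow> 'a"

locale binary_algebra = vectorspace class_ring A
  for A :: "('k::field, 'a, 'o, 'm) balg_scheme" (structure) +
  assumes bop_closed: "\<lbrakk>x \<in> carrier A; y \<in> carrier A\<rbrakk> \<Longrightarrow> bop A op x y \<in> carrier A"
    and bop_add_left: "\<lbrakk>x \<in> carrier A; x' \<in> carrier A; y \<in> carrier A\<rbrakk> \<Longrightarrow>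
      bop A op (x \<oplus> x') y = bop A op x y \<oplus> bop A op x' y"
    and bop_add_right: "\<lbrakk>x \<in> carrier A; y \<in> carrier A; y' \<in> carrier A\<rbrakk> \<Longrightarrow>
      bop A op x (y \<oplus> y') = bop A op x y \<oplus> bop A op x y'"
    and bop_smult_left: "\<lbrakk>x \<in> carrier A; y \<in> carrier A\<rbrakk> \<Longrightarrow>
      bop A op (c \<odot> x) y = c \<odot> bop A op x y"
    and bop_smult_right: "\<lbrakk>x \<in> carrier A; y \<in> carrier A\<rbrakk> \<Longrightarrow>
      bop A op x (c \<odot> y) = c \<odot> bop A op x y"

definition binary_ideal :: "('k::field, 'a, 'o, 'm) balg_scheme \<Rightarrow> 'a set \<Rightarrow> bool" where
  "binary_ideal A I \<longleftrightarrow> subspace class_ring I A \<and>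
     (\<forall>op. \<forall>x\<in>carrier A. \<forall>i\<in>I. bop A op x i \<in> I \<and> bop A op i x \<in> I)"

definition quotient_alg ::
    "('k::field, 'a, 'o, 'm) balg_scheme \<Rightarrow> 'a set \<Rightarrow> ('k, 'a set, 'o) balg" where
  "quotient_alg A I = module.extend (quotient_space A I)
     (balg.fields (\<lambda>op X Y. \<Union>x\<in>X. \<Union>y\<in>Y. I +>\<^bsub>A\<^esub> bop A op x y))"


subsection \<open>Free algebras\<close>

datatype (dead 'o, gens: 'v) tm = Gen 'v | Op 'o "('o, 'v) tm" "('o, 'v) tm"
  for map: map_gens

primrec leaves :: "('o, 'v) tm \<Rightarrow> 'v list" where
  "leaves (Gen v) = [v]"
| "leaves (Op op s t) = leaves s @ leaves t"

primrec eval_tm :: "('k::field, 'a, 'o, 'm) balg_scheme \<Rightarrow> ('v \<Rightarrow> 'a) \<Rightarrow> ('o, 'v) tm \<Rightarrow> 'a" where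
  "eval_tm A f (Gen v) = f v"
| "eval_tm A f (Op op s t) = bop A op (eval_tm A f s) (eval_tm A f t)"

definition term_alg ::
    "('k::field, 'v, 'm) module_scheme \<Rightarrow> ('k, ('o, 'v) tm \<Rightarrow>\<^sub>0 'k, 'o) balg" where
  "term_alg V = module.extend (free_space {t. gens t \<subseteq> carrier V})
     (balg.fields (\<lambda>op p q. \<Sum>s\<in>Poly_Mapping.keys p. \<Sum>t\<in>Poly_Mapping.keys q.
        Poly_Mapping.single (Op op s t) (Poly_Mapping.lookup p s * Poly_Mapping.lookup q t)))"

definition gen_rels :: "('k::field, 'v, 'm) module_scheme \<Rightarrow> (('o, 'v) tm \<Rightarrow>\<^sub>0 'k) set" where
  "gen_rels V =
     {Poly_Mapping.single (Gen (x \<oplus>\<^bsub>V\<^esub> y)) 1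
        - Poly_Mapping.single (Gen x) 1 - Poly_Mapping.single (Gen y) 1 | x y.
        x \<in> carrier V \<and> y \<in> carrier V} \<union>
     {Poly_Mapping.single (Gen (c \<odot>\<^bsub>V\<^esub> x)) 1 - Poly_Mapping.single (Gen x) c | c x. x \<in> carrier V}"

text \<open>
  A type of algebras is given by \<open>laws\<close>, which maps an algebra to the set of those elements whose
  vanishing says that the algebra is of the given type. The free algebra of that type on the vector
  space \<open>V\<close> is the quotient of the term algebra on \<open>V\<close> by the ideal generated by the laws and by
  linearity in the generators.
\<close>

type_synonym ('k, 'o, 'v) laws =
  "('k, ('o, 'v) tm \<Rightarrow>\<^sub>0 'k, 'o) balg \<Rightarrow> (('o, 'v) tm \<Rightarrow>\<^sub>0 'k) set"

definition free_alg_ideal ::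
    "('k, 'o, 'v) laws \<Rightarrow> ('k::field, 'v, 'm) module_scheme \<Rightarrow> (('o, 'v) tm \<Rightarrow>\<^sub>0 'k) set" where
  "free_alg_ideal laws V =
     binary_ideal (term_alg V) hull (gen_rels V \<union> laws (term_alg V))"

definition free_alg ::
    "('k, 'o, 'v) laws \<Rightarrow> ('k::field, 'v, 'm) module_scheme
       \<Rightarrow> ('k, (('o, 'v) tm \<Rightarrow>\<^sub>0 'k) set, 'o) balg" where
  "free_alg laws V = quotient_alg (term_alg V) (free_alg_ideal laws V)"

definition free_term ::
    "('k, 'o, 'v) laws \<Rightarrow> ('k::field, 'v, 'm) module_scheme \<Rightarrow> ('o, 'v) tm
       \<Rightarrow> (('o, 'v) tm \<Rightarrow>\<^sub>0 'k) set" where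
  "free_term laws V t =
     free_alg_ideal laws V +>\<^bsub>(term_alg V :: ('k, ('o, 'v) tm \<Rightarrow>\<^sub>0 'k, 'o) balg)\<^esub> Poly_Mapping.single t 1"


section \<open>Duplicial and magmatic algebras\<close>

datatype dup_op = Prec | Succ

datatype mag_op = Dot

abbreviation prec :: "('k, 'a, dup_op, 'm) balg_scheme \<Rightarrow> 'a \<Rightarrow> 'a \<Rightarrow> 'a" (infixl \<open>\<prec>\<index>\<close> 70) where
  "x \<prec>\<^bsub>A\<^esub> y \<equiv> bop A Prec x y"

abbreviation succ :: "('k, 'a, dup_op, 'm) balg_scheme \<Rightarrow> 'a \<Rightarrow> 'a \<Rightarrow> 'a" (infixl \<open>\<succ>\<index>\<close> 70) where
  "x \<succ>\<^bsub>A\<^esub> y \<equiv> bop A Succ x y"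

locale duplicial_algebra = binary_algebra A
  for A :: "('k::field, 'a, dup_op, 'm) balg_scheme" (structure) +
  assumes prec_prec: "\<lbrakk>x \<in> carrier A; y \<in> carrier A; z \<in> carrier A\<rbrakk> \<Longrightarrow>
      (x \<prec> y) \<prec> z = x \<prec> (y \<prec> z)"
    and succ_prec: "\<lbrakk>x \<in> carrier A; y \<in> carrier A; z \<in> carrier A\<rbrakk> \<Longrightarrow>
      (x \<succ> y) \<prec> z = x \<succ> (y \<prec> z)"
    and succ_succ: "\<lbrakk>x \<in> carrier A; y \<in> carrier A; z \<in> carrier A\<rbrakk> \<Longrightarrow>
      (x \<succ> y) \<succ> z = x \<succ> (y \<succ> z)"

definition dup_laws :: "('k::field, 'a, dup_op, 'm) balg_scheme \<Rightarrow> 'a set" where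
  "dup_laws A =
     {((x \<prec>\<^bsub>A\<^esub> y) \<prec>\<^bsub>A\<^esub> z) \<ominus>\<^bsub>A\<^esub> (x \<prec>\<^bsub>A\<^esub> (y \<prec>\<^bsub>A\<^esub> z)) | x y z.
        x \<in> carrier A \<and> y \<in> carrier A \<and> z \<in> carrier A} \<union>
     {((x \<succ>\<^bsub>A\<^esub> y) \<prec>\<^bsub>A\<^esub> z) \<ominus>\<^bsub>A\<^esub> (x \<succ>\<^bsub>A\<^esub> (y \<prec>\<^bsub>A\<^esub> z)) | x y z.
        x \<in> carrier A \<and> y \<in> carrier A \<and> z \<in> carrier A} \<union>
     {((x \<succ>\<^bsub>A\<^esub> y) \<succ>\<^bsub>A\<^esub> z) \<ominus>\<^bsub>A\<^esub> (x \<succ>\<^bsub>A\<^esub> (y \<succ>\<^bsub>A\<^esub> z)) | x y z.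
        x \<in> carrier A \<and> y \<in> carrier A \<and> z \<in> carrier A}"

definition mag_laws :: "('k::field, 'a, mag_op, 'm) balg_scheme \<Rightarrow> 'a set" where
  "mag_laws A = {}"

definition mag_of ::
    "('k::field, 'a, dup_op, 'm) balg_scheme \<Rightarrow> ('k, 'a, mag_op) balg"
    \<comment> \<open>the forgetful functor from duplicial to magmatic algebras\<close> where
  "mag_of A = module.extend (module.truncate A)
     (balg.fields (\<lambda>op x y. (x \<prec>\<^bsub>A\<^esub> y) \<ominus>\<^bsub>A\<^esub> (x \<succ>\<^bsub>A\<^esub> y)))"


section \<open>Duplicial bialgebras\<close>

record (overloaded) ('k::zero, 'a, 'o) bialg = "('k, 'a, 'o) balg" +
  comult :: "'a \<Rightarrow> ('a list \<Rightarrow>\<^sub>0 'k) set"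

locale duplicial_bialgebra = duplicial_algebra H
  for H :: "('k::field, 'a, dup_op, 'm) bialg_scheme" (structure) +
  assumes comult_linear: "linear_map class_ring H (tensor_power 2 H) (comult H)"
    and comult_coassociative: "coassociative H (comult H)"
    and comult_bop: "\<lbrakk>x \<in> carrier H; y \<in> carrier H\<rbrakk> \<Longrightarrow>
      comult H (bop H op x y) =
        (tensor H [x, y]
         \<oplus>\<^bsub>tensor_power 2 H\<^esub>
         quot_lift (tensor_power 2 H) (\<lambda>vs. tensor H [vs ! 0, bop H op (vs ! 1) y]) (comult H x))
         \<oplus>\<^bsub>tensor_power 2 H\<^esub>
         quot_lift (tensor_power 2 H) (\<lambda>vs. tensor H [bop H op x (vs ! 0), vs ! 1]) (comult H y)"

definition Prim :: "('k::field, 'a, dup_op, 'm) bialg_scheme \<Rightarrow> ('k, 'a, mag_op) balg" where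
  "Prim H = (mag_of H)\<lparr>carrier := {x \<in> carrier H. comult H x = \<zero>\<^bsub>tensor_power 2 H\<^esub>}\<rparr>"

definition dup_bialg_iso ::
    "('k::field, 'a, dup_op, 'm) bialg_scheme \<Rightarrow> ('k, 'b, dup_op, 'n) bialg_scheme
       \<Rightarrow> ('a \<Rightarrow> 'b) \<Rightarrow> bool" where
  "dup_bialg_iso H G f \<longleftrightarrow> coalgebra_iso H (comult H) G (comult G) f \<and>
     (\<forall>op. \<forall>x\<in>carrier H. \<forall>y\<in>carrier H. f (bop H op x y) = bop G op (f x) (f y))"


subsection \<open>The bialgebra structure on free duplicial algebras\<close>

definition Dup_with_comult ::
    "('k::field, 'v, 'm) module_scheme
       \<Rightarrow> (((dup_op, 'v) tm \<Rightarrow>\<^sub>0 'k) set \<Rightarrow> (((dup_op, 'v) tm \<Rightarrow>\<^sub>0 'k) set list \<Rightarrow>\<^sub>0 'k) set)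
       \<Rightarrow> ('k, ((dup_op, 'v) tm \<Rightarrow>\<^sub>0 'k) set, dup_op) bialg" where
  "Dup_with_comult V \<delta> = balg.extend (free_alg dup_laws V) (bialg.fields \<delta>)"

text \<open>
  Since \<open>Dup(V)\<close> is generated by \<open>V\<close>, its bialgebra structure is determined by its vanishing
  on \<open>V\<close>.
\<close>

definition Dup_comult ::
    "('k::field, 'v, 'm) module_scheme
       \<Rightarrow> ((dup_op, 'v) tm \<Rightarrow>\<^sub>0 'k) set \<Rightarrow> (((dup_op, 'v) tm \<Rightarrow>\<^sub>0 'k) set list \<Rightarrow>\<^sub>0 'k) set" where
  "Dup_comult V = (THE \<delta>.
     \<delta> \<in> extensional (carrier (free_alg dup_laws V)) \<and>
     duplicial_bialgebra (Dup_with_comult V \<delta>) \<and>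
     (\<forall>v\<in>carrier V. \<delta> (free_term dup_laws V (Gen v)) =
        \<zero>\<^bsub>tensor_power 2 (free_alg dup_laws V)\<^esub>))"

definition Dup ::
    "('k::field, 'v, 'm) module_scheme \<Rightarrow> ('k, ((dup_op, 'v) tm \<Rightarrow>\<^sub>0 'k) set, dup_op) bialg" where
  "Dup V = Dup_with_comult V (Dup_comult V)"


subsection \<open>The universal enveloping bialgebra of a magmatic algebra\<close>

text \<open>
  The left adjoint of \<^const>\<open>mag_of\<close> sends \<open>L\<close> to the quotient of \<open>Dup(L)\<close> by the ideal that
  identifies the product of \<open>L\<close> with the operation \<open>x \<prec> y - x \<succ> y\<close>.
\<close>

definition U_ideal ::
    "('k::field, 'v, mag_op, 'm) balg_scheme \<Rightarrow> ((dup_op, 'v) tm \<Rightarrow>\<^sub>0 'k) set set" where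
  "U_ideal L = binary_ideal (Dup L) hull
     {free_term dup_laws L (Gen (bop L Dot x y)) \<ominus>\<^bsub>Dup L\<^esub>
        bop (mag_of (Dup L)) Dot (free_term dup_laws L (Gen x)) (free_term dup_laws L (Gen y))
      | x y. x \<in> carrier L \<and> y \<in> carrier L}"

definition U_alg ::
    "('k::field, 'v, mag_op, 'm) balg_scheme
       \<Rightarrow> ('k, ((dup_op, 'v) tm \<Rightarrow>\<^sub>0 'k) set set, dup_op) balg" where
  "U_alg L = quotient_alg (Dup L) (U_ideal L)"

definition U ::
    "('k::field, 'v, mag_op, 'm) balg_scheme
       \<Rightarrow> ('k, ((dup_op, 'v) tm \<Rightarrow>\<^sub>0 'k) set set, dup_op) bialg" where
  "U L = balg.extend (U_alg L) (bialg.fields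
     (\<lambda>X. the_elem ((\<lambda>x. tensor_map (U_alg L) (\<lambda>y. U_ideal L +>\<^bsub>Dup L\<^esub> y) (comult (Dup L) x)) ` X)))"


section \<open>Operads\<close>

text \<open>
  Symmetric operads in vector spaces, presented by partial compositions: for \<open>\<mu>\<close> of arity \<open>m\<close>
  and \<open>\<nu>\<close> of arity \<open>n\<close>, \<open>pcomp m n i \<mu> \<nu>\<close> inserts \<open>\<nu>\<close> into the input \<open>i\<close> of \<open>\<mu>\<close>. Inputs are
  numbered from \<open>0\<close>.
\<close>

record ('k, 'p) operad =
  ops :: "nat \<Rightarrow> ('k, 'p) module"
  ident :: 'p
  pcomp :: "nat \<Rightarrow> nat \<Rightarrow> nat \<Rightarrow> 'p \<Rightarrow> 'p \<Rightarrow> 'p"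
  perm_act :: "nat \<Rightarrow> (nat \<Rightarrow> nat) \<Rightarrow> 'p \<Rightarrow> 'p"

definition operad_iso ::
    "('k::field, 'p) operad \<Rightarrow> ('k, 'q) operad \<Rightarrow> (nat \<Rightarrow> 'p \<Rightarrow> 'q) \<Rightarrow> bool" where
  "operad_iso P Q \<phi> \<longleftrightarrow>
     (\<forall>n. linear_iso (ops P n) (ops Q n) (\<phi> n)) \<and>
     \<phi> 1 (ident P) = ident Q \<and>
     (\<forall>m n i. \<forall>\<mu>\<in>carrier (ops P m). \<forall>\<nu>\<in>carrier (ops P n). i < m \<longrightarrow>
        \<phi> (m + n - 1) (pcomp P m n i \<mu> \<nu>) = pcomp Q m n i (\<phi> m \<mu>) (\<phi> n \<nu>)) \<and>
     (\<forall>n \<sigma>. \<forall>\<mu>\<in>carrier (ops P n). \<sigma> permutes {..<n} \<longrightarrow>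
        \<phi> n (perm_act P n \<sigma> \<mu>) = perm_act Q n \<sigma> (\<phi> n \<mu>))"

definition restrict_operad :: "(nat \<Rightarrow> 'p set) \<Rightarrow> ('k::field, 'p) operad \<Rightarrow> ('k, 'p) operad" where
  "restrict_operad S P = P\<lparr>ops := (\<lambda>n. (ops P n)\<lparr>carrier := S n\<rparr>)\<rparr>"

definition suboperad :: "(nat \<Rightarrow> 'p set) \<Rightarrow> ('k::field, 'p) operad \<Rightarrow> bool" where
  "suboperad S P \<longleftrightarrow>
     (\<forall>n. subspace class_ring (S n) (ops P n)) \<and>
     ident P \<in> S 1 \<and>
     (\<forall>m n i. \<forall>\<mu>\<in>S m. \<forall>\<nu>\<in>S n. i < m \<longrightarrow> pcomp P m n i \<mu> \<nu> \<in> S (m + n - 1)) \<and>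
     (\<forall>n \<sigma>. \<forall>\<mu>\<in>S n. \<sigma> permutes {..<n} \<longrightarrow> perm_act P n \<sigma> \<mu> \<in> S n)"


subsection \<open>The operad of a type of algebras\<close>

text \<open>
  The operations of arity \<open>n\<close> form the multilinear part of the free algebra on the vector space
  with basis \<open>x\<^sub>0, \<dots>, x\<^sub>n\<^sub>-\<^sub>1\<close>, and composition is substitution.
\<close>

definition coord_space :: "nat \<Rightarrow> ('k::field, nat \<Rightarrow>\<^sub>0 'k) module" where
  "coord_space n = free_space {..<n}"

definition var :: "('k::field, 'o, nat \<Rightarrow>\<^sub>0 'k) laws \<Rightarrow> nat \<Rightarrow> nat \<Rightarrow> (('o, nat \<Rightarrow>\<^sub>0 'k) tm \<Rightarrow>\<^sub>0 'k) set" where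
  "var laws n j = free_term laws (coord_space n) (Gen (Poly_Mapping.single j 1))"

definition multilinear_part ::
    "('k::field, 'o, nat \<Rightarrow>\<^sub>0 'k) laws \<Rightarrow> nat \<Rightarrow> (('o, nat \<Rightarrow>\<^sub>0 'k) tm \<Rightarrow>\<^sub>0 'k) set set" where
  "multilinear_part laws n = LinearCombinations.module.span class_ring (free_alg laws (coord_space n))
     {free_term laws (coord_space n) (map_gens (\<lambda>j. Poly_Mapping.single j 1) t) | t.
        distinct (leaves t) \<and> set (leaves t) = {..<n}}"

text \<open>\<open>subst_vars laws n g\<close> is the morphism of algebras that sends \<open>x\<^sub>j\<close> to \<open>g j\<close>, with values in the
  free algebra on \<open>x\<^sub>0, \<dots>, x\<^sub>n\<^sub>-\<^sub>1\<close>.\<close>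

definition subst_vars ::
    "('k::field, 'o, nat \<Rightarrow>\<^sub>0 'k) laws \<Rightarrow> nat \<Rightarrow> (nat \<Rightarrow> (('o, nat \<Rightarrow>\<^sub>0 'k) tm \<Rightarrow>\<^sub>0 'k) set)
       \<Rightarrow> (('o, nat \<Rightarrow>\<^sub>0 'k) tm \<Rightarrow>\<^sub>0 'k) set \<Rightarrow> (('o, nat \<Rightarrow>\<^sub>0 'k) tm \<Rightarrow>\<^sub>0 'k) set" where
  "subst_vars laws n g = quot_lift (free_alg laws (coord_space n))
     (eval_tm (free_alg laws (coord_space n)) (lin_ext (free_alg laws (coord_space n)) g))"

definition operad_of ::
    "('k::field, 'o, nat \<Rightarrow>\<^sub>0 'k) laws \<Rightarrow> ('k, (('o, nat \<Rightarrow>\<^sub>0 'k) tm \<Rightarrow>\<^sub>0 'k) set) operad" where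
  "operad_of laws =
     \<lparr>ops = (\<lambda>n. (module.truncate (free_alg laws (coord_space n)))
               \<lparr>carrier := multilinear_part laws n\<rparr>),
      ident = var laws 1 0,
      pcomp = (\<lambda>m n i \<mu> \<nu>. subst_vars laws (m + n - 1)
        (\<lambda>j. if j < i then var laws (m + n - 1) j
             else if j = i then subst_vars laws (m + n - 1) (\<lambda>l. var laws (m + n - 1) (i + l)) \<nu>
             else var laws (m + n - 1) (j + n - 1)) \<mu>),
      perm_act = (\<lambda>n \<sigma>. subst_vars laws n (\<lambda>j. var laws n (\<sigma> j)))\<rparr>"

abbreviation Dup_operad :: "('k::field, ((dup_op, nat \<Rightarrow>\<^sub>0 'k) tm \<Rightarrow>\<^sub>0 'k) set) operad" where
  "Dup_operad \<equiv> operad_of dup_laws"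

abbreviation Mag_operad :: "('k::field, ((mag_op, nat \<Rightarrow>\<^sub>0 'k) tm \<Rightarrow>\<^sub>0 'k) set) operad" where
  "Mag_operad \<equiv> operad_of mag_laws"

definition primitive_operations :: "nat \<Rightarrow> ((dup_op, nat \<Rightarrow>\<^sub>0 'k) tm \<Rightarrow>\<^sub>0 'k::field) set set" where
  "primitive_operations n =
     {\<mu> \<in> carrier (ops Dup_operad n).
        comult (Dup (coord_space n)) \<mu> = \<zero>\<^bsub>tensor_power 2 (Dup (coord_space n))\<^esub>}"

definition Prim_As_Dup :: "('k::field, ((dup_op, nat \<Rightarrow>\<^sub>0 'k) tm \<Rightarrow>\<^sub>0 'k) set) operad" where
  "Prim_As_Dup = restrict_operad primitive_operations Dup_operad"

end

theory Submission
  imports Defs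
begin

text \<open>
  Over a field, every vector space is isomorphic to a space \<open>fs X\<close> of finitely supported functions,
  and every (co)algebra structure is then given by structure constants on \<open>X\<close>; this turns tensor
  powers, quotients and free algebras into explicit computations.

  For a magmatic algebra \<open>L\<close>, the space of nonempty words over \<open>L\<close> with concatenation as \<open>\<prec>\<close> and
  deconcatenation as coproduct carries a unique duplicial bialgebra structure with
  \<open>a \<succ> b = a \<prec> b - a \<cdot> b\<close> on letters. It is the enveloping algebra \<open>U(L)\<close>, its primitive part is \<open>L\<close>,
  and for \<open>L\<close> the free magmatic algebra on \<open>V\<close> it is \<open>Dup(V)\<close>. So the primitive operations are the
  words of length one over the magmatic trees, and \<open>U(L)\<close> is \<open>As\<^sup>c(L)\<close> as a coalgebra.

  Conversely, on a connected duplicial bialgebra \<open>H\<close> the equation \<open>e(x) = x - e(x\<^sub>1) \<prec> x\<^sub>2\<close> has a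
  unique solution \<open>e\<close>, which projects \<open>H\<close> onto its primitive part and annihilates all \<open>x \<prec> y\<close>. Iterating
  it gives an inverse of the evaluation map from words over the primitive part to \<open>H\<close>.
\<close>

section \<open>Linear calculus on free vector spaces\<close>

text \<open>The spaces in question are quotients by spans and hulls, and the maps on them are read
  off cosets by \<open>the_elem\<close>, so each value needs independence of the representative. The
  free algebras and \<open>U L\<close> are recognised without any rewriting or confluence argument:
  an explicit surjection onto a model kills the relations, and the projection to the abstract
  quotient factors linearly through that surjection, so its kernel is exactly the ideal. For the
  duplicial models this factorisation is always \<open>word_eval\<close>.

  In a connected bialgebra the decomposition into primitives is carried by \<open>\<prec>\<close>:
  \<open>e\<close> and its properties come from the associativity of \<open>\<prec>\<close> and its
  compatibility with the coproduct, while \<open>\<succ>\<close> is recovered from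
  \<open>\<prec>\<close> and the product of the primitive part. Connectedness acts through one fact:
  convolution operators are locally nilpotent. So an inhomogeneous convolution equation has a
  solution, and two maps agree as soon as they satisfy the same equation. As \<open>U(L)\<close> and
  \<open>As\<^sup>c(L)\<close> share the basis of words and the coproduct \<open>dec\<close>, the
  isomorphisms amount to equal coordinates.\<close>

definition scl :: "'k::field \<Rightarrow> ('x \<Rightarrow>\<^sub>0 'k) \<Rightarrow> ('x \<Rightarrow>\<^sub>0 'k)" where
  "scl c = Poly_Mapping.map ((*) c)"

abbreviation sg :: "'x \<Rightarrow> ('x \<Rightarrow>\<^sub>0 'k::field)" where
  "sg x \<equiv> Poly_Mapping.single x 1"

lemma lookup_scl [simp]: "Poly_Mapping.lookup (scl c p) x = c * Poly_Mapping.lookup p x"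
  by (simp add: scl_def Poly_Mapping.map.rep_eq when_def)

lemma scl_simps [simp]:
  "scl c 0 = 0" "scl 0 p = 0" "scl 1 p = p" "scl a (scl b p) = scl (a * b) p"
  "scl c (- p) = - scl c p" "scl (- c) p = - scl c p"
  by (auto intro!: poly_mapping_eqI)

lemma scl_single [simp]: "scl a (Poly_Mapping.single x b) = Poly_Mapping.single x (a * b)"
  by (auto intro!: poly_mapping_eqI simp: lookup_single when_def)

lemma scl_add: "scl c (p + q) = scl c p + scl c q"
  and scl_diff: "scl c (p - q) = scl c p - scl c q"
  and scl_add_left: "scl (a + b) p = scl a p + scl b p"
  and scl_diff_left: "scl (a - b) p = scl a p - scl b p"
  by (auto intro!: poly_mapping_eqI simp: lookup_add lookup_minus algebra_simps)

lemma scl_sum: "scl c (sum f A) = (\<Sum>a\<in>A. scl c (f a))"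
  by (induction A rule: infinite_finite_induct) (auto simp: scl_add)

lemma keys_scl: "Poly_Mapping.keys (scl c p) \<subseteq> Poly_Mapping.keys p"
  by (auto simp: in_keys_iff)

lemma sg_inj [simp]: "sg x = (sg y :: 'x \<Rightarrow>\<^sub>0 'k::field) \<longleftrightarrow> x = y"
proof
  assume "sg x = (sg y :: 'x \<Rightarrow>\<^sub>0 'k)"
  then have "Poly_Mapping.lookup (sg x) x = (Poly_Mapping.lookup (sg y) x :: 'k)" by simp
  then show "x = y" by (simp add: lookup_single when_def split: if_splits)
qed simp

text \<open>The bind of the free vector space monad, with \<open>sg\<close> as unit:
  \<open>pbind p f\<close> is the linear extension of \<open>f\<close> at \<open>p\<close>, and
  linear maps compose by \<open>pbind_assoc\<close>. Independent binds commute by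
  \<open>pbind_swap\<close>, which is mostly instantiated at one vector in order to choose the order
  of the binds.\<close>

definition pbind :: "('x \<Rightarrow>\<^sub>0 'k::field) \<Rightarrow> ('x \<Rightarrow> 'y \<Rightarrow>\<^sub>0 'k) \<Rightarrow> ('y \<Rightarrow>\<^sub>0 'k)" where
  "pbind p f = (\<Sum>x\<in>Poly_Mapping.keys p. scl (Poly_Mapping.lookup p x) (f x))"

lemma pbind_superset:
  assumes "finite S" "Poly_Mapping.keys p \<subseteq> S"
  shows "pbind p f = (\<Sum>x\<in>S. scl (Poly_Mapping.lookup p x) (f x))"
  unfolding pbind_def using assms
  by (intro sum.mono_neutral_left) (auto simp: in_keys_iff)

lemma pbind_cong [fundef_cong]:
  "p = q \<Longrightarrow> (\<And>x. x \<in> Poly_Mapping.keys q \<Longrightarrow> f x = g x) \<Longrightarrow> pbind p f = pbind q g"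
  by (simp add: pbind_def)

lemma pbind_0 [simp]: "pbind 0 f = 0"
  by (simp add: pbind_def)

lemma pbind_0_right [simp]: "pbind p (\<lambda>x. 0) = 0"
  by (simp add: pbind_def)

lemma pbind_add: "pbind (p + q) f = pbind p f + pbind q f"
proof -
  let ?S = "Poly_Mapping.keys p \<union> Poly_Mapping.keys q"
  have "Poly_Mapping.keys (p + q) \<subseteq> ?S" by (rule keys_add)
  then show ?thesis
    by (subst (1 2 3) pbind_superset[of ?S]) (auto simp: lookup_add scl_add_left sum.distrib)
qed

lemma pbind_scl: "pbind (scl c p) f = scl c (pbind p f)"
  using keys_scl[of c p]
  by (subst (1 2) pbind_superset[of "Poly_Mapping.keys p"]) (auto simp: scl_sum)

lemma pbind_uminus: "pbind (- p) f = - pbind p f"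
  using pbind_scl[of "-1" p f] by simp

lemma pbind_diff: "pbind (p - q) f = pbind p f - pbind q f"
  using pbind_add[of p "- q" f] by (simp add: pbind_uminus)

lemma pbind_sum: "pbind (sum g A) f = (\<Sum>a\<in>A. pbind (g a) f)"
  by (induction A rule: infinite_finite_induct) (auto simp: pbind_add)

lemma pbind_single [simp]: "pbind (Poly_Mapping.single x c) f = scl c (f x)"
  by (cases "c = 0") (auto simp: pbind_def)

lemma pbind_add_right: "pbind p (\<lambda>x. f x + g x) = pbind p f + pbind p g"
  by (simp add: pbind_def scl_add sum.distrib)

lemma pbind_diff_right: "pbind p (\<lambda>x. f x - g x) = pbind p f - pbind p g"
  by (simp add: pbind_def scl_diff sum_subtractf)

lemma pbind_uminus_right: "pbind p (\<lambda>x. - f x) = - pbind p f"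
  by (simp add: pbind_def sum_negf)

lemma pbind_scl_right: "pbind p (\<lambda>x. scl c (f x)) = scl c (pbind p f)"
  by (simp add: pbind_def scl_sum mult.commute)

lemma pbind_sum_right: "pbind p (\<lambda>x. \<Sum>a\<in>A. f x a) = (\<Sum>a\<in>A. pbind p (\<lambda>x. f x a))"
  by (induction A rule: infinite_finite_induct) (auto simp: pbind_add_right)

lemmas pbind_lin = pbind_add pbind_diff pbind_scl pbind_uminus pbind_add_right pbind_diff_right
  pbind_scl_right pbind_uminus_right

lemma pbind_assoc: "pbind (pbind p f) g = pbind p (\<lambda>x. pbind (f x) g)"
  by (simp add: pbind_def[of p] pbind_sum pbind_scl)

lemma pbind_swap: "pbind p (\<lambda>x. pbind q (f x)) = pbind q (\<lambda>y. pbind p (\<lambda>x. f x y))"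
  by (simp add: pbind_def scl_sum mult.commute sum.swap[of _ "Poly_Mapping.keys q"])

lemma pbind_sg [simp]: "pbind p sg = p"
proof (rule poly_mapping_eqI)
  fix x
  have "Poly_Mapping.lookup (pbind p sg) x =
      (\<Sum>y\<in>Poly_Mapping.keys p. if y = x then Poly_Mapping.lookup p y else 0)"
    unfolding pbind_def lookup_sum by (intro sum.cong) (auto simp: lookup_single when_def)
  also have "\<dots> = Poly_Mapping.lookup p x"
    by (auto simp: in_keys_iff)
  finally show "Poly_Mapping.lookup (pbind p sg) x = Poly_Mapping.lookup p x" .
qed

abbreviation bmul :: "('x \<Rightarrow> 'y \<Rightarrow> 'z \<Rightarrow>\<^sub>0 'k::field) \<Rightarrow> ('x \<Rightarrow>\<^sub>0 'k) \<Rightarrow> ('y \<Rightarrow>\<^sub>0 'k) \<Rightarrow> 'z \<Rightarrow>\<^sub>0 'k" where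
  "bmul m p q \<equiv> pbind p (\<lambda>a. pbind q (m a))"

definition fs :: "'x set \<Rightarrow> ('x \<Rightarrow>\<^sub>0 'k::field) set" where
  "fs X = {p. Poly_Mapping.keys p \<subseteq> X}"

definition subsp :: "('x \<Rightarrow>\<^sub>0 'k::field) set \<Rightarrow> bool" where
  "subsp I \<longleftrightarrow> 0 \<in> I \<and> (\<forall>p\<in>I. \<forall>q\<in>I. p + q \<in> I) \<and> (\<forall>c. \<forall>p\<in>I. scl c p \<in> I)"

lemma subsp_0: "subsp I \<Longrightarrow> 0 \<in> I"
  and subsp_add: "subsp I \<Longrightarrow> p \<in> I \<Longrightarrow> q \<in> I \<Longrightarrow> p + q \<in> I"
  and subsp_scl: "subsp I \<Longrightarrow> p \<in> I \<Longrightarrow> scl c p \<in> I"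
  by (auto simp: subsp_def)

lemma subsp_uminus: "subsp I \<Longrightarrow> p \<in> I \<Longrightarrow> - p \<in> I"
  using subsp_scl[of I p "-1"] by simp

lemma subsp_diff: "subsp I \<Longrightarrow> p \<in> I \<Longrightarrow> q \<in> I \<Longrightarrow> p - q \<in> I"
  using subsp_add[of I p "-q"] subsp_uminus[of I q] by simp

lemma subsp_sum: "subsp I \<Longrightarrow> (\<And>a. a \<in> A \<Longrightarrow> f a \<in> I) \<Longrightarrow> sum f A \<in> I"
  by (induction A rule: infinite_finite_induct) (auto simp: subsp_0 subsp_add)

lemma subsp_pbind: "subsp I \<Longrightarrow> (\<And>x. x \<in> Poly_Mapping.keys p \<Longrightarrow> f x \<in> I) \<Longrightarrow> pbind p f \<in> I"
  unfolding pbind_def by (intro subsp_sum subsp_scl)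

lemmas subsp_intros = subsp_0 subsp_add subsp_scl subsp_uminus subsp_diff subsp_sum subsp_pbind

lemma subsp_fs [simp]: "subsp (fs X)"
  unfolding subsp_def fs_def by (auto dest!: keys_add[THEN subsetD] keys_scl[THEN subsetD])

lemma fs_0 [simp]: "0 \<in> fs X"
  by (simp add: fs_def)

lemma fs_single [simp]: "Poly_Mapping.single x a \<in> fs X \<longleftrightarrow> a = 0 \<or> x \<in> X"
  by (simp add: fs_def)

lemmas fs_intros = fs_0 subsp_intros[OF subsp_fs]

lemma fs_UNIV [simp]: "fs UNIV = UNIV"
  by (auto simp: fs_def)

lemma fs_keys: "p \<in> fs X \<Longrightarrow> x \<in> Poly_Mapping.keys p \<Longrightarrow> x \<in> X"
  by (auto simp: fs_def)

lemma fs_pbind: "p \<in> fs X \<Longrightarrow> (\<And>x. x \<in> X \<Longrightarrow> f x \<in> fs Y) \<Longrightarrow> pbind p f \<in> fs Y"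
  by (intro subsp_pbind) (auto dest: fs_keys)

lemma fs_pbind_cong: "p \<in> fs X \<Longrightarrow> (\<And>x. x \<in> X \<Longrightarrow> f x = g x) \<Longrightarrow> pbind p f = pbind p g"
  by (intro pbind_cong) (auto dest: fs_keys)

section \<open>Coordinates\<close>

text \<open>Only closure and a linear bijection onto \<open>fs X\<close> are assumed; the vector
  space axioms are pulled back along \<open>c\<close> in the sublocale below. A newly built space is
  thus a vector space as soon as it has coordinates.\<close>

locale coord =
  fixes V :: "('k::field, 'a, 'm) module_scheme" (structure)
    and X :: "'x set" and c :: "'a \<Rightarrow> 'x \<Rightarrow>\<^sub>0 'k"
  assumes c_bij: "bij_betw c (carrier V) (fs X)"
    and zero_mem: "\<zero> \<in> carrier V"
    and add_mem: "\<lbrakk>x \<in> carrier V; y \<in> carrier V\<rbrakk> \<Longrightarrow> x \<oplus> y \<in> carrier V"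
    and smult_mem: "x \<in> carrier V \<Longrightarrow> a \<odot> x \<in> carrier V"
    and c_zero [simp]: "c \<zero> = 0"
    and c_add [simp]: "\<lbrakk>x \<in> carrier V; y \<in> carrier V\<rbrakk> \<Longrightarrow> c (x \<oplus> y) = c x + c y"
    and c_smult [simp]: "x \<in> carrier V \<Longrightarrow> c (a \<odot> x) = scl a (c x)"
begin

lemma c_mem: "x \<in> carrier V \<Longrightarrow> c x \<in> fs X"
  using c_bij by (auto simp: bij_betw_def)

lemma c_inj: "x \<in> carrier V \<Longrightarrow> y \<in> carrier V \<Longrightarrow> c x = c y \<longleftrightarrow> x = y"
  using c_bij by (auto simp: bij_betw_def inj_on_def)

lemma c_eq_0_iff: "x \<in> carrier V \<Longrightarrow> c x = 0 \<longleftrightarrow> x = \<zero>"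
  using c_inj[of x \<zero>] zero_mem by simp

definition vec :: "('x \<Rightarrow>\<^sub>0 'k) \<Rightarrow> 'a" where
  "vec p = inv_into (carrier V) c p"

lemma vec_mem: "p \<in> fs X \<Longrightarrow> vec p \<in> carrier V"
  unfolding vec_def using c_bij by (metis bij_betw_def inv_into_into)

lemma c_vec [simp]: "p \<in> fs X \<Longrightarrow> c (vec p) = p"
  unfolding vec_def using c_bij by (metis bij_betw_def f_inv_into_f)

lemma vec_c [simp]: "x \<in> carrier V \<Longrightarrow> vec (c x) = x"
  using c_inj[of "vec (c x)" x] by (simp add: c_mem vec_mem)

lemma vec_eqI: "x \<in> carrier V \<Longrightarrow> p = c x \<Longrightarrow> vec p = x"
  by simp

lemma eqI: "x \<in> carrier V \<Longrightarrow> y \<in> carrier V \<Longrightarrow> c x = c y \<Longrightarrow> x = y"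
  using c_inj by blast

sublocale vectorspace class_ring V
proof -
  have ab: "abelian_group V"
  proof (rule abelian_groupI)
    fix x assume x: "x \<in> carrier V"
    have "(-1) \<odot> x \<in> carrier V \<and> (-1) \<odot> x \<oplus> x = \<zero>"
      using x by (auto intro!: eqI add_mem smult_mem zero_mem simp: smult_mem)
    then show "\<exists>y\<in>carrier V. y \<oplus> x = \<zero>" by blast
  qed (auto intro!: eqI add_mem zero_mem simp: add_mem zero_mem ac_simps)
  have "module class_ring V"
    by (intro Module.module.intro ab Module.module_axioms.intro domain.axioms(1)[OF field.axioms(1)[OF class_field]])
       (auto intro!: eqI add_mem smult_mem simp: smult_mem add_mem scl_add scl_add_left)
  then show "vectorspace class_ring V"
    by (intro vectorspace.intro class_field)
qed

lemma c_minus [simp]: "x \<in> carrier V \<Longrightarrow> y \<in> carrier V \<Longrightarrow> c (x \<ominus> y) = c x - c y"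
proof -
  assume xy: "x \<in> carrier V" "y \<in> carrier V"
  then have "c (x \<ominus> y) + c y = c ((x \<ominus> y) \<oplus> y)" by simp
  also have "(x \<ominus> y) \<oplus> y = x" using xy
    by (simp add: a_minus_def a_assoc l_neg)
  finally show "c (x \<ominus> y) = c x - c y" by (simp add: algebra_simps)
qed

lemma finsum_coord:
  assumes "\<And>i. i \<in> S \<Longrightarrow> f i \<in> carrier V"
  shows "c (finsum V f S) = (\<Sum>i\<in>S. c (f i))"
proof (cases "finite S")
  case True
  then show ?thesis using assms
    by (induction S) (auto simp: Pi_def finsum_closed)
next
  case False
  then show ?thesis by (simp add: finsum_infinite)
qed

lemma lin_ext_mem: "(\<And>x. x \<in> Poly_Mapping.keys p \<Longrightarrow> f x \<in> carrier V) \<Longrightarrow> lin_ext V f p \<in> carrier V"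
  unfolding lin_ext_def by (intro finsum_closed) (auto intro!: smult_mem)

lemma c_lin_ext:
  "(\<And>x. x \<in> Poly_Mapping.keys p \<Longrightarrow> f x \<in> carrier V) \<Longrightarrow> c (lin_ext V f p) = pbind p (\<lambda>x. c (f x))"
  unfolding lin_ext_def pbind_def by (subst finsum_coord) (auto intro!: smult_mem sum.cong)

lemma ex_mem: "x \<in> X \<Longrightarrow> vec (sg x) \<in> carrier V"
  by (simp add: vec_mem)

end

lemma coord_free_space: "coord (free_space X) X id"
  by standard (auto simp: free_space_def fs_def scl_def[symmetric] bij_betw_def
      dest!: keys_add[THEN subsetD] keys_scl[THEN subsetD])

lemma carrier_free_space [simp]: "carrier (free_space X) = fs X"
  and zero_free_space [simp]: "\<zero>\<^bsub>free_space X\<^esub> = 0"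
  and add_free_space [simp]: "x \<oplus>\<^bsub>free_space X\<^esub> y = x + y"
  and smult_free_space [simp]: "a \<odot>\<^bsub>free_space X\<^esub> x = scl a x"
  by (auto simp: free_space_def fs_def scl_def)

lemma coord_linear_iso: "coord V X c \<Longrightarrow> coord W X d \<Longrightarrow> (\<And>x. x \<in> carrier V \<Longrightarrow> f x \<in> carrier W \<and> d (f x) = c x)
   \<Longrightarrow> linear_iso V W f"
proof -
  assume V: "coord V X c" and W: "coord W X d"
    and f: "\<And>x. x \<in> carrier V \<Longrightarrow> f x \<in> carrier W \<and> d (f x) = c x"
  interpret V: coord V X c by fact
  interpret W: coord W X d by fact
  have "f \<in> LinearCombinations.module_hom class_ring V W"
    unfolding LinearCombinations.module_hom_def using f
    by (auto intro!: W.eqI simp: V.add_mem V.smult_mem W.add_mem W.smult_mem)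
  moreover have "bij_betw f (carrier V) (carrier W)"
    by (rule bij_betwI[of _ _ _ "\<lambda>y. V.vec (d y)"])
       (auto simp: f V.vec_mem W.c_mem intro!: W.eqI)
  ultimately show ?thesis unfolding linear_iso_def
    by (intro conjI linear_map.intro mod_hom.intro mod_hom_axioms.intro V.vectorspace_axioms
        W.vectorspace_axioms V.module_axioms W.module_axioms)
qed

lemma coord_linear_map: 
  assumes V: "coord V X c" and W: "coord W Y d" 
    and f: "\<And>x. x \<in> carrier V \<Longrightarrow> f x \<in> carrier W \<and> d (f x) = pbind (c x) F"
  shows "linear_map class_ring V W f"
proof -
  interpret V: coord V X c by fact
  interpret W: coord W Y d by fact
  have "f \<in> LinearCombinations.module_hom class_ring V W"
    unfolding LinearCombinations.module_hom_def using f
    by (auto intro!: W.eqI simp: V.add_mem V.smult_mem W.add_mem W.smult_mem pbind_lin)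
  then show ?thesis
    by (intro linear_map.intro mod_hom.intro mod_hom_axioms.intro V.vectorspace_axioms
        W.vectorspace_axioms V.module_axioms W.module_axioms)
qed

lemma linear_map_coord:
  fixes V :: "('k::field, 'a, 'm) module_scheme" and W :: "('k, 'b, 'n) module_scheme"
  assumes V: "coord V X c" and W: "coord W Y d" and f: "linear_map class_ring V W f"
    and x: "x \<in> carrier V"
  shows "f x \<in> carrier W" "d (f x) = pbind (c x) (\<lambda>a. d (f (coord.vec V c (sg a))))"
proof -
  interpret V: coord V X c by fact
  interpret W: coord W Y d by fact
  interpret f: linear_map class_ring V W f by fact
  have f_mem: "f x \<in> carrier W" if "x \<in> carrier V" for x
    using f.f_hom that by (auto simp: LinearCombinations.module_hom_def)
  then show "f x \<in> carrier W" using x by simp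
  let ?v = "\<lambda>a. V.vec (sg a)"
  have v: "?v a \<in> carrier V" if "a \<in> Poly_Mapping.keys (c x)" for a
    using that V.c_mem[OF x] by (auto intro!: V.ex_mem dest: fs_keys)
  define S where "S = Poly_Mapping.keys (c x)"
  have x_eq: "x = lin_ext V ?v (c x)"
    using v V.c_mem[OF x]
    by (intro V.eqI x V.lin_ext_mem) (auto simp: V.c_lin_ext intro!: fs_pbind_cong[of _ X, THEN trans[OF _ pbind_sg], symmetric])
  have "d (f (finsum V (\<lambda>a. b a \<odot>\<^bsub>V\<^esub> ?v a) S)) = (\<Sum>a\<in>S. scl (b a) (d (f (?v a))))" 
    if "finite S" "\<And>a. a \<in> S \<Longrightarrow> ?v a \<in> carrier V" for S b
    using that
  proof (induction S)
    case empty
    have "f \<zero>\<^bsub>V\<^esub> = f (0 \<odot>\<^bsub>V\<^esub> \<zero>\<^bsub>V\<^esub>)" by (intro arg_cong[of _ _ f] V.eqI) (auto simp: V.zero_mem V.smult_mem)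
    also have "\<dots> = 0 \<odot>\<^bsub>W\<^esub> f \<zero>\<^bsub>V\<^esub>" using V.zero_mem by (subst f.f_smult) auto
    finally have "d (f \<zero>\<^bsub>V\<^esub>) = scl 0 (d (f \<zero>\<^bsub>V\<^esub>))" using V.zero_mem f_mem by (metis W.c_smult)
    then show ?case by simp
  next
    case (insert a S)
    then show ?case
      by (simp add: Pi_def V.smult_mem f_mem)
  qed
  note fin = this
  have "d (f x) = d (f (lin_ext V ?v (c x)))"
    by (subst x_eq[symmetric]) (rule refl)
  also have "\<dots> = pbind (c x) (\<lambda>a. d (f (?v a)))"
    unfolding lin_ext_def pbind_def by (rule fin[OF finite_keys v])
  finally show "d (f x) = pbind (c x) (\<lambda>a. d (f (?v a)))" .
qed

lemma coord_cong:
  assumes "coord V X c" "carrier W = carrier V" "\<And>x y. x \<in> carrier V \<Longrightarrow> y \<in> carrier V \<Longrightarrow> x \<oplus>\<^bsub>W\<^esub> y = x \<oplus>\<^bsub>V\<^esub> y"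
    "\<And>a x. x \<in> carrier V \<Longrightarrow> a \<odot>\<^bsub>W\<^esub> x = a \<odot>\<^bsub>V\<^esub> x" "\<zero>\<^bsub>W\<^esub> = \<zero>\<^bsub>V\<^esub>" "\<And>x. x \<in> carrier V \<Longrightarrow> d x = c x"
  shows "coord W X d"
proof -
  interpret coord V X c by fact
  have "bij_betw d (carrier V) (fs X)" using c_bij assms(6) by (metis bij_betw_cong)
  then show ?thesis
    by unfold_locales (auto simp: assms add_mem smult_mem zero_mem)
qed

lemma coord_subspace:
  assumes "coord V X c" "S \<subseteq> carrier V" "c ` S = fs Y" 
    "carrier W = S" "\<And>x y. x \<in> S \<Longrightarrow> y \<in> S \<Longrightarrow> x \<oplus>\<^bsub>W\<^esub> y = x \<oplus>\<^bsub>V\<^esub> y"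
    "\<And>a x. x \<in> S \<Longrightarrow> a \<odot>\<^bsub>W\<^esub> x = a \<odot>\<^bsub>V\<^esub> x" "\<zero>\<^bsub>W\<^esub> = \<zero>\<^bsub>V\<^esub>"
  shows "coord W Y c"
proof -
  interpret coord V X c by fact
  have S: "x \<in> S \<longleftrightarrow> x \<in> carrier V \<and> c x \<in> fs Y" for x
    using assms(2) c_inj unfolding assms(3)[symmetric] by blast
  have "inj_on c S" using c_bij assms(2) by (meson bij_betw_def inj_on_subset)
  then have "bij_betw c S (fs Y)" using assms(3) by (simp add: bij_betw_def)
  then show ?thesis
    by unfold_locales (auto simp: S assms add_mem smult_mem zero_mem intro!: fs_intros)
qed

section \<open>Complements, bases and quotients\<close>

text \<open>\<open>Y\<close> is maximal, by Zorn, among the subsets of \<open>X\<close> whose span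
  meets \<open>I\<close> only in 0. Then every basis vector is congruent modulo \<open>I\<close> to
  a vector supported on \<open>Y\<close>, and \<open>q\<close> picks that vector. So
  \<open>Y\<close> is a basis of the quotient by \<open>I\<close> made of old basis
  elements.\<close>

lemma complement_projection:
  fixes I :: "('x \<Rightarrow>\<^sub>0 'k::field) set"
  assumes I: "subsp I"
  obtains Y q where "Y \<subseteq> X" "\<And>x. x \<in> X \<Longrightarrow> q x \<in> fs Y" "\<And>p. p \<in> fs X \<Longrightarrow> pbind p q = 0 \<longleftrightarrow> p \<in> I"
    "\<And>y. y \<in> Y \<Longrightarrow> q y = sg y"
proof -
  define A where "A = {Y. Y \<subseteq> X \<and> fs Y \<inter> I \<subseteq> {0}}"
  have "\<exists>Y\<in>A. \<forall>Z\<in>A. Y \<subseteq> Z \<longrightarrow> Z = Y"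
  proof (rule subset_Zorn')
    fix C assume C: "subset.chain A C"
    have CA: "C \<subseteq> A" using C by (simp add: subset.chain_def)
    have "p = 0" if "p \<in> fs (\<Union>C)" "p \<in> I" for p
    proof (cases "C = {}")
      case True
      then show ?thesis using that by (simp add: fs_def)
    next
      case False
      have "finite (Poly_Mapping.keys p)" "Poly_Mapping.keys p \<subseteq> \<Union>C"
        using that by (auto simp: fs_def)
      then obtain B where "B \<in> C" "Poly_Mapping.keys p \<subseteq> B"
        using finite_subset_Union_chain[OF _ _ False C] by blast
      moreover have "B \<in> A" using CA \<open>B \<in> C\<close> by blast
      ultimately have "p \<in> fs B \<inter> I" "fs B \<inter> I \<subseteq> {0}" using that by (auto simp: A_def fs_def)
      then show ?thesis by blast
    qed
    then show "\<Union>C \<in> A" using CA by (auto simp: A_def)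
  qed
  then obtain Y where Y: "Y \<in> A" and max: "\<And>Z. Z \<in> A \<Longrightarrow> Y \<subseteq> Z \<Longrightarrow> Z = Y" by blast
  have YX: "Y \<subseteq> X" and ind: "\<And>p. p \<in> fs Y \<Longrightarrow> p \<in> I \<Longrightarrow> p = 0" using Y by (auto simp: A_def)
  have ex: "\<exists>q. q \<in> fs Y \<and> sg x - q \<in> I \<and> (x \<in> Y \<longrightarrow> q = sg x)" if x: "x \<in> X" for x
  proof (cases "x \<in> Y")
    case True
    then show ?thesis using I by (intro exI[of _ "sg x"]) (auto simp: subsp_0)
  next
    case False
    \<comment> \<open>Maximality gives a nonzero relation in \<open>I\<close> supported on
      \<open>insert x Y\<close>. Its coefficient at \<open>x\<close> cannot vanish, since
      \<open>fs Y\<close> meets \<open>I\<close> only in 0, so the relation can be solved for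
      \<open>x\<close>.\<close>
    then have "insert x Y \<notin> A" using max[of "insert x Y"] by auto
    then obtain p where p: "p \<in> fs (insert x Y)" "p \<in> I" "p \<noteq> 0"
      using x YX by (auto simp: A_def)
    define a where "a = Poly_Mapping.lookup p x"
    have "a \<noteq> 0"
    proof
      assume "a = 0"
      then have "p \<in> fs Y" using p(1) by (auto simp: fs_def a_def in_keys_iff)
      then show False using ind p by blast
    qed
    define q where "q = sg x - scl (1 / a) p"
    have "y \<in> Y" if "y \<in> Poly_Mapping.keys q" for y
    proof (rule ccontr)
      assume "y \<notin> Y"
      show False
      proof (cases "y = x")
        case True
        then show False using that \<open>a \<noteq> 0\<close> by (simp add: q_def in_keys_iff lookup_minus a_def)
      next
        case False
        then have "y \<notin> Poly_Mapping.keys p" using \<open>y \<notin> Y\<close> p(1) by (auto simp: fs_def)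
        then show False using that False
          by (simp add: q_def in_keys_iff lookup_minus lookup_single when_def)
      qed
    qed
    then have "q \<in> fs Y" by (auto simp: fs_def)
    moreover have "sg x - q \<in> I" using p I by (simp add: q_def subsp_scl)
    ultimately show ?thesis using False by blast
  qed
  define q where "q x = (SOME q. q \<in> fs Y \<and> sg x - q \<in> I \<and> (x \<in> Y \<longrightarrow> q = sg x))" for x
  have q: "q x \<in> fs Y" "sg x - q x \<in> I" "x \<in> Y \<Longrightarrow> q x = sg x" if "x \<in> X" for x
    using someI_ex[OF ex[OF that]] unfolding q_def by auto
  have d: "p - pbind p q \<in> I" if "p \<in> fs X" for p
  proof -
    have "p - pbind p q = pbind p (\<lambda>x. sg x - q x)" by (simp add: pbind_diff_right)
    then show ?thesis using q(2) that I by (auto intro!: subsp_pbind dest: fs_keys)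
  qed
  show ?thesis
  proof (rule that[of Y q, OF YX])
    fix p :: "'x \<Rightarrow>\<^sub>0 'k" assume p: "p \<in> fs X"
    show "pbind p q = 0 \<longleftrightarrow> p \<in> I"
    proof
      assume "pbind p q = 0"
      then show "p \<in> I" using d[OF p] by simp
    next
      assume "p \<in> I"
      then have "pbind p q \<in> I" using subsp_diff[OF I _ d[OF p], of p] by simp
      moreover have "pbind p q \<in> fs Y" by (rule fs_pbind[OF p]) (rule q(1))
      ultimately show "pbind p q = 0" using ind by blast
    qed
  qed (use q YX in auto)
qed

lemma lin_ext_lin:
  fixes V :: "('k::field, 'a, 'm) module_scheme"
  assumes "vectorspace class_ring V"
    and f: "\<And>x. x \<in> Poly_Mapping.keys p \<Longrightarrow> f x \<in> carrier V"
      "\<And>x. x \<in> Poly_Mapping.keys q \<Longrightarrow> f x \<in> carrier V"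
  shows "lin_ext V f (p + q) = lin_ext V f p \<oplus>\<^bsub>V\<^esub> lin_ext V f q"
    and "lin_ext V f (scl a p) = a \<odot>\<^bsub>V\<^esub> lin_ext V f p"
proof -
  interpret vectorspace class_ring V by fact
  have sup: "lin_ext V f r = (\<Oplus>\<^bsub>V\<^esub>x\<in>S. Poly_Mapping.lookup r x \<odot>\<^bsub>V\<^esub> f x)"
    if "finite S" "Poly_Mapping.keys r \<subseteq> S" "\<And>x. x \<in> S \<Longrightarrow> f x \<in> carrier V" for r S
    unfolding lin_ext_def
  proof (rule add.finprod_mono_neutral_cong_left[OF that(1,2)])
    fix x assume "x \<in> S - Poly_Mapping.keys r"
    then show "Poly_Mapping.lookup r x \<odot>\<^bsub>V\<^esub> f x = \<zero>\<^bsub>V\<^esub>"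
      using that(3)[of x] smult_l_null[of "f x"] by (simp add: in_keys_iff)
  qed (use that(3) in auto)
  let ?S = "Poly_Mapping.keys p \<union> Poly_Mapping.keys q"
  have S: "finite ?S" "\<And>x. x \<in> ?S \<Longrightarrow> f x \<in> carrier V" using f by auto
  have m: "(\<lambda>x. Poly_Mapping.lookup r x \<odot>\<^bsub>V\<^esub> f x) \<in> ?S \<rightarrow> carrier V" for r
    using S by auto
  have "lin_ext V f (p + q) = (\<Oplus>\<^bsub>V\<^esub>x\<in>?S. Poly_Mapping.lookup (p + q) x \<odot>\<^bsub>V\<^esub> f x)"
    by (rule sup) (use S keys_add[of p q] in auto)
  also have "\<dots> = (\<Oplus>\<^bsub>V\<^esub>x\<in>?S. Poly_Mapping.lookup p x \<odot>\<^bsub>V\<^esub> f x \<oplus>\<^bsub>V\<^esub> Poly_Mapping.lookup q x \<odot>\<^bsub>V\<^esub> f x)"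
    using S smult_l_distr by (intro finsum_cong') (auto simp: lookup_add)
  also have "\<dots> = (\<Oplus>\<^bsub>V\<^esub>x\<in>?S. Poly_Mapping.lookup p x \<odot>\<^bsub>V\<^esub> f x) \<oplus>\<^bsub>V\<^esub> (\<Oplus>\<^bsub>V\<^esub>x\<in>?S. Poly_Mapping.lookup q x \<odot>\<^bsub>V\<^esub> f x)"
    by (rule finsum_addf[OF m m])
  also have "\<dots> = lin_ext V f p \<oplus>\<^bsub>V\<^esub> lin_ext V f q"
    using S by (subst (1 2) sup[of ?S]) auto
  finally show "lin_ext V f (p + q) = lin_ext V f p \<oplus>\<^bsub>V\<^esub> lin_ext V f q" .
  have "lin_ext V f (scl a p) = (\<Oplus>\<^bsub>V\<^esub>x\<in>?S. Poly_Mapping.lookup (scl a p) x \<odot>\<^bsub>V\<^esub> f x)"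
    by (rule sup) (use S keys_scl[of a p] in auto)
  also have "\<dots> = (\<Oplus>\<^bsub>V\<^esub>x\<in>?S. a \<odot>\<^bsub>V\<^esub> (Poly_Mapping.lookup p x \<odot>\<^bsub>V\<^esub> f x))"
    using S smult_assoc1 by (intro finsum_cong') auto
  also have "\<dots> = a \<odot>\<^bsub>V\<^esub> (\<Oplus>\<^bsub>V\<^esub>x\<in>?S. Poly_Mapping.lookup p x \<odot>\<^bsub>V\<^esub> f x)"
    using finsum_smult_ldistr[OF S(1), of a "\<lambda>x. Poly_Mapping.lookup p x \<odot>\<^bsub>V\<^esub> f x"] m by simp
  also have "\<dots> = a \<odot>\<^bsub>V\<^esub> lin_ext V f p"
    using S by (subst sup[of ?S]) auto
  finally show "lin_ext V f (scl a p) = a \<odot>\<^bsub>V\<^esub> lin_ext V f p" .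
qed

text \<open>\<open>V\<close> is the quotient of the free vector space on its own carrier by the
  kernel of \<open>L\<close>, which evaluates formal combinations. The complement of that kernel
  consists of elements of \<open>V\<close>, which form a Hamel basis.\<close>

lemma vectorspace_coord:
  fixes V :: "('k::field, 'a, 'm) module_scheme"
  assumes "vectorspace class_ring V"
  obtains X :: "'a set" and c where "coord V X c"
proof -
  interpret vectorspace class_ring V by fact
  define L where "L = lin_ext V id"
  have L_add: "L (p + q) = L p \<oplus>\<^bsub>V\<^esub> L q" if "p \<in> fs (carrier V)" "q \<in> fs (carrier V)" for p q
    unfolding L_def using that vectorspace_axioms by (intro lin_ext_lin) (auto dest: fs_keys)
  have L_scl: "L (scl a p) = a \<odot>\<^bsub>V\<^esub> L p" if "p \<in> fs (carrier V)" for p a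
    unfolding L_def using that vectorspace_axioms by (intro lin_ext_lin[where q = 0]) (auto dest: fs_keys)
  have L_mem: "L p \<in> carrier V" if "p \<in> fs (carrier V)" for p
    unfolding L_def lin_ext_def using that by (intro finsum_closed) (auto dest: fs_keys)
  have L_sg: "L (sg x) = x" if "x \<in> carrier V" for x
    using that smult_one[of x] by (simp add: L_def lin_ext_def)
  have L_0: "L 0 = \<zero>\<^bsub>V\<^esub>" by (simp add: L_def lin_ext_def)
  define I where "I = {p \<in> fs (carrier V). L p = \<zero>\<^bsub>V\<^esub>}"
  have I: "subsp I" 
    using smult_r_null by (auto simp: subsp_def I_def L_0 L_add L_scl intro: fs_intros)
  have L_diff: "L (p - q) = \<zero>\<^bsub>V\<^esub> \<longleftrightarrow> L p = L q" if "p \<in> fs (carrier V)" "q \<in> fs (carrier V)" for p q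
  proof -
    have "L ((p - q) + q) = L (p - q) \<oplus>\<^bsub>V\<^esub> L q"
      by (intro L_add fs_intros that)
    then have "L p = L (p - q) \<oplus>\<^bsub>V\<^esub> L q" by simp
    then show ?thesis using that by (auto simp: L_mem fs_intros)
  qed
  obtain Y q where Y: "Y \<subseteq> carrier V" and q: "\<And>x. x \<in> carrier V \<Longrightarrow> q x \<in> fs Y"
    and ker: "\<And>p. p \<in> fs (carrier V) \<Longrightarrow> pbind p q = 0 \<longleftrightarrow> p \<in> I"
    and qY: "\<And>y. y \<in> Y \<Longrightarrow> q y = sg y"
    using complement_projection[OF I, of "carrier V"] by blast
  have ker': "pbind p q = pbind r q \<longleftrightarrow> L p = L r" if "p \<in> fs (carrier V)" "r \<in> fs (carrier V)" for p r
  proof -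
    have "pbind p q = pbind r q \<longleftrightarrow> pbind (p - r) q = 0" by (simp add: pbind_diff)
    also have "\<dots> \<longleftrightarrow> L (p - r) = \<zero>\<^bsub>V\<^esub>" using that by (subst ker) (auto simp: I_def intro: fs_intros)
    finally show ?thesis using L_diff that by simp
  qed
  have inj: "q x = q y \<longleftrightarrow> x = y" if "x \<in> carrier V" "y \<in> carrier V" for x y
    using ker'[of "sg x" "sg y"] that by (simp add: L_sg)
  have surj: "\<exists>x\<in>carrier V. q x = p" if "p \<in> fs Y" for p
  proof -
    have p: "p \<in> fs (carrier V)" using that Y by (auto simp: fs_def)
    have "q (L p) = pbind p q"
      using ker'[of "sg (L p)" p] p by (simp add: L_mem L_sg)
    also have "pbind p q = p" using fs_pbind_cong[OF that qY] by simp
    finally show ?thesis using L_mem[OF p] by blast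
  qed
  have "bij_betw q (carrier V) (fs Y)"
    unfolding bij_betw_def inj_on_def using q surj by (force simp: inj)
  then have "coord V Y q"
  proof (unfold_locales, goal_cases)
    case (5)
    then show ?case using ker'[of 0 "sg \<zero>\<^bsub>V\<^esub>"] by (simp add: L_sg L_0)
  next
    case (6 x y)
    then show ?case using ker'[of "sg x + sg y" "sg (x \<oplus>\<^bsub>V\<^esub> y)"]
      by (simp add: L_sg L_add pbind_add fs_intros)
  next
    case (7 x a)
    then show ?case using ker'[of "scl a (sg x)" "sg (a \<odot>\<^bsub>V\<^esub> x)"] L_scl[of "sg x" a]
      by (simp add: L_sg fs_def split: if_splits)
  qed auto
  then show ?thesis by (rule that)
qed

text \<open>The first isomorphism theorem in coordinates: a surjection \<open>q\<close> with kernel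
  \<open>N\<close> gives coordinates on the quotient. The index set \<open>Y\<close> is left open,
  so it can be a set of basis elements from \<open>complement_projection\<close> or an explicit
  model such as words.\<close>

locale coord_quot = coord M X c for M :: "('k::field, 'a, 'm) module_scheme" and X :: "'x set" and c +
  fixes N :: "'a set" and Y :: "'y set" and q :: "'x \<Rightarrow> 'y \<Rightarrow>\<^sub>0 'k"
  assumes q_mem: "a \<in> X \<Longrightarrow> q a \<in> fs Y"
    and q_surj: "p \<in> fs Y \<Longrightarrow> \<exists>r\<in>fs X. pbind r q = p"
    and q_ker: "x \<in> carrier M \<Longrightarrow> pbind (c x) q = 0 \<longleftrightarrow> x \<in> N"
    and N_sub: "N \<subseteq> carrier M"
begin

definition qc :: "'a set \<Rightarrow> 'y \<Rightarrow>\<^sub>0 'k" where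
  "qc C = the_elem ((\<lambda>x. pbind (c x) q) ` C)"

lemma coset_eq:
  assumes "x \<in> carrier M"
  shows "N +>\<^bsub>M\<^esub> x = {y \<in> carrier M. pbind (c y) q = pbind (c x) q}"
proof -
  have "y \<in> N +>\<^bsub>M\<^esub> x \<longleftrightarrow> pbind (c y) q = pbind (c x) q" if "y \<in> carrier M" for y
  proof
    assume "y \<in> N +>\<^bsub>M\<^esub> x"
    then obtain h where "h \<in> N" "y = h \<oplus>\<^bsub>M\<^esub> x" by (auto simp: a_r_coset_def')
    then show "pbind (c y) q = pbind (c x) q"
      using N_sub q_ker[of h] assms by (auto simp: pbind_add)
  next
    assume "pbind (c y) q = pbind (c x) q"
    then have "y \<ominus>\<^bsub>M\<^esub> x \<in> N"
      using q_ker[of "y \<ominus>\<^bsub>M\<^esub> x"] that assms by (simp add: pbind_diff)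
    moreover have "y = (y \<ominus>\<^bsub>M\<^esub> x) \<oplus>\<^bsub>M\<^esub> x" using that assms by (intro eqI) auto
    ultimately show "y \<in> N +>\<^bsub>M\<^esub> x" by (auto simp: a_r_coset_def')
  qed
  moreover have "N +>\<^bsub>M\<^esub> x \<subseteq> carrier M" using N_sub assms by (auto simp: a_r_coset_def')
  ultimately show ?thesis by blast
qed

lemma qc_coset [simp]: "x \<in> carrier M \<Longrightarrow> qc (N +>\<^bsub>M\<^esub> x) = pbind (c x) q"
  unfolding qc_def by (rule the_elem_image_unique) (auto simp: coset_eq)

lemma carrier_quotient: "carrier (quotient_space M N) = (\<lambda>x. N +>\<^bsub>M\<^esub> x) ` carrier M"
  by (auto simp: quotient_space_def A_RCOSETS_def')

lemma coset_eq_iff: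
  "x \<in> carrier M \<Longrightarrow> y \<in> carrier M \<Longrightarrow> N +>\<^bsub>M\<^esub> x = N +>\<^bsub>M\<^esub> y \<longleftrightarrow> pbind (c x) q = pbind (c y) q"
  by (auto simp: coset_eq)

lemma add_quotient:
  assumes "x \<in> carrier M" "y \<in> carrier M"
  shows "(N +>\<^bsub>M\<^esub> x) \<oplus>\<^bsub>quotient_space M N\<^esub> (N +>\<^bsub>M\<^esub> y) = N +>\<^bsub>M\<^esub> (x \<oplus>\<^bsub>M\<^esub> y)"
proof -
  have "z \<in> (N +>\<^bsub>M\<^esub> x) <+>\<^bsub>M\<^esub> (N +>\<^bsub>M\<^esub> y)" if "z \<in> carrier M" "pbind (c z) q = pbind (c x) q + pbind (c y) q" for z
  proof -
    have "z = x \<oplus>\<^bsub>M\<^esub> (z \<ominus>\<^bsub>M\<^esub> x)" using that assms by (intro eqI) auto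
    moreover have "z \<ominus>\<^bsub>M\<^esub> x \<in> N +>\<^bsub>M\<^esub> y" using that assms by (auto simp: coset_eq pbind_diff)
    moreover have "x \<in> N +>\<^bsub>M\<^esub> x" using assms by (auto simp: coset_eq)
    ultimately show ?thesis unfolding set_add_def' by blast
  qed
  then show ?thesis using assms
    by (auto simp: quotient_space_def coset_eq pbind_add) (auto simp: set_add_def' pbind_add)
qed

lemma smult_quotient:
  assumes "x \<in> carrier M"
  shows "a \<odot>\<^bsub>quotient_space M N\<^esub> (N +>\<^bsub>M\<^esub> x) = N +>\<^bsub>M\<^esub> (a \<odot>\<^bsub>M\<^esub> x)"
proof -
  have "x \<in> N +>\<^bsub>M\<^esub> x" using assms by (simp add: coset_eq)
  moreover have "N +>\<^bsub>M\<^esub> (a \<odot>\<^bsub>M\<^esub> y) = N +>\<^bsub>M\<^esub> (a \<odot>\<^bsub>M\<^esub> x)" if "y \<in> N +>\<^bsub>M\<^esub> x" for y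
    using that assms by (auto simp: coset_eq smult_mem pbind_scl)
  ultimately have "(\<Union>y\<in>N +>\<^bsub>M\<^esub> x. N +>\<^bsub>M\<^esub> (a \<odot>\<^bsub>M\<^esub> y)) = N +>\<^bsub>M\<^esub> (a \<odot>\<^bsub>M\<^esub> x)"
    by blast
  then show ?thesis by (simp only: quotient_space_def module.simps)
qed

lemma zero_quotient: "\<zero>\<^bsub>quotient_space M N\<^esub> = N +>\<^bsub>M\<^esub> \<zero>\<^bsub>M\<^esub>"
  using N_sub by (auto simp: quotient_space_def coset_eq zero_mem q_ker)

sublocale Q: coord "quotient_space M N" Y qc
proof
  show "bij_betw qc (carrier (quotient_space M N)) (fs Y)"
    unfolding bij_betw_def
  proof
    show "inj_on qc (carrier (quotient_space M N))"
      by (auto simp: inj_on_def carrier_quotient coset_eq_iff)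
    have "p \<in> qc ` carrier (quotient_space M N)" if p: "p \<in> fs Y" for p
    proof -
      obtain r where r: "r \<in> fs X" "pbind r q = p" using q_surj[OF p] by blast
      then have "qc (N +>\<^bsub>M\<^esub> vec r) = p" by (simp add: vec_mem)
      moreover have "N +>\<^bsub>M\<^esub> vec r \<in> carrier (quotient_space M N)"
        using r by (auto simp: carrier_quotient vec_mem)
      ultimately show ?thesis by blast
    qed
    then show "qc ` carrier (quotient_space M N) = fs Y"
      by (auto simp: carrier_quotient intro!: fs_pbind q_mem c_mem)
  qed
qed (auto simp: carrier_quotient zero_quotient add_quotient smult_quotient zero_mem add_mem smult_mem pbind_lin)

lemma coset_mem: "x \<in> carrier M \<Longrightarrow> N +>\<^bsub>M\<^esub> x \<in> carrier (quotient_space M N)"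
  by (auto simp: carrier_quotient)

end

lemma coord_quot_exists:
  assumes "coord M X c" "N \<subseteq> carrier M" "\<zero>\<^bsub>M\<^esub> \<in> N" "\<And>x y. x \<in> N \<Longrightarrow> y \<in> N \<Longrightarrow> x \<oplus>\<^bsub>M\<^esub> y \<in> N"
    "\<And>a x. x \<in> N \<Longrightarrow> a \<odot>\<^bsub>M\<^esub> x \<in> N"
  obtains Y q where "coord_quot M X c N Y q" "Y \<subseteq> X" "\<And>y. y \<in> Y \<Longrightarrow> q y = sg y"
proof -
  interpret coord M X c by fact
  have I: "subsp (c ` N)" unfolding subsp_def
  proof (intro conjI ballI allI)
    show "0 \<in> c ` N" using assms(3) c_zero by force
    show "p + r \<in> c ` N" if "p \<in> c ` N" "r \<in> c ` N" for p r
    proof -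
      from that obtain x y where "x \<in> N" "y \<in> N" "p = c x" "r = c y" by auto
      then have "x \<oplus>\<^bsub>M\<^esub> y \<in> N" "p + r = c (x \<oplus>\<^bsub>M\<^esub> y)" using assms(2,4) by (auto simp: subset_iff)
      then show ?thesis by blast
    qed
    show "scl a p \<in> c ` N" if "p \<in> c ` N" for a p
    proof -
      from that obtain x where "x \<in> N" "p = c x" by auto
      then have "a \<odot>\<^bsub>M\<^esub> x \<in> N" "scl a p = c (a \<odot>\<^bsub>M\<^esub> x)" using assms(2,5) by (auto simp: subset_iff)
      then show ?thesis by blast
    qed
  qed
  obtain Y q where Y: "Y \<subseteq> X" and q: "\<And>x. x \<in> X \<Longrightarrow> q x \<in> fs Y"
    and ker: "\<And>p. p \<in> fs X \<Longrightarrow> pbind p q = 0 \<longleftrightarrow> p \<in> c ` N"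
    and qY: "\<And>y. y \<in> Y \<Longrightarrow> q y = sg y"
    using complement_projection[OF I, of X] by blast
  have "\<exists>r\<in>fs X. pbind r q = p" if p: "p \<in> fs Y" for p
    using Y p fs_pbind_cong[OF p qY] by (intro bexI[of _ p]) (auto simp: fs_def)
  moreover have "pbind (c x) q = 0 \<longleftrightarrow> x \<in> N" if "x \<in> carrier M" for x
    using ker[OF c_mem[OF that]] that assms(2) by (auto simp: c_inj subset_iff image_iff)
  ultimately have "coord_quot M X c N Y q"
    by unfold_locales (auto simp: q assms(2))
  then show ?thesis using Y qY that by blast
qed

section \<open>Algebras in coordinates\<close>

locale acoord = coord A X c for A :: "('k::field, 'a, 'o, 'm) balg_scheme" (structure)
    and X :: "'x set" and c +
  fixes m :: "'o \<Rightarrow> 'x \<Rightarrow> 'x \<Rightarrow> 'x \<Rightarrow>\<^sub>0 'k"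
  assumes bop_mem: "\<lbrakk>x \<in> carrier A; y \<in> carrier A\<rbrakk> \<Longrightarrow> bop A op x y \<in> carrier A"
    and c_bop [simp]: "\<lbrakk>x \<in> carrier A; y \<in> carrier A\<rbrakk> \<Longrightarrow> c (bop A op x y) = bmul (m op) (c x) (c y)"
begin

sublocale binary_algebra A
  by unfold_locales (auto intro!: eqI simp: bop_mem add_mem smult_mem pbind_lin)

lemma m_mem: "a \<in> X \<Longrightarrow> b \<in> X \<Longrightarrow> m op a b \<in> fs X"
  using c_mem[OF bop_mem[OF ex_mem ex_mem, of a b op]] by (simp add: ex_mem)

end

lemma (in binary_algebra) acoord:
  assumes "coord A X c"
  shows "acoord A X c (\<lambda>op a b. c (bop A op (coord.vec A c (sg a)) (coord.vec A c (sg b))))"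
proof -
  interpret c: coord A X c by fact
  have l: "linear_map class_ring A A (\<lambda>x. bop A op x y)" if "y \<in> carrier A" for y op
    by (intro linear_map.intro mod_hom.intro mod_hom_axioms.intro vectorspace_axioms module_axioms)
       (auto simp: LinearCombinations.module_hom_def bop_closed bop_add_left bop_smult_left that)
  have r: "linear_map class_ring A A (\<lambda>y. bop A op x y)" if "x \<in> carrier A" for x op
    by (intro linear_map.intro mod_hom.intro mod_hom_axioms.intro vectorspace_axioms module_axioms)
       (auto simp: LinearCombinations.module_hom_def bop_closed bop_add_right bop_smult_right that)
  show ?thesis
  proof
    fix x y op assume xy: "x \<in> carrier A" "y \<in> carrier A"
    show "bop A op x y \<in> carrier A" using xy by (rule bop_closed)
    show "c (bop A op x y) = bmul (\<lambda>a b. c (bop A op (c.vec (sg a)) (c.vec (sg b)))) (c x) (c y)"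
      using linear_map_coord(2)[OF assms assms l[OF xy(2)] xy(1)] c.c_mem[OF xy(1)]
        linear_map_coord(2)[OF assms assms r[OF c.ex_mem] xy(2)]
      by (auto intro!: fs_pbind_cong)
  qed
qed

lemma binary_algebra_acoord:
  fixes A :: "('k::field, 'a, 'o, 'm) balg_scheme"
  assumes "binary_algebra A"
  obtains X :: "'a set" and c m where "acoord A X c m"
  using vectorspace_coord[OF binary_algebra.axioms(1)[OF assms]] binary_algebra.acoord[OF assms] by metis

lemma (in coord) subspace_iff:
  "subspace class_ring I V \<longleftrightarrow> I \<subseteq> carrier V \<and> \<zero> \<in> I \<and> (\<forall>x\<in>I. \<forall>y\<in>I. x \<oplus> y \<in> I) \<and> (\<forall>a. \<forall>x\<in>I. a \<odot> x \<in> I)"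
  using vectorspace_axioms module_axioms
  by (auto simp: subspace_def submodule_def)

lemma (in acoord) binary_ideal_iff:
  "binary_ideal A I \<longleftrightarrow> I \<subseteq> carrier A \<and> \<zero> \<in> I \<and> (\<forall>x\<in>I. \<forall>y\<in>I. x \<oplus> y \<in> I) \<and> (\<forall>a. \<forall>x\<in>I. a \<odot> x \<in> I) \<and>
    (\<forall>op. \<forall>x\<in>carrier A. \<forall>i\<in>I. bop A op x i \<in> I \<and> bop A op i x \<in> I)"
  by (auto simp: binary_ideal_def subspace_iff)

lemma (in acoord) binary_ideal_hull:
  assumes "S \<subseteq> carrier A"
  shows "binary_ideal A (binary_ideal A hull S)"
proof -
  have "binary_ideal A (carrier A)"
    by (auto simp: binary_ideal_iff zero_mem add_mem smult_mem bop_mem)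
  then have "binary_ideal A hull S \<subseteq> carrier A"
    using assms by (auto simp: hull_def)
  then show ?thesis
    unfolding binary_ideal_iff by (auto simp: hull_def binary_ideal_iff)
qed

locale acoord_quot = acoord A X c m + coord_quot A X c I Y q
  for A :: "('k::field, 'a, 'o, 'm) balg_scheme" (structure) and X :: "'x set" and c m I 
    and Y :: "'y set" and q +
  fixes m' :: "'o \<Rightarrow> 'y \<Rightarrow> 'y \<Rightarrow> 'y \<Rightarrow>\<^sub>0 'k"
  assumes q_mult: "\<lbrakk>x \<in> X; y \<in> X\<rbrakk> \<Longrightarrow> pbind (m op x y) q = bmul (m' op) (q x) (q y)"
begin

lemma q_bop: 
  assumes "x \<in> carrier A" "y \<in> carrier A"
  shows "pbind (c (bop A op x y)) q = bmul (m' op) (pbind (c x) q) (pbind (c y) q)"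
proof -
  have "pbind (c (bop A op x y)) q = pbind (c x) (\<lambda>a. pbind (c y) (\<lambda>b. pbind (m op a b) q))"
    using assms by (simp add: pbind_assoc)
  also have "\<dots> = pbind (c x) (\<lambda>a. pbind (c y) (\<lambda>b. bmul (m' op) (q a) (q b)))"
    using c_mem[OF assms(1)] c_mem[OF assms(2)] by (auto intro!: fs_pbind_cong simp: q_mult)
  also have "\<dots> = bmul (m' op) (pbind (c x) q) (pbind (c y) q)"
    by (simp add: pbind_assoc pbind_swap[of "c y"])
  finally show ?thesis .
qed

lemma bop_quotient:
  assumes "x \<in> carrier A" "y \<in> carrier A"
  shows "bop (quotient_alg A I) op (I +>\<^bsub>A\<^esub> x) (I +>\<^bsub>A\<^esub> y) = I +>\<^bsub>A\<^esub> bop A op x y"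
proof -
  have "x \<in> I +>\<^bsub>A\<^esub> x" "y \<in> I +>\<^bsub>A\<^esub> y" using assms by (auto simp: coset_eq)
  moreover have "I +>\<^bsub>A\<^esub> bop A op x' y' = I +>\<^bsub>A\<^esub> bop A op x y" if "x' \<in> I +>\<^bsub>A\<^esub> x" "y' \<in> I +>\<^bsub>A\<^esub> y" for x' y'
    using that assms by (auto simp: coset_eq bop_mem q_bop simp del: c_bop)
  ultimately have "(\<Union>x\<in>I +>\<^bsub>A\<^esub> x. \<Union>y\<in>I +>\<^bsub>A\<^esub> y. I +>\<^bsub>A\<^esub> bop A op x y) = I +>\<^bsub>A\<^esub> bop A op x y"
    by blast
  then show ?thesis
    by (simp add: quotient_alg_def module.defs balg.defs)
qed

lemma carrier_quotient_alg: "carrier (quotient_alg A I) = (\<lambda>x. I +>\<^bsub>A\<^esub> x) ` carrier A"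
  by (simp add: quotient_alg_def carrier_quotient[symmetric] module.defs)

sublocale QA: acoord "quotient_alg A I" Y qc m'
proof (rule acoord.intro)
  show "coord (quotient_alg A I) Y qc"
    by (rule coord_cong[OF Q.coord_axioms]) (auto simp: quotient_alg_def module.defs)
  show "acoord_axioms (quotient_alg A I) qc m'"
    by (standard; auto simp: carrier_quotient_alg bop_quotient bop_mem q_bop simp del: c_bop)
qed

lemma coset_mem_alg: "x \<in> carrier A \<Longrightarrow> I +>\<^bsub>A\<^esub> x \<in> carrier (quotient_alg A I)"
  by (auto simp: carrier_quotient_alg)

end

text \<open>As \<open>Y\<close> is part of \<open>X\<close>, the product of \<open>A\<close> can be
  taken on \<open>Y\<close> and projected back by \<open>q\<close>. Because \<open>I\<close> is an
  ideal, replacing a factor \<open>sg x\<close> by \<open>q x\<close> leaves the projected product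
  unchanged, and this makes \<open>q\<close> multiplicative.\<close>

lemma (in acoord) acoord_quot_exists:
  assumes I: "binary_ideal A I"
  obtains Y :: "'x set" and q m' where "acoord_quot A X c m I Y q m'" 
proof -
  from I have I': "I \<subseteq> carrier A" "\<zero> \<in> I" "\<And>x y. x \<in> I \<Longrightarrow> y \<in> I \<Longrightarrow> x \<oplus> y \<in> I" "\<And>a x. x \<in> I \<Longrightarrow> a \<odot> x \<in> I"
    "\<And>op x i. x \<in> carrier A \<Longrightarrow> i \<in> I \<Longrightarrow> bop A op x i \<in> I \<and> bop A op i x \<in> I"
    by (auto simp: binary_ideal_iff)
  obtain Y q where "coord_quot A X c I Y q" and Y: "Y \<subseteq> X" and qY: "\<And>y. y \<in> Y \<Longrightarrow> q y = sg y"
    using coord_quot_exists[OF coord_axioms I'(1-4)] by blast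
  interpret cq: coord_quot A X c I Y q by fact
  define m' where "m' op a = (\<lambda>b. pbind (m op a b) q)" for op a
  have qq: "pbind (pbind p q) q = pbind p q" if "p \<in> fs X" for p
  proof -
    have "pbind p q \<in> fs Y" using that by (rule fs_pbind) (rule cq.q_mem)
    then show ?thesis using fs_pbind_cong[of "pbind p q" Y q sg] qY by simp
  qed
  have l: "pbind (bmul (m op) p r) q = 0" if "p \<in> fs X" "r \<in> fs X" "pbind p q = 0 \<or> pbind r q = 0" for p r op
  proof -
    have "vec p \<in> carrier A" "vec r \<in> carrier A" using that by (auto simp: vec_mem)
    moreover from this that have "vec p \<in> I \<or> vec r \<in> I" using cq.q_ker[of "vec p"] cq.q_ker[of "vec r"] by auto
    ultimately have "bop A op (vec p) (vec r) \<in> I" using I'(5) by blast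
    then show ?thesis using cq.q_ker[of "bop A op (vec p) (vec r)"] I'(1) that by (auto simp: vec_mem)
  qed
  have "pbind (m op x y) q = bmul (m' op) (q x) (q y)" if xy: "x \<in> X" "y \<in> X" for x y op
  proof -
    have qX: "q z \<in> fs X" if "z \<in> X" for z using cq.q_mem[OF that] Y by (auto simp: fs_def)
    have "bmul (m' op) (q x) (q y) = pbind (bmul (m op) (q x) (q y)) q"
      by (simp add: m'_def pbind_assoc)
    also have "\<dots> = pbind (bmul (m op) (q x) (sg y)) q"
      using l[of "q x" "sg y - q y" op] qq[of "sg y"] xy qX by (simp add: pbind_lin fs_intros)
    also have "\<dots> = pbind (bmul (m op) (sg x) (sg y)) q"
      using l[of "sg x - q x" "sg y" op] qq[of "sg x"] xy qX by (simp add: pbind_lin fs_intros)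
    finally show ?thesis by simp
  qed
  then have "acoord_quot A X c m I Y q m'"
    by (intro acoord_quot.intro acoord_axioms cq.coord_quot_axioms acoord_quot_axioms.intro)
  then show ?thesis by (rule that)
qed

section \<open>Tensor powers in coordinates\<close>

lemma fs_induct [consumes 1, case_names 0 add scl]:
  assumes p: "p \<in> fs X" and P0: "P 0"
    and P_add: "\<And>p q. p \<in> fs X \<Longrightarrow> q \<in> fs X \<Longrightarrow> P p \<Longrightarrow> P q \<Longrightarrow> P (p + q)"
    and P_scl: "\<And>x a. x \<in> X \<Longrightarrow> P (scl a (sg x))"
  shows "P p"
proof -
  have "(\<Sum>x\<in>S. scl (a x) (sg x)) \<in> fs X \<and> P (\<Sum>x\<in>S. scl (a x) (sg x))" if "finite S" "S \<subseteq> X" for S a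
    using that
  proof (induction S)
    case (insert x S)
    then have x: "x \<in> X" and S: "(\<Sum>x\<in>S. scl (a x) (sg x)) \<in> fs X" "P (\<Sum>x\<in>S. scl (a x) (sg x))"
      by auto
    have "scl (a x) (sg x) \<in> fs X" using x by (intro fs_intros) auto
    from P_add[OF this S(1) P_scl[OF x] S(2)] subsp_add[OF subsp_fs this S(1)] show ?case
      by (subst (1 2) sum.insert[OF insert(1,2)]) (rule conjI)
  qed (simp add: P0)
  from this[of "Poly_Mapping.keys p" "Poly_Mapping.lookup p"] p have "P (pbind p sg)"
    by (simp only: pbind_def finite_keys fs_def mem_Collect_eq)
  then show ?thesis by simp
qed

definition words :: "nat \<Rightarrow> 'x set \<Rightarrow> 'x list set" where
  "words n X = {xs. length xs = n \<and> set xs \<subseteq> X}"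

lemma words_hd_tl: "xs \<in> words (Suc n) X \<Longrightarrow> hd xs \<in> X \<and> tl xs \<in> words n X \<and> xs = hd xs # tl xs"
  by (cases xs) (auto simp: words_def)

lemma words_2E: 
  assumes "xs \<in> words 2 X" 
  obtains a b where "xs = [a, b]" "a \<in> X" "b \<in> X"
  using assms by (auto simp: words_def length_Suc_conv numeral_2_eq_2)

lemma words_append: "xs \<in> words m X \<Longrightarrow> ys \<in> words n X \<Longrightarrow> xs @ ys \<in> words (m + n) X"
  by (auto simp: words_def)

lemma tensor_words_eq: "tensor_words n V = words n (carrier V)"
  by (simp add: tensor_words_def words_def)

text \<open>The pure tensor of a list of vectors, expanded in the basis of words.\<close>

primrec outer :: "('x \<Rightarrow>\<^sub>0 'k::field) list \<Rightarrow> 'x list \<Rightarrow>\<^sub>0 'k" where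
  "outer [] = sg []"
| "outer (p # ps) = pbind p (\<lambda>x. pbind (outer ps) (\<lambda>xs. sg (x # xs)))"

lemma outer_append: "outer (ps @ qs) = pbind (outer ps) (\<lambda>xs. pbind (outer qs) (\<lambda>ys. sg (xs @ ys)))"
  by (induction ps) (simp_all add: pbind_assoc)

lemma outer_map_sg [simp]: "outer (map sg xs) = sg xs"
  by (induction xs) simp_all

lemma outer_mem: "set ps \<subseteq> fs X \<Longrightarrow> outer ps \<in> fs (words (length ps) X)"
proof (induction ps)
  case (Cons p ps)
  then have "p \<in> fs X" "outer ps \<in> fs (words (length ps) X)" by auto
  then show ?case by (auto intro!: fs_pbind simp: words_def)
qed (simp add: words_def)

lemma outer_map_pbind: "outer (map (\<lambda>v. pbind (c v) F) zs) = pbind (outer (map c zs)) (\<lambda>xs. outer (map F xs))"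
  by (induction zs) (simp_all add: pbind_assoc pbind_swap[of "outer (map c zs)" for zs])

text \<open>Coordinates of a tensor, which is a coset of formal combinations of lists: a
  representative is expanded multilinearly, and by \<open>tensor_elems\<close> every representative
  gives the same result.\<close>

definition tc :: "('a \<Rightarrow> 'x \<Rightarrow>\<^sub>0 'k::field) \<Rightarrow> ('a list \<Rightarrow>\<^sub>0 'k) set \<Rightarrow> 'x list \<Rightarrow>\<^sub>0 'k" where
  "tc c t = the_elem ((\<lambda>p. pbind p (\<lambda>zs. outer (map c zs))) ` t)"

context coord
begin

lemma map_c_mem: "zs \<in> words n (carrier V) \<Longrightarrow> outer (map c zs) \<in> fs (words n X)"
  using outer_mem[of "map c zs" X] c_mem by (auto simp: words_def)

lemma vec_add: "p \<in> fs X \<Longrightarrow> q \<in> fs X \<Longrightarrow> vec (p + q) = vec p \<oplus> vec q"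
  by (intro vec_eqI) (auto simp: add_mem vec_mem)

lemma vec_scl: "p \<in> fs X \<Longrightarrow> vec (scl a p) = a \<odot> vec p"
  by (intro vec_eqI) (auto simp: smult_mem vec_mem)

lemma tensor_rels_sub: "tensor_rels n V \<subseteq> fs (words n (carrier V))"
  unfolding tensor_rels_def tensor_words_eq
  by (auto simp: words_def add_mem smult_mem intro!: fs_intros)

lemma tensor_null_props:
  shows "subsp (tensor_null n V)" "tensor_rels n V \<subseteq> tensor_null n V" "tensor_null n V \<subseteq> fs (words n (carrier V))"
    and "\<And>S. subsp S \<Longrightarrow> S \<subseteq> fs (words n (carrier V)) \<Longrightarrow> tensor_rels n V \<subseteq> S \<Longrightarrow> tensor_null n V \<subseteq> S"
proof -
  interpret F: coord "free_space (words n (carrier V)) :: ('k, 'a list \<Rightarrow>\<^sub>0 'k) module" "words n (carrier V)" id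
    by (rule coord_free_space)
  have sub: "submodule class_ring S (free_space (words n (carrier V))) \<longleftrightarrow>
      subsp S \<and> S \<subseteq> fs (words n (carrier V))" for S :: "('a list \<Rightarrow>\<^sub>0 'k) set"
    using F.module_axioms by (auto simp: submodule_def subsp_def)
  have rels: "tensor_rels n V \<subseteq> carrier (free_space (words n (carrier V)))"
    using tensor_rels_sub by simp
  have "submodule class_ring (tensor_null n V) (free_space (words n (carrier V)))"
    unfolding tensor_null_def tensor_words_eq by (rule F.span_is_submodule[OF rels])
  then show "subsp (tensor_null n V)" "tensor_null n V \<subseteq> fs (words n (carrier V))"
    unfolding sub by auto
  show "tensor_rels n V \<subseteq> tensor_null n V"
    unfolding tensor_null_def tensor_words_eq by (rule F.in_own_span[OF rels])
  show "tensor_null n V \<subseteq> S" if "subsp S" "S \<subseteq> fs (words n (carrier V))" "tensor_rels n V \<subseteq> S" for S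
    unfolding tensor_null_def tensor_words_eq using that by (intro F.span_is_subset) (auto simp: sub)
qed

lemma tensor_expand1:
  assumes "us @ v # ws \<in> words n (carrier V)"
  shows "sg (us @ v # ws) - pbind (c v) (\<lambda>x. sg (us @ vec (sg x) # ws)) \<in> tensor_null n V"
proof -
  note N = tensor_null_props(1)[of n] tensor_null_props(2)[of n]
  let ?g = "\<lambda>v. sg (us @ v # ws) :: 'a list \<Rightarrow>\<^sub>0 'k"
  have w: "us @ x # ws \<in> words n (carrier V)" if "x \<in> carrier V" for x
    using assms that by (auto simp: words_def)
  have add: "?g (x \<oplus> y) - ?g x - ?g y \<in> tensor_null n V" if "x \<in> carrier V" "y \<in> carrier V" for x y
    using that w[OF that(1)] by (intro subsetD[OF N(2)]) (auto simp: tensor_rels_def tensor_words_eq)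
  have smult: "?g (a \<odot> x) - scl a (?g x) \<in> tensor_null n V" if "x \<in> carrier V" for x a
    using that w[OF that(1)] by (intro subsetD[OF N(2)]) (auto simp: tensor_rels_def tensor_words_eq)
  have "?g (vec p) - pbind p (\<lambda>x. ?g (vec (sg x))) \<in> tensor_null n V" if "p \<in> fs X" for p
    using that
  proof (induction rule: fs_induct)
    case 0
    \<comment> \<open>The zero vector enters as a multiple with scalar 0, so the scalar relation
      shows that a list with a zero entry is null.\<close>
    have "vec 0 = 0 \<odot> \<zero>" by (intro vec_eqI smult_mem zero_mem) (simp add: zero_mem)
    then show ?case using smult[OF zero_mem, of 0] by simp
  next
    case (add p q)
    have "(?g (vec p \<oplus> vec q) - ?g (vec p) - ?g (vec q)) + ((?g (vec p) - pbind p (\<lambda>x. ?g (vec (sg x)))) +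
       (?g (vec q) - pbind q (\<lambda>x. ?g (vec (sg x))))) \<in> tensor_null n V"
      by (intro subsp_add N(1) add \<open>\<And>x y. _ \<Longrightarrow> _ \<Longrightarrow> ?g (x \<oplus> y) - _ - _ \<in> _\<close> vec_mem)
    then show ?case using add by (simp add: vec_add pbind_add algebra_simps)
  next
    case (scl x a)
    then show ?case using smult[OF ex_mem, of x a] by (simp add: vec_scl pbind_scl del: scl_single)
  qed
  from this[OF c_mem[of v]] show ?thesis using assms by (simp add: words_def)
qed

text \<open>The slots are expanded from left to right; the prefix \<open>us\<close> holds the basis
  vectors already chosen, and generalising over it is what lets the induction run.\<close>

lemma tensor_expand:
  "us @ zs \<in> words n (carrier V) \<Longrightarrow>
    sg (us @ zs) - pbind (outer (map c zs)) (\<lambda>xs. sg (us @ map (\<lambda>x. vec (sg x)) xs)) \<in> tensor_null n V"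
proof (induction zs arbitrary: us)
  case Nil
  then show ?case using tensor_null_props(1) by (simp add: subsp_0)
next
  case (Cons v zs)
  let ?b = "\<lambda>x. vec (sg x)"
  let ?R = "\<lambda>x. pbind (outer (map c zs)) (\<lambda>xs. sg ((us @ [?b x]) @ map ?b xs)) :: 'a list \<Rightarrow>\<^sub>0 'k"
  have v: "v \<in> carrier V" using Cons.prems by (auto simp: words_def)
  have 1: "sg (us @ v # zs) - pbind (c v) (\<lambda>x. sg (us @ ?b x # zs)) \<in> tensor_null n V"
    using Cons.prems by (rule tensor_expand1)
  have "sg ((us @ [?b x]) @ zs) - ?R x \<in> tensor_null n V" if "x \<in> X" for x
    using that Cons.prems ex_mem[OF that] by (intro Cons.IH) (auto simp: words_def)
  then have 2: "pbind (c v) (\<lambda>x. sg (us @ ?b x # zs) - ?R x) \<in> tensor_null n V"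
    using tensor_null_props(1) fs_keys[OF c_mem[OF v]] by (intro subsp_pbind) auto
  show ?case using subsp_add[OF tensor_null_props(1) 1 2]
    by (simp add: pbind_lin pbind_assoc)
qed

text \<open>The relations lie in the kernel by minimality of the span. Conversely,
  \<open>tensor_expand\<close> makes every formal combination congruent to its expansion in basis
  tensors, and the coefficients of that expansion are the value of the map; if they vanish, the
  combination is null.\<close>

lemma tensor_coord_quot:
  "coord_quot (free_space (tensor_words n V)) (tensor_words n V) id (tensor_null n V) (words n X) (\<lambda>zs. outer (map c zs))"
  unfolding tensor_words_eq
proof (intro coord_quot.intro coord_quot_axioms.intro coord_free_space)
  let ?W = "words n (carrier V)" and ?q = "\<lambda>zs. outer (map c zs)" and ?b = "\<lambda>x. vec (sg x)"
  show "?q a \<in> fs (words n X)" if "a \<in> ?W" for a using map_c_mem[OF that] .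
  show "\<exists>r\<in>fs ?W. pbind r ?q = p" if p: "p \<in> fs (words n X)" for p
  proof
    show "pbind p (\<lambda>xs. sg (map ?b xs)) \<in> fs ?W"
      using p by (rule fs_pbind) (auto simp: words_def ex_mem)
    have "pbind p (\<lambda>xs. outer (map c (map ?b xs))) = pbind p sg"
      using p by (rule fs_pbind_cong) (auto simp: words_def o_def subset_iff cong: map_cong)
    then show "pbind (pbind p (\<lambda>xs. sg (map ?b xs))) ?q = p" by (simp add: pbind_assoc)
  qed
  show "tensor_null n V \<subseteq> carrier (free_space ?W)" using tensor_null_props(3) by simp
  show "pbind (id x) ?q = 0 \<longleftrightarrow> x \<in> tensor_null n V" if x: "x \<in> carrier (free_space ?W)" for x
  proof
    assume "x \<in> tensor_null n V"
    moreover have "tensor_null n V \<subseteq> {p \<in> fs ?W. pbind p ?q = 0}"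
    proof (rule tensor_null_props(4))
      show "subsp {p \<in> fs ?W. pbind p ?q = 0}" by (auto simp: subsp_def pbind_lin intro: fs_intros)
      have "pbind r ?q = 0" if "r \<in> tensor_rels n V" for r
        using that unfolding tensor_rels_def tensor_words_eq
        by (auto simp: words_def pbind_lin outer_append simp flip: pbind_add_right pbind_diff_right)
      then show "tensor_rels n V \<subseteq> {p \<in> fs ?W. pbind p ?q = 0}" using tensor_rels_sub by auto
    qed auto
    ultimately show "pbind (id x) ?q = 0" by auto
  next
    assume 0: "pbind (id x) ?q = 0"
    have "pbind x (\<lambda>zs. sg ([] @ zs) - pbind (?q zs) (\<lambda>xs. sg ([] @ map ?b xs))) \<in> tensor_null n V"
      using x tensor_expand[of "[]"] by (intro subsp_pbind tensor_null_props(1)) (auto dest: fs_keys)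
    also have "pbind x (\<lambda>zs. sg ([] @ zs) - pbind (?q zs) (\<lambda>xs. sg ([] @ map ?b xs))) = x"
      using 0 by (simp add: pbind_diff_right pbind_assoc[symmetric])
    finally show "x \<in> tensor_null n V" .
  qed
qed

lemma coord_tensor: "coord (tensor_power n V) (words n X) (tc c)"
proof -
  interpret q: coord_quot "free_space (tensor_words n V)" "tensor_words n V" id "tensor_null n V" "words n X"
    "\<lambda>zs. outer (map c zs)" by (rule tensor_coord_quot)
  have "q.qc = tc c" by (simp add: fun_eq_iff q.qc_def tc_def)
  then show ?thesis using q.Q.coord_axioms by (simp add: tensor_power_def)
qed

lemma tensor_elems:
  assumes "t \<in> carrier (tensor_power n V)"
  shows "t \<noteq> {}" "\<And>r. r \<in> t \<Longrightarrow> r \<in> fs (words n (carrier V)) \<and> pbind r (\<lambda>zs. outer (map c zs)) = tc c t"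
proof -
  interpret q: coord_quot "free_space (tensor_words n V)" "tensor_words n V" id "tensor_null n V" "words n X"
    "\<lambda>zs. outer (map c zs)" by (rule tensor_coord_quot)
  have "q.qc = tc c" by (simp add: fun_eq_iff q.qc_def tc_def)
  moreover obtain p where "p \<in> carrier (free_space (tensor_words n V))" "t = tensor_null n V +>\<^bsub>free_space (tensor_words n V)\<^esub> p"
    using assms by (auto simp: tensor_power_def q.carrier_quotient)
  moreover from this q.coset_eq[of p] have "t = {y \<in> fs (words n (carrier V)). pbind y (\<lambda>zs. outer (map c zs)) = 
      pbind p (\<lambda>zs. outer (map c zs))}" by (simp add: tensor_words_eq)
  ultimately show "t \<noteq> {}" "\<And>r. r \<in> t \<Longrightarrow> r \<in> fs (words n (carrier V)) \<and> pbind r (\<lambda>zs. outer (map c zs)) = tc c t"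
    using q.qc_coset[of p] by (auto simp: tensor_words_eq)
qed

lemma tensor_mem: "set zs \<subseteq> carrier V \<Longrightarrow> length zs = n \<Longrightarrow> tensor V zs \<in> carrier (tensor_power n V)"
  and tc_tensor [simp]: "set zs \<subseteq> carrier V \<Longrightarrow> tc c (tensor V zs) = outer (map c zs)"
proof -
  interpret q: coord_quot "free_space (tensor_words (length zs) V)" "tensor_words (length zs) V" id 
    "tensor_null (length zs) V" "words (length zs) X" "\<lambda>zs. outer (map c zs)" by (rule tensor_coord_quot)
  have "q.qc = tc c" by (simp add: fun_eq_iff q.qc_def tc_def)
  then show "set zs \<subseteq> carrier V \<Longrightarrow> length zs = n \<Longrightarrow> tensor V zs \<in> carrier (tensor_power n V)"
    "set zs \<subseteq> carrier V \<Longrightarrow> tc c (tensor V zs) = outer (map c zs)"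
    using q.coset_mem[of "sg zs"] q.qc_coset[of "sg zs"]
    by (auto simp: tensor_def tensor_power_def tensor_words_eq words_def)
qed

text \<open>Independence of the representative holds because the coordinates of \<open>f zs\<close>
  depend on \<open>zs\<close> only through its pure tensor, and linearly. This is the form in which
  multilinearity of \<open>f\<close> is checked everywhere below.\<close>

lemma quot_lift_coord:
  assumes W: "coord W Y d" and t: "t \<in> carrier (tensor_power n V)"
    and f: "\<And>zs. zs \<in> words n (carrier V) \<Longrightarrow> f zs \<in> carrier W \<and> d (f zs) = pbind (outer (map c zs)) F"
  shows "quot_lift W f t \<in> carrier W" "d (quot_lift W f t) = pbind (tc c t) F"
proof -
  interpret W: coord W Y d by fact
  have l: "lin_ext W f r \<in> carrier W \<and> d (lin_ext W f r) = pbind (tc c t) F" if "r \<in> t" for r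
  proof -
    have r: "r \<in> fs (words n (carrier V))" "pbind r (\<lambda>zs. outer (map c zs)) = tc c t"
      using tensor_elems(2)[OF t that] by auto
    have "d (lin_ext W f r) = pbind r (\<lambda>zs. d (f zs))"
      using fs_keys[OF r(1)] f by (intro W.c_lin_ext) auto
    also have "\<dots> = pbind r (\<lambda>zs. pbind (outer (map c zs)) F)"
      using r(1) by (rule fs_pbind_cong) (simp add: f)
    also have "\<dots> = pbind (tc c t) F" using r(2) by (simp add: pbind_assoc[symmetric])
    finally show ?thesis using fs_keys[OF r(1)] f by (auto intro: W.lin_ext_mem)
  qed
  obtain r where r: "r \<in> t" using tensor_elems(1)[OF t] by blast
  have "quot_lift W f t = lin_ext W f r"
    unfolding quot_lift_def using l r by (intro the_elem_image_unique W.eqI) auto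
  then show "quot_lift W f t \<in> carrier W" "d (quot_lift W f t) = pbind (tc c t) F"
    using l[OF r] by auto
qed

lemma tensor_map_coord:
  assumes W: "coord W Y d" and f: "\<And>x. x \<in> carrier V \<Longrightarrow> f x \<in> carrier W \<and> d (f x) = pbind (c x) F"
    and t: "t \<in> carrier (tensor_power 2 V)"
  shows "tensor_map W f t \<in> carrier (tensor_power 2 W)"
    "tc d (tensor_map W f t) = pbind (tc c t) (\<lambda>xs. outer (map F xs))"
proof -
  interpret W: coord W Y d by fact
  have "tensor W (map f zs) \<in> carrier (tensor_power 2 W) \<and>
      tc d (tensor W (map f zs)) = pbind (outer (map c zs)) (\<lambda>xs. outer (map F xs))"
    if "zs \<in> words 2 (carrier V)" for zs
  proof -
    have *: "map (d \<circ> f) zs = map (\<lambda>v. pbind (c v) F) zs"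
      using that f by (auto simp: words_def)
    have "set (map f zs) \<subseteq> carrier W" "length (map f zs) = 2" using that f by (auto simp: words_def)
    then show ?thesis by (simp only: W.tensor_mem W.tc_tensor map_map * outer_map_pbind)
  qed
  from quot_lift_coord[OF W.coord_tensor t this] show "tensor_map W f t \<in> carrier (tensor_power 2 W)"
    "tc d (tensor_map W f t) = pbind (tc c t) (\<lambda>xs. outer (map F xs))"
    unfolding tensor_map_def by auto
qed

end

section \<open>Coalgebras in coordinates\<close>

locale cocoord = coord V X c for V :: "('k::field, 'a, 'm) module_scheme" and X :: "'x set" and c +
  fixes \<delta> :: "'a \<Rightarrow> ('a list \<Rightarrow>\<^sub>0 'k) set" and D :: "'x \<Rightarrow> 'x list \<Rightarrow>\<^sub>0 'k"
  assumes \<delta>_mem: "x \<in> carrier V \<Longrightarrow> \<delta> x \<in> carrier (tensor_power 2 V)"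
    and tc_\<delta>: "x \<in> carrier V \<Longrightarrow> tc c (\<delta> x) = pbind (c x) D"

definition D_first :: "('x \<Rightarrow> 'x list \<Rightarrow>\<^sub>0 'k::field) \<Rightarrow> 'x list \<Rightarrow> 'x list \<Rightarrow>\<^sub>0 'k" where
  "D_first D xs = pbind (D (hd xs)) (\<lambda>ys. sg (ys @ tl xs))"

definition D_second :: "('x \<Rightarrow> 'x list \<Rightarrow>\<^sub>0 'k::field) \<Rightarrow> 'x list \<Rightarrow> 'x list \<Rightarrow>\<^sub>0 'k" where
  "D_second D xs = pbind (D (xs ! 1)) (\<lambda>ys. sg (xs ! 0 # ys))"

primrec D_iter :: "('x \<Rightarrow> 'x list \<Rightarrow>\<^sub>0 'k::field) \<Rightarrow> nat \<Rightarrow> 'x \<Rightarrow> 'x list \<Rightarrow>\<^sub>0 'k" where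
  "D_iter D 0 x = sg [x]"
| "D_iter D (Suc r) x = pbind (D_iter D r x) (D_first D)"

context cocoord
begin

lemma D_mem: "x \<in> X \<Longrightarrow> D x \<in> fs (words 2 X)"
  using coord.c_mem[OF coord_tensor \<delta>_mem[OF ex_mem[of x]]] by (simp add: tc_\<delta> ex_mem)

lemma comult_first_coord:
  assumes t: "t \<in> carrier (tensor_power (r + 1) V)"
  shows "comult_first V \<delta> r t \<in> carrier (tensor_power (r + 2) V)"
    "tc c (comult_first V \<delta> r t) = pbind (tc c t) (D_first D)"
proof -
  let ?T = "tensor_power (r + 2) V"
  have "quot_lift ?T (\<lambda>ws. tensor V (ws @ tl zs)) (\<delta> (hd zs)) \<in> carrier ?T \<and>
    tc c (quot_lift ?T (\<lambda>ws. tensor V (ws @ tl zs)) (\<delta> (hd zs))) = pbind (outer (map c zs)) (D_first D)"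
    if zs: "zs \<in> words (r + 1) (carrier V)" for zs
  proof -
    obtain v us where [simp]: "zs = v # us" and v: "v \<in> carrier V" and us: "us \<in> words r (carrier V)"
      using zs by (cases zs) (auto simp: words_def)
    have "tensor V (ws @ us) \<in> carrier ?T \<and> tc c (tensor V (ws @ us)) =
        pbind (outer (map c ws)) (\<lambda>xs. pbind (outer (map c us)) (\<lambda>ys. sg (xs @ ys)))"
      if "ws \<in> words 2 (carrier V)" for ws
      using that us by (auto simp: words_def outer_append intro!: tensor_mem)
    from quot_lift_coord[OF coord_tensor \<delta>_mem[OF v] this] show ?thesis
      by (simp add: tc_\<delta>[OF v] pbind_assoc D_first_def[abs_def] pbind_swap[of "outer (map c us)"])
  qed
  from quot_lift_coord[OF coord_tensor t this] show "comult_first V \<delta> r t \<in> carrier ?T"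
    "tc c (comult_first V \<delta> r t) = pbind (tc c t) (D_first D)"
    unfolding comult_first_def by auto
qed

lemma comult_second_coord:
  assumes t: "t \<in> carrier (tensor_power 2 V)"
  shows "comult_second V \<delta> t \<in> carrier (tensor_power 3 V)"
    "tc c (comult_second V \<delta> t) = pbind (tc c t) (D_second D)"
proof -
  let ?T = "tensor_power 3 V"
  have "quot_lift ?T (\<lambda>ws. tensor V (zs ! 0 # ws)) (\<delta> (zs ! 1)) \<in> carrier ?T \<and>
    tc c (quot_lift ?T (\<lambda>ws. tensor V (zs ! 0 # ws)) (\<delta> (zs ! 1))) = pbind (outer (map c zs)) (D_second D)"
    if zs: "zs \<in> words 2 (carrier V)" for zs
  proof -
    obtain u v where [simp]: "zs = [u, v]" and u: "u \<in> carrier V" and v: "v \<in> carrier V"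
      using zs by (rule words_2E)
    have "tensor V (u # ws) \<in> carrier ?T \<and> tc c (tensor V (u # ws)) =
        pbind (outer (map c ws)) (\<lambda>ys. pbind (c u) (\<lambda>x. sg (x # ys)))"
      if "ws \<in> words 2 (carrier V)" for ws
      using that u by (auto simp: words_def pbind_swap[of "c u"] intro!: tensor_mem)
    from quot_lift_coord[OF coord_tensor \<delta>_mem[OF v] this] show ?thesis
      by (simp add: tc_\<delta>[OF v] pbind_assoc D_second_def[abs_def] pbind_swap[of "c u"])
  qed
  from quot_lift_coord[OF coord_tensor t this] show "comult_second V \<delta> t \<in> carrier ?T"
    "tc c (comult_second V \<delta> t) = pbind (tc c t) (D_second D)"
    unfolding comult_second_def by auto
qed

lemma iter_comult_coord:
  assumes "x \<in> carrier V"
  shows "iter_comult V \<delta> r x \<in> carrier (tensor_power (r + 1) V)"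
    "tc c (iter_comult V \<delta> r x) = pbind (c x) (D_iter D r)"
proof (induction r)
  case 0
  show "iter_comult V \<delta> 0 x \<in> carrier (tensor_power (0 + 1) V)" using assms by (auto intro!: tensor_mem)
  show "tc c (iter_comult V \<delta> 0 x) = pbind (c x) (D_iter D 0)"
    using assms by (simp add: D_iter.simps[abs_def])
next
  case (Suc r)
  show "iter_comult V \<delta> (Suc r) x \<in> carrier (tensor_power (Suc r + 1) V)"
    using comult_first_coord(1)[OF Suc(1)] by simp
  show "tc c (iter_comult V \<delta> (Suc r) x) = pbind (c x) (D_iter D (Suc r))"
    using comult_first_coord(2)[OF Suc(1)] Suc(2) by (simp add: D_iter.simps[abs_def] pbind_assoc)
qed

lemma coassociative_iff:
  "coassociative V \<delta> \<longleftrightarrow> (\<forall>x\<in>X. pbind (D x) (D_first D) = pbind (D x) (D_second D))"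
proof -
  have *: "comult_first V \<delta> 1 (\<delta> x) = comult_second V \<delta> (\<delta> x) \<longleftrightarrow>
      pbind (c x) (\<lambda>x. pbind (D x) (D_first D)) = pbind (c x) (\<lambda>x. pbind (D x) (D_second D))"
    if x: "x \<in> carrier V" for x
  proof -
    have t: "\<delta> x \<in> carrier (tensor_power (1 + 1) V)" "\<delta> x \<in> carrier (tensor_power 2 V)"
      using \<delta>_mem[OF x] by (simp_all add: numeral_2_eq_2)
    have "comult_first V \<delta> 1 (\<delta> x) \<in> carrier (tensor_power 3 V)"
      using comult_first_coord(1)[OF t(1)] by (simp add: numeral_3_eq_3)
    then have "comult_first V \<delta> 1 (\<delta> x) = comult_second V \<delta> (\<delta> x) \<longleftrightarrow>
        tc c (comult_first V \<delta> 1 (\<delta> x)) = tc c (comult_second V \<delta> (\<delta> x))"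
      using coord.c_inj[OF coord_tensor] comult_second_coord(1)[OF t(2)] by blast
    then show ?thesis
      using comult_first_coord(2)[OF t(1)] comult_second_coord(2)[OF t(2)] by (simp add: tc_\<delta>[OF x] pbind_assoc)
  qed
  show ?thesis unfolding coassociative_def
  proof (intro iffI ballI)
    fix x assume "\<forall>x\<in>X. pbind (D x) (D_first D) = pbind (D x) (D_second D)" "x \<in> carrier V"
    then show "comult_first V \<delta> 1 (\<delta> x) = comult_second V \<delta> (\<delta> x)"
      by (subst *) (auto intro!: fs_pbind_cong[OF c_mem])
  next
    fix x assume "\<forall>x\<in>carrier V. comult_first V \<delta> 1 (\<delta> x) = comult_second V \<delta> (\<delta> x)" "x \<in> X"
    then show "pbind (D x) (D_first D) = pbind (D x) (D_second D)"
      using *[OF ex_mem[of x]] by (simp add: ex_mem)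
  qed
qed

lemma connected_iff:
  "connected_coalgebra V \<delta> \<longleftrightarrow> (\<forall>x\<in>carrier V. \<exists>r\<ge>1. pbind (c x) (D_iter D r) = 0)"
proof -
  have *: "iter_comult V \<delta> r x = \<zero>\<^bsub>tensor_power (r + 1) V\<^esub> \<longleftrightarrow> pbind (c x) (D_iter D r) = 0"
    if "x \<in> carrier V" for x r
    using coord.c_eq_0_iff[OF coord_tensor iter_comult_coord(1)[OF that, of r]]
    unfolding iter_comult_coord(2)[OF that] by (rule sym)
  have "connected_coalgebra V \<delta> \<longleftrightarrow>
      (\<forall>x\<in>carrier V. \<exists>r\<ge>1. iter_comult V \<delta> r x = \<zero>\<^bsub>tensor_power (r + 1) V\<^esub>)"
    unfolding connected_coalgebra_def filtration_def by blast
  then show ?thesis using * by auto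
qed

lemma linear_map_\<delta>: "linear_map class_ring V (tensor_power 2 V) \<delta>"
  by (rule coord_linear_map[OF coord_axioms coord_tensor, where F = D]) (simp add: \<delta>_mem tc_\<delta>)

end

lemma linear_map_cocoord:
  assumes V: "coord V X c" and l: "linear_map class_ring V (tensor_power 2 V) \<delta>"
  shows "cocoord V X c \<delta> (\<lambda>a. tc c (\<delta> (coord.vec V c (sg a))))"
proof -
  interpret coord V X c by fact
  show ?thesis
    by unfold_locales (use linear_map_coord[OF V coord_tensor l] in auto)
qed

lemma cocoord_iso:
  assumes V: "cocoord V X c \<delta> D" and W: "cocoord W X d \<epsilon> D"
    and f: "\<And>x. x \<in> carrier V \<Longrightarrow> f x \<in> carrier W \<and> d (f x) = c x"
  shows "coalgebra_iso V \<delta> W \<epsilon> f"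
proof -
  interpret V: cocoord V X c \<delta> D by fact
  interpret W: cocoord W X d \<epsilon> D by fact
  have "\<epsilon> (f x) = tensor_map W f (\<delta> x)" if x: "x \<in> carrier V" for x
  proof (rule coord.eqI[OF W.coord_tensor[of 2]])
    have f': "f x \<in> carrier W \<and> d (f x) = pbind (c x) sg" if "x \<in> carrier V" for x
      using f[OF that] by simp
    show "tensor_map W f (\<delta> x) \<in> carrier (tensor_power 2 W)"
      by (rule V.tensor_map_coord(1)[OF W.coord_axioms f' V.\<delta>_mem[OF x]])
    show "\<epsilon> (f x) \<in> carrier (tensor_power 2 W)" using f x by (intro W.\<delta>_mem) auto
    show "tc d (\<epsilon> (f x)) = tc d (tensor_map W f (\<delta> x))"
      using f[OF x] V.tensor_map_coord(2)[OF W.coord_axioms f' V.\<delta>_mem[OF x]]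
      by (simp add: W.tc_\<delta> V.tc_\<delta> x)
  qed
  then show ?thesis
    unfolding coalgebra_iso_def using coord_linear_iso[OF V.coord_axioms W.coord_axioms f] by auto
qed

lemma iso_coord:
  fixes V :: "('k::field, 'a, 'm) module_scheme" and W :: "('k, 'b, 'n) module_scheme"
  assumes "linear_iso V W f" and W: "coord W X d"
  shows "coord V X (\<lambda>x. d (f x))"
proof -
  interpret W: coord W X d by fact
  interpret f: linear_map class_ring V W f using assms(1) by (simp add: linear_iso_def)
  have b: "bij_betw f (carrier V) (carrier W)" using assms(1) by (simp add: linear_iso_def)
  have m: "f x \<in> carrier W" if "x \<in> carrier V" for x using b that by (auto simp: bij_betw_def)
  obtain X\<^sub>0 :: "'a set" and c\<^sub>0 where "coord V X\<^sub>0 c\<^sub>0" using vectorspace_coord[OF f.V.vectorspace_axioms] .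
  then interpret c\<^sub>0: coord V X\<^sub>0 c\<^sub>0 .
  have fs: "f (a \<odot>\<^bsub>V\<^esub> x) = a \<odot>\<^bsub>W\<^esub> f x" if "x \<in> carrier V" for a x
    using f.f_smult[of a x] that by simp
  show ?thesis
  proof
    show "bij_betw (\<lambda>x. d (f x)) (carrier V) (fs X)"
      using bij_betw_trans[OF b W.c_bij] by (simp add: o_def)
    show "d (f \<zero>\<^bsub>V\<^esub>) = 0" using f.f0_is_0 by simp
  qed (auto simp: c\<^sub>0.zero_mem c\<^sub>0.add_mem c\<^sub>0.smult_mem m fs)
qed

text \<open>In the coordinates pulled back along \<open>f\<close> the isomorphism becomes the
  identity, so both coalgebras have literally the same structure constants.\<close>

lemma coalgebra_iso_cocoord:
  assumes iso: "coalgebra_iso V \<delta> W \<epsilon> f" and W: "cocoord W X d \<epsilon> D"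
    and \<delta>: "\<And>x. x \<in> carrier V \<Longrightarrow> \<delta> x \<in> carrier (tensor_power 2 V)"
  shows "cocoord V X (\<lambda>x. d (f x)) \<delta> D"
proof -
  interpret W: cocoord W X d \<epsilon> D by fact
  have l: "linear_iso V W f" and e: "\<And>x. x \<in> carrier V \<Longrightarrow> \<epsilon> (f x) = tensor_map W f (\<delta> x)"
    using iso by (auto simp: coalgebra_iso_def)
  interpret V: coord V X "\<lambda>x. d (f x)" by (rule iso_coord[OF l W.coord_axioms])
  have m: "f x \<in> carrier W" if "x \<in> carrier V" for x 
    using l that by (auto simp: linear_iso_def bij_betw_def)
  show ?thesis
  proof
    fix x assume x: "x \<in> carrier V"
    show "\<delta> x \<in> carrier (tensor_power 2 V)" using \<delta>[OF x] .
    have f': "f x \<in> carrier W \<and> d (f x) = pbind (d (f x)) sg" if "x \<in> carrier V" for x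
      using m[OF that] by simp
    show "tc (\<lambda>x. d (f x)) (\<delta> x) = pbind (d (f x)) D"
      using V.tensor_map_coord(2)[OF W.coord_axioms f' \<delta>[OF x]] W.tc_\<delta>[OF m[OF x]] e[OF x] by simp
  qed
qed

section \<open>Duplicial bialgebras in coordinates\<close>

definition dup_coord :: "'x set \<Rightarrow> (dup_op \<Rightarrow> 'x \<Rightarrow> 'x \<Rightarrow> 'x \<Rightarrow>\<^sub>0 'k::field) \<Rightarrow> bool" where
  "dup_coord X m \<longleftrightarrow> (\<forall>x\<in>X. \<forall>y\<in>X. \<forall>z\<in>X.
     pbind (m Prec x y) (\<lambda>u. m Prec u z) = pbind (m Prec y z) (m Prec x) \<and>
     pbind (m Succ x y) (\<lambda>u. m Prec u z) = pbind (m Prec y z) (m Succ x) \<and>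
     pbind (m Succ x y) (\<lambda>u. m Succ u z) = pbind (m Succ y z) (m Succ x))"

lemma bmul_bmul_left: "bmul m (bmul n p q) r =
    pbind p (\<lambda>a. pbind q (\<lambda>b. pbind r (\<lambda>c. pbind (n a b) (\<lambda>u. m u c))))"
  by (simp add: pbind_assoc pbind_swap[of r])

lemma bmul_bmul_right: "bmul m p (bmul n q r) =
    pbind p (\<lambda>a. pbind q (\<lambda>b. pbind r (\<lambda>c. pbind (n b c) (m a))))"
  by (simp add: pbind_assoc)

lemma bmul_assoc_lift:
  assumes "\<And>x y z. x \<in> X \<Longrightarrow> y \<in> X \<Longrightarrow> z \<in> X \<Longrightarrow> pbind (n x y) (\<lambda>u. m u z) = pbind (n' y z) (m' x)"
    and "p \<in> fs X" "q \<in> fs X" "r \<in> fs X"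
  shows "bmul m (bmul n p q) r = bmul m' p (bmul n' q r)"
  unfolding bmul_bmul_left bmul_bmul_right
  by (intro fs_pbind_cong[OF assms(2)] fs_pbind_cong[OF assms(3)] fs_pbind_cong[OF assms(4)] assms(1))

lemma dup_coord_lift:
  assumes "dup_coord X m" "p \<in> fs X" "q \<in> fs X" "r \<in> fs X"
  shows "bmul (m Prec) (bmul (m Prec) p q) r = bmul (m Prec) p (bmul (m Prec) q r)"
    and "bmul (m Prec) (bmul (m Succ) p q) r = bmul (m Succ) p (bmul (m Prec) q r)"
    and "bmul (m Succ) (bmul (m Succ) p q) r = bmul (m Succ) p (bmul (m Succ) q r)"
  using assms(1) by (auto intro!: bmul_assoc_lift[OF _ assms(2-4)] simp: dup_coord_def)

lemma duplicial_algebra_iff: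
  assumes "acoord A X c m"
  shows "duplicial_algebra A \<longleftrightarrow> dup_coord X m"
proof -
  interpret acoord A X c m by fact
  show ?thesis
  proof
    assume "duplicial_algebra A"
    then interpret d: duplicial_algebra A .
    show "dup_coord X m"
      unfolding dup_coord_def
    proof (intro ballI)
      fix x y z assume xyz: "x \<in> X" "y \<in> X" "z \<in> X"
      note v = ex_mem[OF xyz(1)] ex_mem[OF xyz(2)] ex_mem[OF xyz(3)]
      show "pbind (m Prec x y) (\<lambda>u. m Prec u z) = pbind (m Prec y z) (m Prec x) \<and>
         pbind (m Succ x y) (\<lambda>u. m Prec u z) = pbind (m Prec y z) (m Succ x) \<and>
         pbind (m Succ x y) (\<lambda>u. m Succ u z) = pbind (m Succ y z) (m Succ x)"
        using arg_cong[OF d.prec_prec[OF v], of c] arg_cong[OF d.succ_prec[OF v], of c]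
          arg_cong[OF d.succ_succ[OF v], of c] v xyz
        by (simp add: bop_mem)
    qed
  next
    assume *: "dup_coord X m"
    show "duplicial_algebra A"
      by unfold_locales
         (rule eqI; simp add: bop_mem dup_coord_lift[OF * c_mem c_mem c_mem])+
  qed
qed

locale bicoord = acoord H X c m + cocoord H X c "comult H" D
  for H :: "('k::field, 'a, dup_op, 'm) bialg_scheme" (structure) and X :: "'x set" and c m D

definition comp_coord :: "'x set \<Rightarrow> (dup_op \<Rightarrow> 'x \<Rightarrow> 'x \<Rightarrow> 'x \<Rightarrow>\<^sub>0 'k::field) \<Rightarrow> ('x \<Rightarrow> 'x list \<Rightarrow>\<^sub>0 'k) \<Rightarrow> bool" where
  "comp_coord X m D \<longleftrightarrow> (\<forall>op. \<forall>x\<in>X. \<forall>y\<in>X. pbind (m op x y) D = sg [x, y]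
     + pbind (D x) (\<lambda>xs. pbind (m op (xs ! 1) y) (\<lambda>z. sg [xs ! 0, z]))
     + pbind (D y) (\<lambda>xs. pbind (m op x (xs ! 0)) (\<lambda>z. sg [z, xs ! 1])))"

definition coass_coord :: "'x set \<Rightarrow> ('x \<Rightarrow> 'x list \<Rightarrow>\<^sub>0 'k::field) \<Rightarrow> bool" where
  "coass_coord X D \<longleftrightarrow> (\<forall>x\<in>X. pbind (D x) (D_first D) = pbind (D x) (D_second D))"

lemma comp_coord_lift:
  assumes "comp_coord X m D" "p \<in> fs X" "q \<in> fs X"
  shows "pbind (bmul (m op) p q) D = outer [p, q]
     + pbind (pbind p D) (\<lambda>xs. pbind q (\<lambda>b. pbind (m op (xs ! 1) b) (\<lambda>z. sg [xs ! 0, z])))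
     + pbind (pbind q D) (\<lambda>xs. pbind p (\<lambda>a. pbind (m op a (xs ! 0)) (\<lambda>z. sg [z, xs ! 1])))"
proof -
  have "pbind (bmul (m op) p q) D = pbind p (\<lambda>x. pbind q (\<lambda>y. sg [x, y]
     + pbind (D x) (\<lambda>xs. pbind (m op (xs ! 1) y) (\<lambda>z. sg [xs ! 0, z]))
     + pbind (D y) (\<lambda>xs. pbind (m op x (xs ! 0)) (\<lambda>z. sg [z, xs ! 1]))))"
    using assms(1) unfolding pbind_assoc comp_coord_def
    by (intro fs_pbind_cong[OF assms(2)] fs_pbind_cong[OF assms(3)]) blast
  also have "\<dots> = outer [p, q]
     + pbind (pbind p D) (\<lambda>xs. pbind q (\<lambda>b. pbind (m op (xs ! 1) b) (\<lambda>z. sg [xs ! 0, z])))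
     + pbind (pbind q D) (\<lambda>xs. pbind p (\<lambda>a. pbind (m op a (xs ! 0)) (\<lambda>z. sg [z, xs ! 1])))"
    unfolding pbind_add_right
    by (simp add: pbind_assoc pbind_swap[of q "D a" for a] pbind_swap[of p q]
        pbind_swap[of p "D a" for a])
  finally show ?thesis .
qed

context bicoord
begin

lemma comult_left_coord:
  assumes t: "t \<in> carrier (tensor_power 2 H)" and y: "y \<in> carrier H"
  shows "quot_lift (tensor_power 2 H) (\<lambda>ws. tensor H [ws ! 0, bop H op (ws ! 1) y]) t \<in> carrier (tensor_power 2 H)"
    and "tc c (quot_lift (tensor_power 2 H) (\<lambda>ws. tensor H [ws ! 0, bop H op (ws ! 1) y]) t) =
      pbind (tc c t) (\<lambda>xs. pbind (c y) (\<lambda>b. pbind (m op (xs ! 1) b) (\<lambda>z. sg [xs ! 0, z])))"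
proof -
  have "tensor H [ws ! 0, bop H op (ws ! 1) y] \<in> carrier (tensor_power 2 H) \<and>
    tc c (tensor H [ws ! 0, bop H op (ws ! 1) y]) = pbind (outer (map c ws))
      (\<lambda>xs. pbind (c y) (\<lambda>b. pbind (m op (xs ! 1) b) (\<lambda>z. sg [xs ! 0, z])))"
    if "ws \<in> words 2 (carrier H)" for ws
    using that y by (elim words_2E) (auto simp: bop_mem pbind_assoc intro!: tensor_mem)
  from quot_lift_coord[OF coord_tensor t this] show
    "quot_lift (tensor_power 2 H) (\<lambda>ws. tensor H [ws ! 0, bop H op (ws ! 1) y]) t \<in> carrier (tensor_power 2 H)"
    "tc c (quot_lift (tensor_power 2 H) (\<lambda>ws. tensor H [ws ! 0, bop H op (ws ! 1) y]) t) =
      pbind (tc c t) (\<lambda>xs. pbind (c y) (\<lambda>b. pbind (m op (xs ! 1) b) (\<lambda>z. sg [xs ! 0, z])))"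
    by auto
qed

lemma comult_right_coord:
  assumes t: "t \<in> carrier (tensor_power 2 H)" and x: "x \<in> carrier H"
  shows "quot_lift (tensor_power 2 H) (\<lambda>ws. tensor H [bop H op x (ws ! 0), ws ! 1]) t \<in> carrier (tensor_power 2 H)"
    and "tc c (quot_lift (tensor_power 2 H) (\<lambda>ws. tensor H [bop H op x (ws ! 0), ws ! 1]) t) =
      pbind (tc c t) (\<lambda>xs. pbind (c x) (\<lambda>a. pbind (m op a (xs ! 0)) (\<lambda>z. sg [z, xs ! 1])))"
proof -
  have "tensor H [bop H op x (ws ! 0), ws ! 1] \<in> carrier (tensor_power 2 H) \<and>
    tc c (tensor H [bop H op x (ws ! 0), ws ! 1]) = pbind (outer (map c ws))
      (\<lambda>xs. pbind (c x) (\<lambda>a. pbind (m op a (xs ! 0)) (\<lambda>z. sg [z, xs ! 1])))"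
    if ws: "ws \<in> words 2 (carrier H)" for ws
  proof -
    obtain a b where [simp]: "ws = [a, b]" and ab: "a \<in> carrier H" "b \<in> carrier H"
      using ws by (rule words_2E)
    show ?thesis using ab x
      by (simp add: bop_mem pbind_assoc tensor_mem pbind_swap[of "c a" "c x"] pbind_swap[of "c b"])
  qed
  from quot_lift_coord[OF coord_tensor t this] show
    "quot_lift (tensor_power 2 H) (\<lambda>ws. tensor H [bop H op x (ws ! 0), ws ! 1]) t \<in> carrier (tensor_power 2 H)"
    "tc c (quot_lift (tensor_power 2 H) (\<lambda>ws. tensor H [bop H op x (ws ! 0), ws ! 1]) t) =
      pbind (tc c t) (\<lambda>xs. pbind (c x) (\<lambda>a. pbind (m op a (xs ! 0)) (\<lambda>z. sg [z, xs ! 1])))"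
    by auto
qed

lemma comult_bop_iff:
  assumes x: "x \<in> carrier H" and y: "y \<in> carrier H"
  shows "comult H (bop H op x y) =
        (tensor H [x, y]
         \<oplus>\<^bsub>tensor_power 2 H\<^esub>
         quot_lift (tensor_power 2 H) (\<lambda>vs. tensor H [vs ! 0, bop H op (vs ! 1) y]) (comult H x))
         \<oplus>\<^bsub>tensor_power 2 H\<^esub>
         quot_lift (tensor_power 2 H) (\<lambda>vs. tensor H [bop H op x (vs ! 0), vs ! 1]) (comult H y)
    \<longleftrightarrow> pbind (bmul (m op) (c x) (c y)) D = outer [c x, c y]
     + pbind (pbind (c x) D) (\<lambda>xs. pbind (c y) (\<lambda>b. pbind (m op (xs ! 1) b) (\<lambda>z. sg [xs ! 0, z])))
     + pbind (pbind (c y) D) (\<lambda>xs. pbind (c x) (\<lambda>a. pbind (m op a (xs ! 0)) (\<lambda>z. sg [z, xs ! 1])))"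
    (is "?L = ?R \<longleftrightarrow> ?l = ?r")
proof -
  interpret T: coord "tensor_power 2 H" "words 2 X" "tc c" by (rule coord_tensor)
  have t: "tensor H [x, y] \<in> carrier (tensor_power 2 H)" using x y by (intro tensor_mem) auto
  note m = t comult_left_coord[OF \<delta>_mem[OF x] y] comult_right_coord[OF \<delta>_mem[OF y] x]
  have "?R \<in> carrier (tensor_power 2 H)" by (intro T.add_mem m)
  moreover have "?L \<in> carrier (tensor_power 2 H)" using x y by (intro \<delta>_mem bop_mem)
  moreover have "tc c ?L = ?l" using x y by (simp add: tc_\<delta> bop_mem)
  moreover have "tc c ?R = ?r" 
    using x y by (simp only: T.c_add T.add_mem m tc_tensor list.set list.map insert_subset empty_subsetI
        tc_\<delta> simp_thms)
  ultimately show ?thesis using T.c_inj[of ?L ?R] by simp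
qed

lemma duplicial_bialgebra_iff:
  "duplicial_bialgebra H \<longleftrightarrow> dup_coord X m \<and> coass_coord X D \<and> comp_coord X m D"
proof
  assume "duplicial_bialgebra H"
  then interpret d: duplicial_bialgebra H .
  have "comp_coord X m D" unfolding comp_coord_def
  proof (intro allI ballI)
    fix op x y assume xy: "x \<in> X" "y \<in> X"
    show "pbind (m op x y) D = sg [x, y] + pbind (D x) (\<lambda>xs. pbind (m op (xs ! 1) y) (\<lambda>z. sg [xs ! 0, z]))
     + pbind (D y) (\<lambda>xs. pbind (m op x (xs ! 0)) (\<lambda>z. sg [z, xs ! 1]))"
      using d.comult_bop[OF ex_mem[OF xy(1)] ex_mem[OF xy(2)], of op]
      unfolding comult_bop_iff[OF ex_mem[OF xy(1)] ex_mem[OF xy(2)]] using xy by simp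
  qed
  then show "dup_coord X m \<and> coass_coord X D \<and> comp_coord X m D"
    using d.comult_coassociative d.duplicial_algebra_axioms duplicial_algebra_iff[OF acoord_axioms]
    by (simp add: coass_coord_def coassociative_iff)
next
  assume *: "dup_coord X m \<and> coass_coord X D \<and> comp_coord X m D"
  then interpret d: duplicial_algebra H using duplicial_algebra_iff[OF acoord_axioms] by simp
  have "comult H (bop H op x y) =
        (tensor H [x, y]
         \<oplus>\<^bsub>tensor_power 2 H\<^esub>
         quot_lift (tensor_power 2 H) (\<lambda>vs. tensor H [vs ! 0, bop H op (vs ! 1) y]) (comult H x))
         \<oplus>\<^bsub>tensor_power 2 H\<^esub>
         quot_lift (tensor_power 2 H) (\<lambda>vs. tensor H [bop H op x (vs ! 0), vs ! 1]) (comult H y)"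
    if "x \<in> carrier H" "y \<in> carrier H" for op x y
    unfolding comult_bop_iff[OF that] using * that by (intro comp_coord_lift) (auto intro: c_mem)
  moreover have "coassociative H (comult H)" using * by (simp add: coass_coord_def coassociative_iff)
  ultimately show "duplicial_bialgebra H"
    by (intro duplicial_bialgebra.intro d.duplicial_algebra_axioms duplicial_bialgebra_axioms.intro linear_map_\<delta>)
qed

end

lemma duplicial_bialgebra_bicoord:
  fixes H :: "('k::field, 'a, dup_op, 'm) bialg_scheme"
  assumes "duplicial_bialgebra H"
  obtains X :: "'a set" and c m D where "bicoord H X c m D"
proof -
  interpret d: duplicial_bialgebra H by fact
  obtain X :: "'a set" and c m where 1: "acoord H X c m"
    using binary_algebra_acoord[OF d.binary_algebra_axioms] .
  from linear_map_cocoord[OF acoord.axioms(1)[OF 1] d.comult_linear] 1 that show ?thesis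
    by (metis bicoord.intro)
qed

section \<open>The duplicial bialgebra of words over a magmatic algebra\<close>

text \<open>
  A magmatic algebra with basis \<open>B\<close> is given by its structure constants \<open>\<mu>\<close>. On nonempty words over
  \<open>B\<close>, \<open>\<prec>\<close> is concatenation, and \<open>\<succ>\<close> is forced by \<open>a \<succ> h = a \<prec> h - a \<cdot> h\<close> for letters and by the
  duplicial relations: \<open>a \<prec> v = (a \<cdot> b) \<prec> w + a \<succ> v\<close> for \<open>v = b \<prec> w\<close>, hence
  \<open>(a \<prec> v) \<succ> y = ((a \<cdot> b) \<prec> w) \<succ> y + a \<succ> (v \<succ> y)\<close>.
\<close>

fun letter_succ :: "('b \<Rightarrow> 'b \<Rightarrow> 'b \<Rightarrow>\<^sub>0 'k::field) \<Rightarrow> 'b \<Rightarrow> 'b list \<Rightarrow> 'b list \<Rightarrow>\<^sub>0 'k" where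
  "letter_succ \<mu> a [] = 0"
| "letter_succ \<mu> a (h # t) = sg (a # h # t) - pbind (\<mu> a h) (\<lambda>c. sg (c # t))"

fun word_succ :: "('b \<Rightarrow> 'b \<Rightarrow> 'b \<Rightarrow>\<^sub>0 'k::field) \<Rightarrow> 'b list \<Rightarrow> 'b list \<Rightarrow> 'b list \<Rightarrow>\<^sub>0 'k" where
  "word_succ \<mu> [] y = 0"
| "word_succ \<mu> [a] y = letter_succ \<mu> a y"
| "word_succ \<mu> (a # b # w) y =
     pbind (\<mu> a b) (\<lambda>c. word_succ \<mu> (c # w) y) + pbind (word_succ \<mu> (b # w) y) (letter_succ \<mu> a)"

primrec word_op :: "('b \<Rightarrow> 'b \<Rightarrow> 'b \<Rightarrow>\<^sub>0 'k::field) \<Rightarrow> dup_op \<Rightarrow> 'b list \<Rightarrow> 'b list \<Rightarrow> 'b list \<Rightarrow>\<^sub>0 'k" where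
  "word_op \<mu> Prec = (\<lambda>x y. sg (x @ y))"
| "word_op \<mu> Succ = word_succ \<mu>"

definition nwords :: "'b set \<Rightarrow> 'b list set" where
  "nwords B = {w. w \<noteq> [] \<and> set w \<subseteq> B}"

text \<open>Deconcatenation by recursion on the word, matching the inductions that follow; the sum
  over cut positions is recovered in \<open>dec_sum\<close>.\<close>

primrec dec :: "'b list \<Rightarrow> 'b list list \<Rightarrow>\<^sub>0 'k::field" where
  "dec [] = 0"
| "dec (a # w) = (if w = [] then 0 else sg [[a], w]) + pbind (dec w) (\<lambda>ps. sg [a # ps ! 0, ps ! 1])"

lemma letter_succ_mem:
  assumes "\<And>a b. a \<in> B \<Longrightarrow> b \<in> B \<Longrightarrow> \<mu> a b \<in> fs B" "a \<in> B" "y \<in> nwords B"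
  shows "letter_succ \<mu> a y \<in> fs (nwords B)"
  using assms by (cases y) (auto simp: nwords_def intro!: subsp_diff fs_pbind[of _ B])

lemma word_succ_mem:
  assumes \<mu>: "\<And>a b. a \<in> B \<Longrightarrow> b \<in> B \<Longrightarrow> \<mu> a b \<in> fs B"
  shows "set x \<subseteq> B \<Longrightarrow> y \<in> nwords B \<Longrightarrow> word_succ \<mu> x y \<in> fs (nwords B)"
proof (induction "length x" arbitrary: x rule: less_induct)
  case less
  consider "x = []" | a where "x = [a]" | a b w where "x = a # b # w"
    by (metis list.exhaust)
  then show ?case
  proof cases
    case 3
    have ab: "a \<in> B" "b \<in> B" "set w \<subseteq> B" using less.prems 3 by auto
    have "word_succ \<mu> (c # w) y \<in> fs (nwords B)" if "c \<in> B" for c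
      using less.hyps[of "c # w"] less.prems 3 that by auto
    moreover have "word_succ \<mu> (b # w) y \<in> fs (nwords B)"
      using less.hyps[of "b # w"] less.prems 3 by auto
    ultimately show ?thesis using ab 3 \<mu>
      by (auto intro!: subsp_add fs_pbind[OF \<mu>] fs_pbind[of _ "nwords B"] letter_succ_mem)
  qed (use less.prems \<mu> in \<open>auto intro!: letter_succ_mem\<close>)
qed

lemma word_op_mem:
  assumes "\<And>a b. a \<in> B \<Longrightarrow> b \<in> B \<Longrightarrow> \<mu> a b \<in> fs B" "x \<in> nwords B" "y \<in> nwords B"
  shows "word_op \<mu> op x y \<in> fs (nwords B)"
  using assms by (cases op) (auto simp: nwords_def[of B] intro!: word_succ_mem[unfolded nwords_def])

lemma word_succ_nonempty: "y \<noteq> [] \<Longrightarrow> word_succ \<mu> x y \<in> fs {w. w \<noteq> []}"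
  using word_succ_mem[of UNIV \<mu> x y] by (simp add: nwords_def)

text \<open>\<open>letter_succ\<close> touches only the first letter of its right argument, and
  \<open>y \<noteq> []\<close> keeps that letter inside \<open>y\<close>. This locality is the
  source of the law \<open>(x \<succ> y) \<prec> z = x \<succ> (y \<prec> z)\<close>.\<close>

lemma letter_succ_append: "y \<noteq> [] \<Longrightarrow> letter_succ \<mu> a (y @ z) = pbind (letter_succ \<mu> a y) (\<lambda>u. sg (u @ z))"
  by (cases y) (auto simp: pbind_lin pbind_assoc)

lemma word_succ_append: "y \<noteq> [] \<Longrightarrow> word_succ \<mu> x (y @ z) = pbind (word_succ \<mu> x y) (\<lambda>u. sg (u @ z))"
proof (induction \<mu> x y rule: word_succ.induct)
  case (3 \<mu> a b w y)
  have "pbind (word_succ \<mu> (b # w) y) (\<lambda>u. letter_succ \<mu> a (u @ z)) =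
      pbind (word_succ \<mu> (b # w) y) (\<lambda>u. pbind (letter_succ \<mu> a u) (\<lambda>u. sg (u @ z)))"
    by (rule fs_pbind_cong[OF word_succ_nonempty[OF 3(3)]]) (simp add: letter_succ_append)
  then show ?case using 3 by (simp add: pbind_lin pbind_assoc cong: pbind_cong)
qed (auto simp: letter_succ_append)

text \<open>When \<open>x\<close> is a single letter, the claim is the third clause of
  \<open>word_succ\<close> with its first summand moved to the other side. Longer words follow along
  the recursion.\<close>

lemma word_succ_succ: "y \<noteq> [] \<Longrightarrow>
  pbind (word_succ \<mu> x y) (\<lambda>u. word_succ \<mu> u z) = pbind (word_succ \<mu> y z) (word_succ \<mu> x)"
proof (induction \<mu> x y rule: word_succ.induct)
  case (2 \<mu> a y)
  then show ?case by (cases y) (auto simp: pbind_lin pbind_assoc)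
next
  case (3 \<mu> a b w y)
  have l: "pbind (letter_succ \<mu> a u) (\<lambda>v. word_succ \<mu> v z) = pbind (word_succ \<mu> u z) (letter_succ \<mu> a)" 
    if "u \<noteq> []" for u
    using that by (cases u) (auto simp: pbind_lin pbind_assoc)
  have "pbind (word_succ \<mu> (b # w) y) (\<lambda>u. pbind (letter_succ \<mu> a u) (\<lambda>v. word_succ \<mu> v z)) =
      pbind (word_succ \<mu> (b # w) y) (\<lambda>u. pbind (word_succ \<mu> u z) (letter_succ \<mu> a))"
    by (rule fs_pbind_cong[OF word_succ_nonempty[OF 3(3)]]) (simp add: l)
  also have "\<dots> = pbind (pbind (word_succ \<mu> (b # w) y) (\<lambda>u. word_succ \<mu> u z)) (letter_succ \<mu> a)"
    by (simp add: pbind_assoc)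
  also have "\<dots> = pbind (word_succ \<mu> y z) (\<lambda>u. pbind (word_succ \<mu> (b # w) u) (letter_succ \<mu> a))"
    using 3 by (simp add: pbind_assoc)
  finally show ?case using 3
    by (simp add: pbind_lin pbind_assoc pbind_swap[of "word_succ \<mu> y z"] cong: pbind_cong)
qed (simp add: word_succ.simps(1)[abs_def])

lemma word_op_dup_coord: "dup_coord (nwords B) (word_op \<mu>)"
  by (auto simp: dup_coord_def nwords_def word_succ_append word_succ_succ)

lemma dec_mem: "w \<in> nwords B \<Longrightarrow> dec w \<in> fs (words 2 (nwords B))"
proof (induction w)
  case (Cons a w)
  show ?case
  proof (cases "w = []")
    case False
    then have "w \<in> nwords B" "a \<in> B" using Cons.prems by (auto simp: nwords_def)
    with False Cons.IH Cons.prems show ?thesis 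
      by (auto intro!: subsp_add fs_pbind[of _ "words 2 (nwords B)"] elim!: words_2E simp: words_def[of 2] nwords_def)
  qed simp
qed simp

lemma dec_nonempty: "dec w \<in> fs (words 2 {w. w \<noteq> []})"
  using dec_mem[of w UNIV] by (cases w) (simp_all add: nwords_def)

lemma dec_cong:
  assumes "\<And>p q. p \<noteq> [] \<Longrightarrow> q \<noteq> [] \<Longrightarrow> f [p, q] = g [p, q]"
  shows "pbind (dec w) f = pbind (dec w) g"
  using assms by (intro fs_pbind_cong[OF dec_nonempty]) (auto elim!: words_2E)

text \<open>A cut of a concatenation lies at the joint, inside \<open>x\<close> or inside
  \<open>y\<close>; these are the three terms of the compatibility relation for
  \<open>\<prec>\<close>.\<close>

lemma dec_append:
  "x \<noteq> [] \<Longrightarrow> y \<noteq> [] \<Longrightarrow> dec (x @ y) = sg [x, y] + pbind (dec x) (\<lambda>ps. sg [ps ! 0, ps ! 1 @ y])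
     + pbind (dec y) (\<lambda>ps. sg [x @ ps ! 0, ps ! 1])"
proof (induction x)
  case (Cons a x)
  then show ?case by (cases "x = []") (auto simp: pbind_lin pbind_assoc)
qed simp

text \<open>Every cut leaves the first letter in the left part, so merging \<open>a\<close> into it
  commutes with cutting. The arbitrary \<open>G\<close> allows the two parts to be processed
  further.\<close>

lemma dec_letter_succ:
  "pbind (dec (b # w)) (\<lambda>ps. pbind (letter_succ \<mu> a (ps ! 0)) (\<lambda>z. G z (ps ! 1))) =
    pbind (dec (b # w)) (\<lambda>ps. G (a # ps ! 0) (ps ! 1)) - pbind (\<mu> a b) (\<lambda>c. pbind (dec (c # w)) (\<lambda>ps. G (ps ! 0) (ps ! 1)))"
  by (cases "w = []") (simp_all add: pbind_lin pbind_assoc pbind_swap[of "\<mu> a b"])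

lemma letter_succ_dec:
  "u \<noteq> [] \<Longrightarrow> pbind (letter_succ \<mu> a u) dec =
    sg [[a], u] + pbind (dec u) (\<lambda>ps. pbind (letter_succ \<mu> a (ps ! 0)) (\<lambda>z. sg [z, ps ! 1]))"
proof (cases u)
  case (Cons h t)
  show ?thesis unfolding Cons dec_letter_succ[where G = "\<lambda>z q. sg [z, q]"]
    by (cases "t = []") (simp_all add: pbind_lin pbind_assoc)
qed simp

lemma word_succ_dec:
  "x \<noteq> [] \<Longrightarrow> y \<noteq> [] \<Longrightarrow> pbind (word_succ \<mu> x y) dec = sg [x, y]
     + pbind (dec x) (\<lambda>ps. pbind (word_succ \<mu> (ps ! 1) y) (\<lambda>z. sg [ps ! 0, z]))
     + pbind (dec y) (\<lambda>ps. pbind (word_succ \<mu> x (ps ! 0)) (\<lambda>z. sg [z, ps ! 1]))"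
proof (induction \<mu> x y rule: word_succ.induct)
  case (2 \<mu> a y)
  then show ?case by (simp add: letter_succ_dec)
next
  case (3 \<mu> a b w y)
  let ?s = "word_succ \<mu>"
  let ?G = "\<lambda>p q. pbind (?s q y) (\<lambda>z. sg [p, z])"
  have "pbind (?s (b # w) y) (\<lambda>u. pbind (letter_succ \<mu> a u) dec) =
      pbind (?s (b # w) y) (\<lambda>u. sg [[a], u] + pbind (dec u) (\<lambda>ps. pbind (letter_succ \<mu> a (ps ! 0)) (\<lambda>z. sg [z, ps ! 1])))"
    by (rule fs_pbind_cong[OF word_succ_nonempty[OF 3(4)]]) (simp add: letter_succ_dec)
  also have "\<dots> = ?G [a] (b # w)
      + pbind (pbind (?s (b # w) y) dec) (\<lambda>ps. pbind (letter_succ \<mu> a (ps ! 0)) (\<lambda>z. sg [z, ps ! 1]))"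
    by (simp add: pbind_lin pbind_assoc)
  also have "\<dots> = ?G [a] (b # w) + (pbind (letter_succ \<mu> a (b # w)) (\<lambda>z. sg [z, y])
      + pbind (dec (b # w)) (\<lambda>ps. pbind (letter_succ \<mu> a (ps ! 0)) (\<lambda>z. ?G z (ps ! 1)))
      + pbind (dec y) (\<lambda>ps. pbind (pbind (?s (b # w) (ps ! 0)) (letter_succ \<mu> a)) (\<lambda>z. sg [z, ps ! 1])))"
    unfolding 3(2)[OF list.distinct(2) 3(4)]
    by (simp add: pbind_lin pbind_assoc pbind_swap[of "letter_succ \<mu> a u" for u] del: dec.simps letter_succ.simps)
  finally have A: "pbind (?s (b # w) y) (\<lambda>u. pbind (letter_succ \<mu> a u) dec) = \<dots>" .
  have B: "pbind (\<mu> a b) (\<lambda>c. pbind (?s (c # w) y) dec) = pbind (\<mu> a b) (\<lambda>c. sg [c # w, y]) + 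
      pbind (\<mu> a b) (\<lambda>c. pbind (dec (c # w)) (\<lambda>ps. ?G (ps ! 0) (ps ! 1))) +
      pbind (dec y) (\<lambda>ps. pbind (pbind (\<mu> a b) (\<lambda>c. ?s (c # w) (ps ! 0))) (\<lambda>z. sg [z, ps ! 1]))"
    by (simp add: 3(1)[OF _ list.distinct(2) 3(4)] pbind_lin pbind_assoc pbind_swap[of "\<mu> a b" "dec y"]
        cong: pbind_cong del: dec.simps)
  have C: "pbind (dec (a # b # w)) (\<lambda>ps. ?G (ps ! 0) (ps ! 1)) = ?G [a] (b # w) + 
      pbind (dec (b # w)) (\<lambda>ps. ?G (a # ps ! 0) (ps ! 1))"
    unfolding dec.simps(2)[of a "b # w"] by (simp add: pbind_lin pbind_assoc del: dec.simps)
  have "pbind (?s (a # b # w) y) dec = pbind (\<mu> a b) (\<lambda>c. pbind (?s (c # w) y) dec) +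
      pbind (?s (b # w) y) (\<lambda>u. pbind (letter_succ \<mu> a u) dec)"
    by (simp add: pbind_lin pbind_assoc)
  \<comment> \<open>All terms containing \<open>\<mu> a b\<close> from the first summand of
    \<open>word_succ\<close> cancel against the second: at the joint with \<open>y\<close> by the
    definition of \<open>letter_succ\<close>, and at the cuts inside \<open>x\<close> by
    \<open>dec_letter_succ\<close>.\<close>
  also have "\<dots> = sg [a # b # w, y] + pbind (dec (a # b # w)) (\<lambda>ps. ?G (ps ! 0) (ps ! 1)) +
     pbind (dec y) (\<lambda>ps. pbind (?s (a # b # w) (ps ! 0)) (\<lambda>z. sg [z, ps ! 1]))"
    unfolding A B C dec_letter_succ[where G = "\<lambda>p q. pbind (word_succ \<mu> q y) (\<lambda>z. sg [p, z])"] by (simp add: pbind_lin pbind_assoc del: dec.simps)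
  finally show ?case .
qed simp

lemma word_comp_coord: "comp_coord (nwords B) (word_op \<mu>) dec"
  unfolding comp_coord_def
proof (intro allI ballI)
  fix op x y assume "x \<in> nwords B" "y \<in> nwords B"
  then have "x \<noteq> []" "y \<noteq> []" by (auto simp: nwords_def)
  then show "pbind (word_op \<mu> op x y) dec = sg [x, y]
     + pbind (dec x) (\<lambda>ps. pbind (word_op \<mu> op (ps ! 1) y) (\<lambda>z. sg [ps ! 0, z]))
     + pbind (dec y) (\<lambda>ps. pbind (word_op \<mu> op x (ps ! 0)) (\<lambda>z. sg [z, ps ! 1]))"
    by (cases op) (simp_all add: dec_append word_succ_dec)
qed

text \<open>Prepending \<open>a\<close> to a left part creates one further cut, right behind
  \<open>a\<close>. Under \<open>D_first\<close> these extra terms add up to what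
  \<open>D_second\<close> produces from the cut into \<open>[a]\<close> and \<open>w\<close>; all
  other terms match by induction.\<close>

lemma dec_coass: "pbind (dec w) (D_first dec) = pbind (dec w) (D_second dec)"
proof (induction w)
  case (Cons a w)
  have 1: "pbind (dec w) (\<lambda>ps. D_first dec [a # ps ! 0, ps ! 1]) =
      pbind (dec w) (\<lambda>ps. sg ([a] # ps)) + pbind (pbind (dec w) (D_first dec)) (\<lambda>ps. sg ((a # hd ps) # tl ps))"
    unfolding pbind_assoc pbind_add_right[symmetric]
    by (rule dec_cong) (auto simp: D_first_def pbind_lin pbind_assoc intro!: dec_cong)
  have 2: "pbind (dec w) (\<lambda>ps. D_second dec [a # ps ! 0, ps ! 1]) =
      pbind (pbind (dec w) (D_second dec)) (\<lambda>ps. sg ((a # hd ps) # tl ps))"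
    unfolding pbind_assoc by (rule dec_cong) (auto simp: D_second_def pbind_lin pbind_assoc)
  have 3: "dec (a # w) = (if w = [] then 0 else sg [[a], w]) + pbind (dec w) (\<lambda>ps. sg [a # ps ! 0, ps ! 1])"
    by simp
  have 4: "pbind (if w = [] then 0 else sg [[a], w]) (D_first dec) = 0"
    by (simp add: D_first_def)
  have 5: "pbind (if w = [] then 0 else sg [[a], w]) (D_second dec) = pbind (dec w) (\<lambda>ps. sg ([a] # ps))"
    by (simp add: D_second_def)
  show ?case
    unfolding 3 pbind_add 4 5 pbind_assoc pbind_single scl_simps 1 2 Cons.IH[unfolded pbind_assoc] by simp
qed simp

lemma dec_coass_coord: "coass_coord X dec"
  by (simp add: coass_coord_def dec_coass)

section \<open>Nilpotency of iterated deconcatenation\<close>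

lemma dec_concat: "(dec v :: 'b list list \<Rightarrow>\<^sub>0 'k::field) \<in> fs {ps. length ps = 2 \<and> [] \<notin> set ps \<and> concat ps = v}"
proof (induction v)
  case (Cons a v)
  have "pbind (dec v :: 'b list list \<Rightarrow>\<^sub>0 'k) (\<lambda>ps. sg [a # ps ! 0, ps ! 1]) \<in> fs {ps. length ps = 2 \<and> [] \<notin> set ps \<and> concat ps = a # v}"
    using Cons.IH by (rule fs_pbind) (auto simp: length_Suc_conv numeral_2_eq_2)
  then show ?case by (auto intro!: subsp_add)
qed simp

lemma D_iter_dec:
  "w \<noteq> [] \<Longrightarrow> (D_iter dec r w :: 'b list list \<Rightarrow>\<^sub>0 'k::field) \<in> fs {ps. length ps = Suc r \<and> [] \<notin> set ps \<and> concat ps = w}"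
proof (induction r)
  case (Suc r)
  have "(D_iter dec r w :: 'b list list \<Rightarrow>\<^sub>0 'k) \<in> fs {ps. length ps = Suc r \<and> [] \<notin> set ps \<and> concat ps = w}" using Suc by simp
  then show ?case unfolding D_iter.simps
  proof (rule fs_pbind)
    fix ps assume "ps \<in> {ps. length ps = Suc r \<and> [] \<notin> set ps \<and> concat ps = w}"
    then obtain p qs where ps: "ps = p # qs" "length qs = r" "[] \<notin> set qs" "p @ concat qs = w"
      by (cases ps) auto
    show "D_first dec ps \<in> fs {ps. length ps = Suc (Suc r) \<and> [] \<notin> set ps \<and> concat ps = w}"
      unfolding D_first_def using dec_concat by (rule fs_pbind) (auto simp: ps)
  qed
qed simp

text \<open>A word has no decomposition into more nonempty pieces than it has letters.\<close>

lemma D_iter_dec_0: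
  fixes w :: "'b list"
  assumes "w \<noteq> []" "length w \<le> r"
  shows "(D_iter dec r w :: 'b list list \<Rightarrow>\<^sub>0 'k::field) = 0"
proof -
  have "length ps \<le> length (concat ps)" if "[] \<notin> set ps" for ps :: "'b list list"
    using that
  proof (induction ps)
    case (Cons p ps)
    then show ?case by (cases p) auto
  qed simp
  then have "{ps. length ps = Suc r \<and> [] \<notin> set ps \<and> concat ps = w} = {}"
    using assms by fastforce
  then have "(D_iter dec r w :: 'b list list \<Rightarrow>\<^sub>0 'k) \<in> fs {}" using D_iter_dec[OF assms(1), of r] by metis
  then show ?thesis by (simp add: fs_def)
qed

lemma dec_connected:
  assumes "cocoord V X c \<delta> dec" "X \<subseteq> {w. w \<noteq> []}"
  shows "connected_coalgebra V \<delta>"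
proof -
  interpret cocoord V X c \<delta> dec by fact
  have "\<exists>r\<ge>1. pbind (c x) (D_iter dec r) = 0" if x: "x \<in> carrier V" for x
  proof -
    \<comment> \<open>\<open>Suc\<close> makes the index at least 1, as the filtration demands, and
      the inserted 0 keeps \<open>Max\<close> defined when \<open>c x\<close> is zero.\<close>
    define r where "r = Suc (Max (insert 0 (length ` Poly_Mapping.keys (c x))))"
    have "pbind (c x) (D_iter dec r) = pbind (c x) (\<lambda>w. 0)"
    proof (rule pbind_cong[OF refl])
      fix w assume w: "w \<in> Poly_Mapping.keys (c x)"
      then have "length w \<le> r" unfolding r_def by (intro le_SucI Max_ge) auto
      then show "D_iter dec r w = 0"
        using w c_mem[OF x] assms(2) by (intro D_iter_dec_0) (auto simp: fs_def)
    qed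
    then show ?thesis by (intro exI[of _ r]) (auto simp: r_def)
  qed
  then show ?thesis by (simp add: connected_iff)
qed

section \<open>Evaluation of words in a duplicial algebra\<close>

text \<open>The product under \<open>\<prec>\<close> of the images of the letters. In the absence of
  a unit a single letter needs its own clause, and the value at the empty word is a default.\<close>

fun word_eval :: "(dup_op \<Rightarrow> 'x \<Rightarrow> 'x \<Rightarrow> 'x \<Rightarrow>\<^sub>0 'k::field) \<Rightarrow> ('b \<Rightarrow> 'x \<Rightarrow>\<^sub>0 'k) \<Rightarrow> 'b list \<Rightarrow> 'x \<Rightarrow>\<^sub>0 'k" where
  "word_eval m f [] = 0"
| "word_eval m f [a] = f a"
| "word_eval m f (a # b # w) = bmul (m Prec) (f a) (word_eval m f (b # w))"

text \<open>\<open>f\<close> is a magmatic morphism from the algebra with structure constants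
  \<open>\<mu>\<close> to a duplicial algebra. The outcome \<open>E_word_op\<close>, that
  \<open>f\<close> extends to a duplicial morphism on words, is the universal property behind both
  \<open>Dup(V)\<close> and \<open>U(L)\<close>, and it also gives the comparison map into a
  connected bialgebra.\<close>

locale word_morphism =
  fixes X :: "'x set" and m :: "dup_op \<Rightarrow> 'x \<Rightarrow> 'x \<Rightarrow> 'x \<Rightarrow>\<^sub>0 'k::field"
    and B :: "'b set" and \<mu> :: "'b \<Rightarrow> 'b \<Rightarrow> 'b \<Rightarrow>\<^sub>0 'k" and f :: "'b \<Rightarrow> 'x \<Rightarrow>\<^sub>0 'k"
  assumes dup: "dup_coord X m"
    and m_mem: "\<lbrakk>x \<in> X; y \<in> X\<rbrakk> \<Longrightarrow> m op x y \<in> fs X"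
    and \<mu>_mem: "\<lbrakk>a \<in> B; b \<in> B\<rbrakk> \<Longrightarrow> \<mu> a b \<in> fs B"
    and f_mem: "a \<in> B \<Longrightarrow> f a \<in> fs X"
    and f_mult: "\<lbrakk>a \<in> B; b \<in> B\<rbrakk> \<Longrightarrow>
      pbind (\<mu> a b) f = bmul (m Prec) (f a) (f b) - bmul (m Succ) (f a) (f b)"
begin

abbreviation "E \<equiv> word_eval m f"

lemma bmul_mem: "p \<in> fs X \<Longrightarrow> q \<in> fs X \<Longrightarrow> bmul (m op) p q \<in> fs X"
  by (auto intro!: fs_pbind m_mem)

lemma E_Cons: "w \<noteq> [] \<Longrightarrow> E (a # w) = bmul (m Prec) (f a) (E w)"
  by (cases w) auto

lemma E_mem: "set w \<subseteq> B \<Longrightarrow> E w \<in> fs X"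
proof (induction w)
  case (Cons a w)
  then show ?case by (cases "w = []") (auto simp: E_Cons intro!: bmul_mem f_mem)
qed simp

lemma E_append:
  "x \<noteq> [] \<Longrightarrow> y \<noteq> [] \<Longrightarrow> set x \<subseteq> B \<Longrightarrow> set y \<subseteq> B \<Longrightarrow> E (x @ y) = bmul (m Prec) (E x) (E y)"
proof (induction x)
  case (Cons a x)
  show ?case
  proof (cases "x = []")
    case True
    then show ?thesis using Cons.prems by (simp add: E_Cons)
  next
    case False
    then show ?thesis using Cons
      by (simp add: E_Cons dup_coord_lift(1)[OF dup f_mem E_mem E_mem] del: pbind_assoc)
  qed
qed simp

text \<open>Split off the first letter \<open>h\<close> of \<open>y\<close>. Substituting
  \<open>f_mult\<close> for the merged letter and using both laws of the form
  \<open>(_) \<prec> z\<close> cancels the terms with \<open>\<prec>\<close> and leaves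
  \<open>f a \<succ> (f h \<prec> E t)\<close>.\<close>

lemma E_letter_succ:
  assumes "a \<in> B" "y \<in> nwords B"
  shows "pbind (letter_succ \<mu> a y) E = bmul (m Succ) (f a) (E y)"
proof -
  obtain h t where y: "y = h # t" "h \<in> B" "set t \<subseteq> B" using assms by (cases y) (auto simp: nwords_def)
  show ?thesis
  proof (cases "t = []")
    case True
    then show ?thesis using assms y by (simp add: pbind_lin f_mult pbind_assoc)
  next
    case False
    have "pbind (letter_succ \<mu> a y) E = bmul (m Prec) (f a) (bmul (m Prec) (f h) (E t)) -
        bmul (m Prec) (pbind (\<mu> a h) f) (E t)"
      using False by (simp add: y pbind_lin pbind_assoc E_Cons)
    also have "\<dots> = bmul (m Prec) (f a) (bmul (m Prec) (f h) (E t)) -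
        (bmul (m Prec) (bmul (m Prec) (f a) (f h)) (E t) - bmul (m Prec) (bmul (m Succ) (f a) (f h)) (E t))"
      using assms y by (simp only: f_mult pbind_diff)
    also have "\<dots> = bmul (m Succ) (f a) (bmul (m Prec) (f h) (E t))"
      using assms y by (simp only: dup_coord_lift(1,2)[OF dup f_mem f_mem E_mem]) simp
    also have "\<dots> = bmul (m Succ) (f a) (E y)" using False by (simp add: y E_Cons)
    finally show ?thesis .
  qed
qed

text \<open>The induction is on the length, because the recursion of \<open>word_succ\<close> turns
  \<open>a # b # w\<close> into words \<open>c # w\<close> with a new first letter.\<close>

lemma E_word_succ:
  "x \<in> nwords B \<Longrightarrow> y \<in> nwords B \<Longrightarrow> pbind (word_succ \<mu> x y) E = bmul (m Succ) (E x) (E y)"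
proof (induction "length x" arbitrary: x rule: less_induct)
  case less
  consider a where "x = [a]" "a \<in> B" | a b w where "x = a # b # w" "a \<in> B" "b \<in> B" "set w \<subseteq> B"
    using less.prems unfolding nwords_def by (cases x; cases "tl x") auto
  then show ?case
  proof cases
    case 1
    then show ?thesis using E_letter_succ[OF _ less.prems(2)] by simp
  next
    case 2
    have w: "b # w \<in> nwords B" "c \<in> B \<Longrightarrow> c # w \<in> nwords B" for c using 2 by (auto simp: nwords_def)
    have Ey: "E y \<in> fs X" using less.prems by (intro E_mem) (auto simp: nwords_def)
    have Ebw: "E (b # w) \<in> fs X" using 2 by (intro E_mem) auto
    have 3: "pbind (word_succ \<mu> (b # w) y) E = bmul (m Succ) (E (b # w)) (E y)"
      using less.hyps[of "b # w"] 2 w less.prems by simp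
    have 4: "pbind (word_succ \<mu> (c # w) y) E = bmul (m Succ) (E (c # w)) (E y)" if "c \<in> B" for c
      using less.hyps[of "c # w"] 2 w that less.prems by simp
    have "pbind (word_succ \<mu> x y) E = pbind (\<mu> a b) (\<lambda>c. pbind (word_succ \<mu> (c # w) y) E) +
        pbind (word_succ \<mu> (b # w) y) (\<lambda>u. pbind (letter_succ \<mu> a u) E)"
      by (simp add: 2 pbind_lin pbind_assoc)
    also have "pbind (\<mu> a b) (\<lambda>c. pbind (word_succ \<mu> (c # w) y) E) =
        bmul (m Succ) (pbind (\<mu> a b) (\<lambda>c. E (c # w))) (E y)"
      unfolding pbind_assoc by (rule fs_pbind_cong[OF \<mu>_mem[OF 2(2,3)]]) (rule 4)
    \<comment> \<open>Read backwards, \<open>E_letter_succ\<close> evaluates the words with merged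
      first letters. Its correction term cancels the second summand of \<open>word_succ\<close> by
      associativity of \<open>\<succ>\<close>.\<close>
    also have "pbind (\<mu> a b) (\<lambda>c. E (c # w)) = E x - bmul (m Succ) (f a) (E (b # w))"
      using E_letter_succ[OF 2(2) w(1)] by (simp add: 2 pbind_lin pbind_assoc algebra_simps)
    also have "pbind (word_succ \<mu> (b # w) y) (\<lambda>u. pbind (letter_succ \<mu> a u) E) =
        pbind (word_succ \<mu> (b # w) y) (\<lambda>u. bmul (m Succ) (f a) (E u))"
      using w less.prems(2) 
      by (intro fs_pbind_cong[OF word_succ_mem[OF \<mu>_mem]] E_letter_succ 2) (auto simp: nwords_def)
    also have "\<dots> = bmul (m Succ) (f a) (pbind (word_succ \<mu> (b # w) y) E)"
      by (simp add: pbind_assoc pbind_swap[of "word_succ \<mu> (b # w) y"])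
    also have "\<dots> = bmul (m Succ) (bmul (m Succ) (f a) (E (b # w))) (E y)"
      unfolding 3 using dup_coord_lift(3)[OF dup f_mem[OF 2(2)] Ebw Ey] by simp
    finally show ?thesis by (simp add: pbind_diff)
  qed
qed

lemma E_word_op:
  assumes "x \<in> nwords B" "y \<in> nwords B"
  shows "pbind (word_op \<mu> op x y) E = bmul (m op) (E x) (E y)"
  using assms E_word_succ[OF assms] E_append[of x y] by (cases op) (auto simp: nwords_def)

end

section \<open>Free algebras in coordinates\<close>

abbreviation op_tm :: "'o \<Rightarrow> ('o, 'v) tm \<Rightarrow> ('o, 'v) tm \<Rightarrow> ('o, 'v) tm \<Rightarrow>\<^sub>0 'k::field" where
  "op_tm op s t \<equiv> sg (Op op s t)"

definition tms :: "'v set \<Rightarrow> ('o, 'v) tm set" where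
  "tms X = {t. gens t \<subseteq> X}"

lemma tms_simps [simp]: "Gen v \<in> tms X \<longleftrightarrow> v \<in> X" "Op op s t \<in> tms X \<longleftrightarrow> s \<in> tms X \<and> t \<in> tms X"
  by (auto simp: tms_def)

primrec ev :: "('o \<Rightarrow> 'x \<Rightarrow> 'x \<Rightarrow> 'x \<Rightarrow>\<^sub>0 'k::field) \<Rightarrow> ('v \<Rightarrow> 'x \<Rightarrow>\<^sub>0 'k) \<Rightarrow> ('o, 'v) tm \<Rightarrow> 'x \<Rightarrow>\<^sub>0 'k" where
  "ev m g (Gen v) = g v"
| "ev m g (Op op s t) = bmul (m op) (ev m g s) (ev m g t)"

lemma ev_mem:
  assumes "\<And>op a b. a \<in> Y \<Longrightarrow> b \<in> Y \<Longrightarrow> m op a b \<in> fs Y" "\<And>v. v \<in> gens t \<Longrightarrow> g v \<in> fs Y"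
  shows "ev m g t \<in> fs Y"
  using assms(2) by (induction t) (auto intro!: fs_pbind assms(1))

lemma (in acoord) eval_tm_coord:
  assumes "\<And>v. v \<in> gens t \<Longrightarrow> f v \<in> carrier A"
  shows "eval_tm A f t \<in> carrier A" "c (eval_tm A f t) = ev m (\<lambda>v. c (f v)) t"
proof -
  have "eval_tm A f t \<in> carrier A \<and> c (eval_tm A f t) = ev m (\<lambda>v. c (f v)) t"
    using assms by (induction t) (auto simp: bop_mem)
  then show "eval_tm A f t \<in> carrier A" "c (eval_tm A f t) = ev m (\<lambda>v. c (f v)) t" by auto
qed

lemma bop_term_alg: "bop (term_alg V) op p q = bmul (op_tm op) p q"
proof -
  have "bop (term_alg V) op p q = (\<Sum>s\<in>Poly_Mapping.keys p. \<Sum>t\<in>Poly_Mapping.keys q.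
        Poly_Mapping.single (Op op s t) (Poly_Mapping.lookup p s * Poly_Mapping.lookup q t))"
    by (simp add: term_alg_def module.defs balg.defs)
  also have "\<dots> = bmul (op_tm op) p q"
    by (simp add: pbind_def scl_sum)
  finally show ?thesis .
qed

lemma acoord_term_alg:
  "acoord (term_alg V :: ('k::field, ('o, 'v) tm \<Rightarrow>\<^sub>0 'k, 'o) balg) (tms (carrier V)) id op_tm"
proof (intro acoord.intro acoord_axioms.intro)
  show c: "coord (term_alg V :: ('k, ('o, 'v) tm \<Rightarrow>\<^sub>0 'k, 'o) balg) (tms (carrier V)) id"
    by (rule coord_cong[OF coord_free_space[of "tms (carrier V)"]])
       (auto simp: term_alg_def module.defs tms_def)
  have car: "carrier (term_alg V :: ('k, ('o, 'v) tm \<Rightarrow>\<^sub>0 'k, 'o) balg) = fs (tms (carrier V))"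
    by (simp add: term_alg_def module.defs tms_def)
  fix x y :: "('o, 'v) tm \<Rightarrow>\<^sub>0 'k" and op 
  assume "x \<in> carrier (term_alg V :: ('k, ('o, 'v) tm \<Rightarrow>\<^sub>0 'k, 'o) balg)"
    "y \<in> carrier (term_alg V :: ('k, ('o, 'v) tm \<Rightarrow>\<^sub>0 'k, 'o) balg)"
  then show "bop (term_alg V) op x y \<in> carrier (term_alg V)"
    unfolding car bop_term_alg by (auto intro!: fs_pbind)
  show "id (bop (term_alg V) op x y) = bmul (op_tm op) (id x) (id y)"
    by (simp add: bop_term_alg)
qed

lemma term_alg_simps [simp]:
  "carrier (term_alg V) = fs (tms (carrier V))" "\<zero>\<^bsub>term_alg V\<^esub> = 0" "x \<oplus>\<^bsub>term_alg V\<^esub> y = x + y" 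
  "a \<odot>\<^bsub>term_alg V\<^esub> x = scl a x"
  by (simp_all add: term_alg_def module.defs tms_def free_space_def fs_def scl_def)

locale free_alg_coord = coord V X c for V :: "('k::field, 'v, 'm) module_scheme" and X :: "'x set" and c +
  fixes laws :: "('k, 'o, 'v) laws"
  assumes laws_mem: "laws (term_alg V) \<subseteq> fs (tms (carrier V))"
begin

sublocale tm: acoord "term_alg V :: ('k, ('o, 'v) tm \<Rightarrow>\<^sub>0 'k, 'o) balg" "tms (carrier V)" id op_tm
  by (rule acoord_term_alg)

abbreviation "I \<equiv> free_alg_ideal laws V"

lemma gen_rels_mem: "gen_rels V \<subseteq> fs (tms (carrier V))"
  by (auto simp: gen_rels_def add_mem smult_mem intro!: fs_intros)

lemma ideal_I: "binary_ideal (term_alg V) I"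
  unfolding free_alg_ideal_def using gen_rels_mem laws_mem by (intro tm.binary_ideal_hull) auto

lemma ideal_subset: "gen_rels V \<subseteq> I" "laws (term_alg V) \<subseteq> I"
  unfolding free_alg_ideal_def hull_def by auto

lemma subsp_I: "subsp I"
  using ideal_I unfolding tm.binary_ideal_iff by (simp add: subsp_def)

lemma gen_expand:
  assumes "v \<in> carrier V"
  shows "sg (Gen v) - pbind (c v) (\<lambda>x. sg (Gen (vec (sg x)))) \<in> I"
proof -
  let ?g = "\<lambda>v. sg (Gen v) :: ('o, 'v) tm \<Rightarrow>\<^sub>0 'k"
  have add: "?g (x \<oplus>\<^bsub>V\<^esub> y) - ?g x - ?g y \<in> I" if "x \<in> carrier V" "y \<in> carrier V" for x y
    using that by (intro subsetD[OF ideal_subset(1)]) (auto simp: gen_rels_def)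
  have smult: "?g (a \<odot>\<^bsub>V\<^esub> x) - scl a (?g x) \<in> I" if "x \<in> carrier V" for x a
    using that by (intro subsetD[OF ideal_subset(1)]) (auto simp: gen_rels_def)
  have "?g (vec p) - pbind p (\<lambda>x. ?g (vec (sg x))) \<in> I" if "p \<in> fs X" for p
    using that
  proof (induction rule: fs_induct)
    case 0
    have "vec 0 = 0 \<odot>\<^bsub>V\<^esub> \<zero>\<^bsub>V\<^esub>" by (intro vec_eqI smult_mem zero_mem) (simp add: zero_mem)
    then show ?case using smult[OF zero_mem, of 0] by simp
  next
    case (add p q)
    have "(?g (vec p \<oplus>\<^bsub>V\<^esub> vec q) - ?g (vec p) - ?g (vec q)) + ((?g (vec p) - pbind p (\<lambda>x. ?g (vec (sg x)))) +
       (?g (vec q) - pbind q (\<lambda>x. ?g (vec (sg x))))) \<in> I"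
      by (intro subsp_add subsp_I add \<open>\<And>x y. _ \<Longrightarrow> _ \<Longrightarrow> ?g (x \<oplus>\<^bsub>V\<^esub> y) - _ - _ \<in> _\<close> vec_mem)
    then show ?case using add by (simp add: vec_add pbind_add algebra_simps)
  next
    case (scl x a)
    then show ?case using smult[OF ex_mem, of x a] by (simp add: vec_scl pbind_scl del: scl_single)
  qed
  from this[OF c_mem[OF assms]] show ?thesis using assms by simp
qed

text \<open>A criterion for recognising the free algebra. The ideal lies in the kernel of
  \<open>\<tau>\<close> by minimality of the hull. For the converse, \<open>lift\<close> factors the
  projection \<open>q\<close> to the quotient linearly through \<open>\<tau>\<close>, so whatever
  \<open>\<tau>\<close> kills is killed by \<open>q\<close> and lies in the ideal. The premise
  ranges over all coordinates of the quotient because these come from a mere existence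
  statement.\<close>

lemma model:
  fixes Y :: "'y set" and m' :: "'o \<Rightarrow> 'y \<Rightarrow> 'y \<Rightarrow> 'y \<Rightarrow>\<^sub>0 'k" and g\<^sub>0 :: "'x \<Rightarrow> 'y \<Rightarrow>\<^sub>0 'k"
  defines "\<tau> \<equiv> ev m' (\<lambda>v. pbind (c v) g\<^sub>0)"
  assumes m'_mem: "\<And>op a b. a \<in> Y \<Longrightarrow> b \<in> Y \<Longrightarrow> m' op a b \<in> fs Y"
    and g\<^sub>0_mem: "\<And>x. x \<in> X \<Longrightarrow> g\<^sub>0 x \<in> fs Y"
    and laws: "\<And>l. l \<in> laws (term_alg V) \<Longrightarrow> pbind l \<tau> = 0"
    and surj: "\<And>y. y \<in> Y \<Longrightarrow> \<exists>r\<in>fs (tms (carrier V)). pbind r \<tau> = sg y"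
    and lift: "\<And>(Y' :: ('o, 'v) tm set) q m\<^sub>2. 
      acoord_quot (term_alg V) (tms (carrier V)) id op_tm I Y' q m\<^sub>2 \<Longrightarrow>
      \<exists>\<omega>. \<forall>t\<in>tms (carrier V). pbind (\<tau> t) \<omega> = q t"
  shows "acoord_quot (term_alg V) (tms (carrier V)) id op_tm I Y \<tau> m'"
proof -
  have \<tau>_mem: "\<tau> t \<in> fs Y" if "t \<in> tms (carrier V)" for t
    unfolding \<tau>_def using that g\<^sub>0_mem
    by (intro ev_mem m'_mem) (auto simp: tms_def intro!: fs_pbind[OF c_mem])
  have \<tau>_op: "\<tau> (Op op s t) = bmul (m' op) (\<tau> s) (\<tau> t)" for op s t
    by (simp add: \<tau>_def)
  obtain Y\<^sub>2 :: "('o, 'v) tm set" and q m\<^sub>2 where q: "acoord_quot (term_alg V) (tms (carrier V)) id op_tm I Y\<^sub>2 q m\<^sub>2"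
    using tm.acoord_quot_exists[OF ideal_I] .
  interpret q: acoord_quot "term_alg V :: ('k, ('o, 'v) tm \<Rightarrow>\<^sub>0 'k, 'o) balg" "tms (carrier V)" id op_tm I Y\<^sub>2 q m\<^sub>2 by (rule q)
  obtain \<omega> where \<omega>: "\<And>t. t \<in> tms (carrier V) \<Longrightarrow> pbind (\<tau> t) \<omega> = q t" using lift[OF q] by blast
  let ?K = "{p \<in> fs (tms (carrier V)). pbind p \<tau> = 0}"
  have bm: "pbind (bmul (op_tm op) p r) \<tau> = bmul (m' op) (pbind p \<tau>) (pbind r \<tau>)" for op p r
    by (simp add: pbind_assoc \<tau>_op pbind_swap[of r])
  have bmem: "bmul (op_tm op) p r \<in> fs (tms (carrier V))"
    if "p \<in> fs (tms (carrier V))" "r \<in> fs (tms (carrier V))" for op :: 'o and p r :: "('o, 'v) tm \<Rightarrow>\<^sub>0 'k"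
    using tm.bop_mem[of p r op] that by (simp add: bop_term_alg)
  have "binary_ideal (term_alg V) ?K"
    unfolding tm.binary_ideal_iff
    by (auto simp: pbind_lin bop_term_alg bm bmem intro!: subsp_add[OF subsp_fs] subsp_scl[OF subsp_fs])
  moreover have "gen_rels V \<subseteq> ?K"
  proof -
    have "pbind r \<tau> = 0" if "r \<in> gen_rels V" for r
      using that by (auto simp: gen_rels_def \<tau>_def pbind_lin)
    then show ?thesis using gen_rels_mem by blast
  qed
  moreover have "laws (term_alg V) \<subseteq> ?K" using laws laws_mem by blast
  ultimately have IK: "I \<subseteq> ?K"
    unfolding free_alg_ideal_def by (intro hull_minimal) auto
  show ?thesis
  proof (intro acoord_quot.intro acoord_term_alg coord_quot.intro acoord_quot_axioms.intro coord_quot_axioms.intro)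
    show "coord (term_alg V :: ('k, ('o, 'v) tm \<Rightarrow>\<^sub>0 'k, 'o) balg) (tms (carrier V)) id" by (rule tm.coord_axioms)
    show "\<exists>r\<in>fs (tms (carrier V)). pbind r \<tau> = p" if "p \<in> fs Y" for p
      using that
    proof (induction rule: fs_induct)
      case 0
      then show ?case by (intro bexI[of _ 0]) auto
    next
      case (add p r)
      then show ?case by (metis pbind_add fs_intros(3))
    next
      case (scl x a)
      then show ?case using surj[of x] by (metis pbind_scl fs_intros(4))
    qed
    fix x :: "('o, 'v) tm \<Rightarrow>\<^sub>0 'k" assume x: "x \<in> carrier (term_alg V :: ('k, ('o, 'v) tm \<Rightarrow>\<^sub>0 'k, 'o) balg)"
    show "(pbind (id x) \<tau> = 0) = (x \<in> I)"
    proof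
      assume "pbind (id x) \<tau> = 0"
      moreover have "pbind x q = pbind (pbind x \<tau>) \<omega>"
        unfolding pbind_assoc using x by (intro fs_pbind_cong[of x]) (auto simp: \<omega>)
      ultimately show "x \<in> I" using q.q_ker[OF x] by simp
    qed (use IK in auto)
  next
    show "I \<subseteq> carrier (term_alg V)" using IK by auto
  qed (auto simp: \<tau>_mem \<tau>_op)
qed

end

subsection \<open>Free magmatic algebras\<close>

context coord
begin

definition mag_ev :: "(mag_op, 'a) tm \<Rightarrow> (mag_op, 'x) tm \<Rightarrow>\<^sub>0 'k" where
  "mag_ev = ev op_tm (\<lambda>v. pbind (c v) (\<lambda>x. sg (Gen x)))"

text \<open>With no laws to impose, linearity in the generators alone reduces terms to trees over
  the basis. The factorisation required by \<open>model\<close> evaluates such a tree again, now in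
  the quotient.\<close>

lemma mag_quot:
  "acoord_quot (term_alg V) (tms (carrier V)) id op_tm (free_alg_ideal mag_laws V) (tms X) mag_ev op_tm"
proof -
  interpret free_alg_coord V X c "mag_laws :: ('k, mag_op, 'a) laws"
    by unfold_locales (simp add: mag_laws_def)
  show ?thesis unfolding mag_ev_def
  proof (rule model, goal_cases)
    case (4 t)
    let ?s = "map_gens (\<lambda>x. vec (sg x)) t :: (mag_op, 'a) tm"
    have "?s \<in> tms (carrier V) \<and> ev op_tm (\<lambda>v. pbind (c v) (\<lambda>x. sg (Gen x))) ?s = sg t"
      using 4 by (induction t) (auto simp: ex_mem)
    then show ?case by (intro bexI[of _ "sg ?s"]) auto
  next
    case (5 Y' q m\<^sub>2)
    then interpret q: acoord_quot "term_alg V :: ('k, (mag_op, 'a) tm \<Rightarrow>\<^sub>0 'k, mag_op) balg" "tms (carrier V)" id op_tm I Y' q m\<^sub>2 .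
    define \<omega> where "\<omega> = ev m\<^sub>2 (\<lambda>x. q (Gen (vec (sg x))))"
    have "pbind (ev op_tm (\<lambda>v. pbind (c v) (\<lambda>x. sg (Gen x))) t) \<omega> = q t" if "t \<in> tms (carrier V)" for t
      using that
    proof (induction t)
      case (Gen v)
      have "pbind (sg (Gen v) - pbind (c v) (\<lambda>x. sg (Gen (vec (sg x))))) q = 0"
        using gen_expand[of v] Gen q.q_ker q.N_sub by auto
      then show ?case by (simp add: \<omega>_def pbind_lin pbind_assoc)
    next
      case (Op op s t)
      have \<omega>: "\<omega> (Op op s t) = bmul (m\<^sub>2 op) (\<omega> s) (\<omega> t)" for s t by (simp add: \<omega>_def)
      let ?e = "ev op_tm (\<lambda>v. pbind (c v) (\<lambda>x. sg (Gen x)))"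
      have "pbind (?e (Op op s t)) \<omega> = bmul (m\<^sub>2 op) (pbind (?e s) \<omega>) (pbind (?e t) \<omega>)"
        by (simp add: pbind_assoc \<omega> pbind_swap[of "?e t"])
      then show ?case using Op q.q_mult by simp
    qed
    then show ?case by blast
  qed (auto simp: mag_laws_def)
qed

definition mag_c :: "((mag_op, 'a) tm \<Rightarrow>\<^sub>0 'k) set \<Rightarrow> (mag_op, 'x) tm \<Rightarrow>\<^sub>0 'k" where
  "mag_c C = the_elem ((\<lambda>p. pbind (id p) mag_ev) ` C)"

lemma mag_acoord: "acoord (free_alg mag_laws V) (tms X) mag_c op_tm"
proof -
  interpret mag: acoord_quot "term_alg V" "tms (carrier V)" id op_tm "free_alg_ideal mag_laws V" "tms X" mag_ev op_tm
    by (rule mag_quot)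
  have "mag_c = mag.qc" by (simp add: fun_eq_iff mag_c_def mag.qc_def)
  then show ?thesis unfolding free_alg_def using mag.QA.acoord_axioms by simp
qed

lemma mag_free_term:
  assumes "gens t \<subseteq> carrier V"
  shows "free_term mag_laws V t \<in> carrier (free_alg mag_laws V)" "mag_c (free_term mag_laws V t) = mag_ev t"
proof -
  interpret mag: acoord_quot "term_alg V" "tms (carrier V)" id op_tm "free_alg_ideal mag_laws V" "tms X" mag_ev op_tm
    by (rule mag_quot)
  have "mag_c = mag.qc" by (simp add: fun_eq_iff mag_c_def mag.qc_def)
  then show "free_term mag_laws V t \<in> carrier (free_alg mag_laws V)" "mag_c (free_term mag_laws V t) = mag_ev t"
    using assms mag.coset_mem_alg[of "sg t"] mag.qc_coset[of "sg t"]
    by (auto simp: free_term_def free_alg_def tms_def)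
qed

end

subsection \<open>Free duplicial algebras\<close>

lemma acoord_quot_dup:
  assumes "acoord_quot A X c m I Y q m'" "dup_laws A \<subseteq> I"
  shows "dup_coord Y m'"
proof -
  interpret acoord_quot A X c m I Y q m' by fact
  let ?Q = "\<lambda>x. pbind (c x) q"
  have Q_bop: "?Q (bop A op x y) = bmul (m' op) (?Q x) (?Q y)" if "x \<in> carrier A" "y \<in> carrier A" for op x y
    by (rule q_bop[OF that])
  have Q_minus: "?Q x = ?Q y" if "x \<ominus>\<^bsub>A\<^esub> y \<in> I" "x \<in> carrier A" "y \<in> carrier A" for x y
    using q_ker[of "x \<ominus>\<^bsub>A\<^esub> y"] that by (simp add: pbind_diff)
  have ex: "\<exists>u\<in>carrier A. ?Q u = sg y" if "y \<in> Y" for y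
    using q_surj[of "sg y"] that by (metis c_vec vec_mem fs_single)
  show ?thesis unfolding dup_coord_def
  proof (intro ballI)
    fix x y z assume "x \<in> Y" "y \<in> Y" "z \<in> Y"
    then obtain u v w where u: "u \<in> carrier A" "?Q u = sg x" and v: "v \<in> carrier A" "?Q v = sg y" 
      and w: "w \<in> carrier A" "?Q w = sg z" using ex by meson
    have l: "((u \<prec>\<^bsub>A\<^esub> v) \<prec>\<^bsub>A\<^esub> w) \<ominus>\<^bsub>A\<^esub> (u \<prec>\<^bsub>A\<^esub> (v \<prec>\<^bsub>A\<^esub> w)) \<in> I"
      "((u \<succ>\<^bsub>A\<^esub> v) \<prec>\<^bsub>A\<^esub> w) \<ominus>\<^bsub>A\<^esub> (u \<succ>\<^bsub>A\<^esub> (v \<prec>\<^bsub>A\<^esub> w)) \<in> I"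
      "((u \<succ>\<^bsub>A\<^esub> v) \<succ>\<^bsub>A\<^esub> w) \<ominus>\<^bsub>A\<^esub> (u \<succ>\<^bsub>A\<^esub> (v \<succ>\<^bsub>A\<^esub> w)) \<in> I"
      by (intro subsetD[OF assms(2)]; unfold dup_laws_def; use u(1) v(1) w(1) in blast)+
    note l = l[THEN Q_minus]
    show "pbind (m' Prec x y) (\<lambda>u. m' Prec u z) = pbind (m' Prec y z) (m' Prec x) \<and>
       pbind (m' Succ x y) (\<lambda>u. m' Prec u z) = pbind (m' Prec y z) (m' Succ x) \<and>
       pbind (m' Succ x y) (\<lambda>u. m' Succ u z) = pbind (m' Succ y z) (m' Succ x)"
      using l by (simp add: bop_mem Q_bop u v w del: c_bop)
  qed
qed

abbreviation dup_tm_op :: "dup_op \<Rightarrow> (mag_op, 'x) tm list \<Rightarrow> (mag_op, 'x) tm list \<Rightarrow> (mag_op, 'x) tm list \<Rightarrow>\<^sub>0 'k::field" where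
  "dup_tm_op \<equiv> word_op (op_tm Dot)"

lemma op_tm_mem: "a \<in> tms X \<Longrightarrow> b \<in> tms X \<Longrightarrow> op_tm op a b \<in> fs (tms X)"
  by simp

lemma mag_op_eq: "op = Dot"
  by (cases op)

context coord
begin

definition dup_ev :: "(dup_op, 'a) tm \<Rightarrow> (mag_op, 'x) tm list \<Rightarrow>\<^sub>0 'k" where
  "dup_ev = ev dup_tm_op (\<lambda>v. pbind (c v) (\<lambda>x. sg [Gen x]))"

lemma dup_ev_simps [simp]: "dup_ev (Gen v) = pbind (c v) (\<lambda>x. sg [Gen x])"
    "dup_ev (Op op s t) = bmul (dup_tm_op op) (dup_ev s) (dup_ev t)"
  by (simp_all add: dup_ev_def)

text \<open>The image is closed under both operations. A tree is reached as a letter because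
  \<open>[s] \<prec> [t] - [s] \<succ> [t]\<close> is the one-letter word of the product tree, and
  words are reached from letters by \<open>\<prec>\<close>.\<close>

lemma dup_ev_surj:
  assumes "w \<in> nwords (tms X)"
  shows "\<exists>r\<in>fs (tms (carrier V)). pbind r dup_ev = sg w"
proof -
  define R where "R = (\<lambda>r. pbind r dup_ev) ` fs (tms (carrier V))"
  have add: "p + q \<in> R" "p - q \<in> R" if "p \<in> R" "q \<in> R" for p q
    using that unfolding R_def by (auto simp: pbind_lin[symmetric] intro!: imageI fs_intros)
  have bm: "bmul (dup_tm_op op) p q \<in> R" if pq: "p \<in> R" "q \<in> R" for p q op
  proof -
    obtain r s where rs: "r \<in> fs (tms (carrier V))" "p = pbind r dup_ev" "s \<in> fs (tms (carrier V))" "q = pbind s dup_ev"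
      using pq by (auto simp: R_def)
    have "bmul (dup_tm_op op) p q = pbind (bmul (op_tm op) r s) dup_ev"
      by (simp add: rs pbind_assoc pbind_swap[of s])
    moreover have "bmul (op_tm op) r s \<in> fs (tms (carrier V))" using rs by (auto intro!: fs_pbind)
    ultimately show ?thesis unfolding R_def by blast
  qed
  have letter: "sg [t] \<in> R" if "t \<in> tms X" for t
    using that
  proof (induction t)
    case (Gen x)
    have "pbind (sg (Gen (vec (sg x)))) dup_ev = sg [Gen x]" "sg (Gen (vec (sg x))) \<in> fs (tms (carrier V))" 
      using Gen by (auto simp: ex_mem)
    then show ?case unfolding R_def by (metis imageI)
  next
    case (Op op s t)
    then have "bmul (dup_tm_op Prec) (sg [s]) (sg [t]) - bmul (dup_tm_op Succ) (sg [s]) (sg [t]) \<in> R"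
      by (intro add bm) auto
    then show ?case by (simp add: mag_op_eq[of op])
  qed
  have "sg w \<in> R" using assms
  proof (induction w)
    case (Cons t w)
    show ?case
    proof (cases "w = []")
      case True
      then show ?thesis using Cons.prems by (auto simp: nwords_def intro: letter)
    next
      case False
      then have "bmul (dup_tm_op Prec) (sg [t]) (sg w) \<in> R"
        using Cons by (intro bm letter) (auto simp: nwords_def)
      then show ?thesis by simp
    qed
  qed (simp add: nwords_def)
  then show ?thesis by (auto simp: R_def)
qed

text \<open>Words over trees already satisfy the duplicial laws, so only freeness remains; the
  factorisation required by \<open>model\<close> is \<open>word_eval\<close> into the
  quotient.\<close>

lemma dup_quot:
  "acoord_quot (term_alg V) (tms (carrier V)) id op_tm (free_alg_ideal dup_laws V) (nwords (tms X)) dup_ev dup_tm_op"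
proof -
  interpret tm: acoord "term_alg V :: ('k, (dup_op, 'a) tm \<Rightarrow>\<^sub>0 'k, dup_op) balg" "tms (carrier V)" id op_tm
    by (rule acoord_term_alg)
  have minus: "x \<ominus>\<^bsub>term_alg V\<^esub> y = x - y" if "x \<in> fs (tms (carrier V))" "y \<in> fs (tms (carrier V))"
    for x y :: "(dup_op, 'a) tm \<Rightarrow>\<^sub>0 'k"
    using tm.c_minus[of x y] that by simp
  have mem: "bop (term_alg V) op x y \<in> fs (tms (carrier V))" if "x \<in> fs (tms (carrier V))" "y \<in> fs (tms (carrier V))"
    for op and x y :: "(dup_op, 'a) tm \<Rightarrow>\<^sub>0 'k"
    using tm.bop_mem[of x y op] that by simp
  interpret free_alg_coord V X c "dup_laws :: ('k, dup_op, 'a) laws"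
    by unfold_locales (auto simp: dup_laws_def minus mem intro!: fs_intros)
  have dup: "dup_coord (nwords (tms X)) dup_tm_op" by (rule word_op_dup_coord)
  have bm: "pbind (bmul (op_tm op) p r) dup_ev = bmul (dup_tm_op op) (pbind p dup_ev) (pbind r dup_ev)" for op p r
    by (simp add: pbind_assoc pbind_swap[of r])
  have dup_ev_mem: "dup_ev t \<in> fs (nwords (tms X))" if "t \<in> tms (carrier V)" for t
    unfolding dup_ev_def using that
    by (intro ev_mem word_op_mem op_tm_mem) (auto simp: nwords_def tms_def intro!: fs_pbind[OF c_mem])
  show ?thesis unfolding dup_ev_def
  proof (rule model, goal_cases)
    case (1 op a b)
    then show ?case by (intro word_op_mem op_tm_mem)
  next
    case (2 x)
    then show ?case by (simp add: nwords_def)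
  next
    case (3 l)
    have mem2: "pbind p dup_ev \<in> fs (nwords (tms X))" if "p \<in> fs (tms (carrier V))" for p
      using that by (rule fs_pbind) (rule dup_ev_mem)
    show ?case unfolding dup_ev_def[symmetric] using 3
      by (auto simp: dup_laws_def minus mem; 
          simp add: bop_term_alg pbind_diff bm dup_coord_lift[OF dup mem2 mem2 mem2] del: word_op.simps)
  next
    case (4 w)
    then show ?case unfolding dup_ev_def[symmetric] by (rule dup_ev_surj)
  next
    case (5 Y' q m\<^sub>2)
    then interpret q: acoord_quot "term_alg V :: ('k, (dup_op, 'a) tm \<Rightarrow>\<^sub>0 'k, dup_op) balg" "tms (carrier V)" id op_tm I Y' q m\<^sub>2 .
    \<comment> \<open>Trees are evaluated in the abstract quotient with the product
      \<open>a \<prec> b - a \<succ> b\<close>, which is what makes \<open>f\<close> a magmatic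
      morphism.\<close>
    define f where "f = ev (\<lambda>op :: mag_op. \<lambda>a b. m\<^sub>2 Prec a b - m\<^sub>2 Succ a b) (\<lambda>x. q (Gen (vec (sg x))))"
    interpret w: word_morphism Y' m\<^sub>2 "tms X" "op_tm Dot" f
    proof
      show "dup_coord Y' m\<^sub>2" by (rule acoord_quot_dup[OF 5]) (rule ideal_subset)
      show m2: "m\<^sub>2 op x y \<in> fs Y'" if "x \<in> Y'" "y \<in> Y'" for op x y
        using q.QA.m_mem that by blast
      show "f a \<in> fs Y'" if "a \<in> tms X" for a
        unfolding f_def using that m2 q.q_mem by (intro ev_mem) (auto simp: tms_def ex_mem intro!: fs_intros)
      show "pbind (op_tm Dot a b) f = bmul (m\<^sub>2 Prec) (f a) (f b) - bmul (m\<^sub>2 Succ) (f a) (f b)" for a b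
        by (simp add: f_def pbind_lin)
    qed auto
    have "pbind (dup_ev t) w.E = q t" if "t \<in> tms (carrier V)" for t
      using that
    proof (induction t)
      case (Gen v)
      have "pbind (sg (Gen v) - pbind (c v) (\<lambda>x. sg (Gen (vec (sg x))))) q = 0"
        using gen_expand[of v] Gen q.q_ker q.N_sub by auto
      then show ?case by (simp add: f_def pbind_lin pbind_assoc)
    next
      case (Op op s t)
      have st: "dup_ev s \<in> fs (nwords (tms X))" "dup_ev t \<in> fs (nwords (tms X))" using Op.prems by (auto intro: dup_ev_mem)
      have "pbind (dup_ev (Op op s t)) w.E = pbind (dup_ev s) (\<lambda>x. pbind (dup_ev t) (\<lambda>y. pbind (dup_tm_op op x y) w.E))"
        by (simp add: pbind_assoc)
      also have "\<dots> = pbind (dup_ev s) (\<lambda>x. pbind (dup_ev t) (\<lambda>y. bmul (m\<^sub>2 op) (w.E x) (w.E y)))"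
        by (intro fs_pbind_cong[OF st(1)] fs_pbind_cong[OF st(2)] w.E_word_op)
      also have "\<dots> = bmul (m\<^sub>2 op) (pbind (dup_ev s) w.E) (pbind (dup_ev t) w.E)"
        by (simp add: pbind_assoc pbind_swap[of "dup_ev t"])
      finally show ?case using Op q.q_mult by simp
    qed
    then show ?case unfolding dup_ev_def[symmetric] by blast
  qed
qed

definition dup_c :: "((dup_op, 'a) tm \<Rightarrow>\<^sub>0 'k) set \<Rightarrow> (mag_op, 'x) tm list \<Rightarrow>\<^sub>0 'k" where
  "dup_c C = the_elem ((\<lambda>p. pbind (id p) dup_ev) ` C)"

lemma dup_acoord: "acoord (free_alg dup_laws V) (nwords (tms X)) dup_c dup_tm_op"
proof -
  interpret dup: acoord_quot "term_alg V" "tms (carrier V)" id op_tm "free_alg_ideal dup_laws V" "nwords (tms X)"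
    dup_ev dup_tm_op by (rule dup_quot)
  have "dup_c = dup.qc" by (simp add: fun_eq_iff dup_c_def dup.qc_def)
  then show ?thesis unfolding free_alg_def using dup.QA.acoord_axioms by simp
qed

lemma dup_free_term:
  assumes "gens t \<subseteq> carrier V"
  shows "free_term dup_laws V t \<in> carrier (free_alg dup_laws V)" "dup_c (free_term dup_laws V t) = dup_ev t"
proof -
  interpret dup: acoord_quot "term_alg V" "tms (carrier V)" id op_tm "free_alg_ideal dup_laws V" "nwords (tms X)"
    dup_ev dup_tm_op by (rule dup_quot)
  have "dup_c = dup.qc" by (simp add: fun_eq_iff dup_c_def dup.qc_def)
  then show "free_term dup_laws V t \<in> carrier (free_alg dup_laws V)" "dup_c (free_term dup_laws V t) = dup_ev t"
    using assms dup.coset_mem_alg[of "sg t"] dup.qc_coset[of "sg t"]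
    by (auto simp: free_term_def free_alg_def tms_def)
qed

end

text \<open>If all letters go to primitive elements, evaluation is a morphism of coalgebras. In the
  coproduct of \<open>f t \<prec> E w\<close> the term with the coproduct of \<open>f t\<close>
  vanishes, and the remaining ones are the cut behind \<open>t\<close> and the cuts of
  \<open>w\<close> with \<open>f t\<close> multiplied onto the left part.\<close>

lemma (in word_morphism) E_dec:
  assumes D: "comp_coord X m D" "\<And>a. a \<in> B \<Longrightarrow> pbind (f a) D = 0"
  shows "set w \<subseteq> B \<Longrightarrow> pbind (E w) D = pbind (dec w) (\<lambda>ps. outer (map E ps))"
proof (induction w)
  case (Cons t w)
  show ?case
  proof (cases "w = []")
    case True
    then show ?thesis using Cons.prems D(2) by simp
  next
    case False
    have t: "pbind (f t) D = 0" and tw: "f t \<in> fs X" "E w \<in> fs X"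
      using Cons.prems D(2) by (auto intro!: f_mem E_mem)
    have "pbind (dec w) (\<lambda>ps. outer (map E [t # ps ! 0, ps ! 1])) =
        pbind (dec w) (\<lambda>ps. pbind (outer (map E ps))
          (\<lambda>us. pbind (f t) (\<lambda>a. pbind (m Prec a (us ! 0)) (\<lambda>z. sg [z, us ! 1]))))"
    proof (rule dec_cong)
      fix p q :: "'b list" assume "p \<noteq> []"
      then show "outer (map E [t # [p, q] ! 0, [p, q] ! 1]) = pbind (outer (map E [p, q]))
          (\<lambda>us. pbind (f t) (\<lambda>a. pbind (m Prec a (us ! 0)) (\<lambda>z. sg [z, us ! 1])))"
        by (simp add: E_Cons pbind_assoc pbind_swap[of _ "f t"] pbind_swap[of "m Prec a b" "E q" for a b])
    qed
    also have "\<dots> = pbind (pbind (E w) D)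
          (\<lambda>us. pbind (f t) (\<lambda>a. pbind (m Prec a (us ! 0)) (\<lambda>z. sg [z, us ! 1])))"
      using Cons by (simp add: pbind_assoc[symmetric])
    finally have A: "pbind (dec w) (\<lambda>ps. outer (map E [t # ps ! 0, ps ! 1])) = \<dots>" .
    have "pbind (E (t # w)) D = outer [f t, E w] +
        pbind (dec w) (\<lambda>ps. outer (map E [t # ps ! 0, ps ! 1]))"
      unfolding E_Cons[OF False] comp_coord_lift[OF D(1) tw] t A by simp
    then show ?thesis using False by (simp add: pbind_lin pbind_assoc)
  qed
qed simp

section \<open>The bialgebra structure of free duplicial algebras\<close>

text \<open>Adding a coproduct produces a record of another type; its tensor powers have to be
  identified with those of the underlying space.\<close>

lemma tensor_cong:
  fixes V :: "('k::field, 'a, 'm) module_scheme" and W :: "('k, 'a, 'n) module_scheme"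
  assumes "carrier W = carrier V" "add W = add V" "smult W = smult V"
  shows "tensor_power n W = tensor_power n V" "tensor W = tensor V"
proof -
  have w: "tensor_words n W = tensor_words n V" for n by (simp add: tensor_words_def assms)
  have r: "tensor_rels n W = tensor_rels n V" for n by (simp add: tensor_rels_def w assms)
  have n: "tensor_null n W = tensor_null n V" for n by (simp add: tensor_null_def w r)
  show "tensor_power n W = tensor_power n V" by (simp add: tensor_power_def n w)
  show "tensor W = tensor V" by (simp add: fun_eq_iff tensor_def n w)
qed

lemma Dup_with_comult_simps [simp]:
  "carrier (Dup_with_comult V \<delta>) = carrier (free_alg dup_laws V)"
  "add (Dup_with_comult V \<delta>) = add (free_alg dup_laws V)"
  "zero (Dup_with_comult V \<delta>) = zero (free_alg dup_laws V)"
  "smult (Dup_with_comult V \<delta>) = smult (free_alg dup_laws V)"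
  "bop (Dup_with_comult V \<delta>) = bop (free_alg dup_laws V)"
  "comult (Dup_with_comult V \<delta>) = \<delta>"
  by (simp_all add: Dup_with_comult_def balg.defs bialg.defs)

lemma tensor_Dup_with_comult:
  "tensor_power n (Dup_with_comult V \<delta>) = tensor_power n (free_alg dup_laws V)"
  by (rule tensor_cong) simp_all

context coord
begin

lemma Dup_with_comult_acoord: "acoord (Dup_with_comult V \<delta>) (nwords (tms X)) dup_c dup_tm_op"
proof -
  interpret A: acoord "free_alg dup_laws V" "nwords (tms X)" dup_c dup_tm_op by (rule dup_acoord)
  have "coord (Dup_with_comult V \<delta>) (nwords (tms X)) dup_c"
    by (rule coord_cong[OF A.coord_axioms]) simp_all
  then show ?thesis by (intro acoord.intro acoord_axioms.intro) (simp_all add: A.bop_mem)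
qed

text \<open>Existence: \<open>dec\<close>, carried over through the coordinates, satisfies the
  axioms. Uniqueness: the compatibility relation computes the coproduct of a product from those of
  its factors, so vanishing on the generators determines it on every term;
  \<open>extensional\<close> determines it off the carrier. Together they resolve the
  \<open>THE\<close> in \<open>Dup_comult\<close>.\<close>

lemma Dup_comult_coord:
  "Dup_comult V \<in> extensional (carrier (free_alg dup_laws V))"
  "bicoord (Dup V) (nwords (tms X)) dup_c dup_tm_op dec"
proof -
  let ?A = "free_alg dup_laws V" and ?Y = "nwords (tms X) :: (mag_op, 'x) tm list set"
  interpret A: acoord ?A ?Y dup_c dup_tm_op by (rule dup_acoord)
  interpret T: coord "tensor_power 2 ?A" "words 2 ?Y" "tc dup_c" by (rule A.coord_tensor)
  let ?P = "\<lambda>\<delta>. \<delta> \<in> extensional (carrier ?A) \<and> duplicial_bialgebra (Dup_with_comult V \<delta>) \<and>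
     (\<forall>v\<in>carrier V. \<delta> (free_term dup_laws V (Gen v)) = \<zero>\<^bsub>tensor_power 2 ?A\<^esub>)"
  define \<delta>\<^sub>0 where "\<delta>\<^sub>0 = (\<lambda>x\<in>carrier ?A. T.vec (pbind (dup_c x) dec))"
  have dec2: "pbind (dup_c x) dec \<in> fs (words 2 ?Y)" if "x \<in> carrier ?A" for x
    using A.c_mem[OF that] by (rule fs_pbind) (rule dec_mem)
  have bi: "bicoord (Dup_with_comult V \<delta>) ?Y dup_c dup_tm_op D"
    if "cocoord (Dup_with_comult V \<delta>) ?Y dup_c \<delta> D" for \<delta> D
    using that by (intro bicoord.intro Dup_with_comult_acoord) simp
  have co: "cocoord (Dup_with_comult V \<delta>\<^sub>0) ?Y dup_c \<delta>\<^sub>0 dec"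
    by (intro cocoord.intro cocoord_axioms.intro acoord.axioms(1)[OF Dup_with_comult_acoord])
       (auto simp: tensor_Dup_with_comult \<delta>\<^sub>0_def dec2 T.vec_mem)
  have db: "duplicial_bialgebra (Dup_with_comult V \<delta>\<^sub>0)"
    unfolding bicoord.duplicial_bialgebra_iff[OF bi[OF co]]
    by (intro conjI word_op_dup_coord dec_coass_coord word_comp_coord)
  have z: "pbind (dup_ev (Gen v)) dec = 0" for v
    by (simp add: pbind_assoc)
  have P0: "?P \<delta>\<^sub>0"
  proof (intro conjI ballI db)
    show "\<delta>\<^sub>0 \<in> extensional (carrier ?A)" by (simp add: \<delta>\<^sub>0_def)
    fix v assume v: "v \<in> carrier V"
    have "T.vec 0 = \<zero>\<^bsub>tensor_power 2 ?A\<^esub>" by (rule T.vec_eqI) (simp_all add: T.zero_mem)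
    then show "\<delta>\<^sub>0 (free_term dup_laws V (Gen v)) = \<zero>\<^bsub>tensor_power 2 ?A\<^esub>"
      using v dup_free_term[of "Gen v"] z[of v] by (simp add: \<delta>\<^sub>0_def del: dup_ev_simps)
  qed
  have uniq: "\<delta> = \<delta>\<^sub>0" if P: "?P \<delta>" for \<delta>
  proof (rule extensionalityI)
    show "\<delta> \<in> extensional (carrier ?A)" using P by simp
    show "\<delta>\<^sub>0 \<in> extensional (carrier ?A)" by (simp add: \<delta>\<^sub>0_def)
    fix x assume x: "x \<in> carrier ?A"
    have "linear_map class_ring (Dup_with_comult V \<delta>) (tensor_power 2 (Dup_with_comult V \<delta>)) \<delta>"
      using P duplicial_bialgebra.comult_linear[of "Dup_with_comult V \<delta>"] by simp
    from linear_map_cocoord[OF acoord.axioms(1)[OF Dup_with_comult_acoord] this] obtain D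
      where D: "cocoord (Dup_with_comult V \<delta>) ?Y dup_c \<delta> D" by blast
    interpret B: bicoord "Dup_with_comult V \<delta>" ?Y dup_c dup_tm_op D by (rule bi[OF D])
    have comp: "comp_coord ?Y dup_tm_op D" using P B.duplicial_bialgebra_iff by blast
    have tD: "tc dup_c (\<delta> y) = pbind (dup_c y) D" "\<delta> y \<in> carrier (tensor_power 2 ?A)" if "y \<in> carrier ?A" for y
      using cocoord.tc_\<delta>[OF D, of y] cocoord.\<delta>_mem[OF D, of y] that by (simp_all add: tensor_Dup_with_comult)
    have ev_mem: "dup_ev t \<in> fs ?Y" if "gens t \<subseteq> carrier V" for t
      using A.c_mem[OF dup_free_term(1)[OF that]] dup_free_term(2)[OF that] by simp
    \<comment> \<open>The agreement is proved on terms, where the compatibility relation can be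
      followed; \<open>dup_ev_surj\<close> carries it over to words afterwards.\<close>
    have eq: "pbind (dup_ev t) D = pbind (dup_ev t) dec" if "gens t \<subseteq> carrier V" for t
      using that
    proof (induction t)
      case (Gen v)
      then have "pbind (dup_ev (Gen v)) D = 0"
        using tD(1)[OF dup_free_term(1)[of "Gen v"]] P dup_free_term(2)[of "Gen v"] by simp
      then show ?case unfolding z .
    next
      case (Op op s t)
      then have st: "dup_ev s \<in> fs ?Y" "dup_ev t \<in> fs ?Y" and e: "pbind (dup_ev s) D = pbind (dup_ev s) dec"
        "pbind (dup_ev t) D = pbind (dup_ev t) dec" by (auto intro: ev_mem)
      show ?case
        unfolding dup_ev_simps comp_coord_lift[OF comp st] comp_coord_lift[OF word_comp_coord st] e ..
    qed
    have "pbind (dup_c x) D = pbind (dup_c x) dec"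
    proof (rule fs_pbind_cong[OF A.c_mem[OF x]])
      fix w assume "w \<in> ?Y"
      then obtain r where r: "r \<in> fs (tms (carrier V))" "pbind r dup_ev = sg w" using dup_ev_surj by blast
      have "pbind (sg w) D = pbind r (\<lambda>t. pbind (dup_ev t) D)" using r(2) by (simp add: pbind_assoc[symmetric])
      also have "\<dots> = pbind r (\<lambda>t. pbind (dup_ev t) dec)"
        using r(1) by (rule fs_pbind_cong) (simp add: eq tms_def)
      also have "\<dots> = pbind (sg w) dec" using r(2) by (simp add: pbind_assoc[symmetric])
      finally show "D w = dec w" by simp
    qed
    then show "\<delta> x = \<delta>\<^sub>0 x" using tD[OF x] x by (intro T.eqI) (auto simp: \<delta>\<^sub>0_def T.vec_mem dec2)
  qed
  have "Dup_comult V = \<delta>\<^sub>0" unfolding Dup_comult_def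
    using P0 uniq by (intro the_equality) blast+
  then show "Dup_comult V \<in> extensional (carrier ?A)"
    "bicoord (Dup V) ?Y dup_c dup_tm_op dec"
    using bi[OF co] P0 by (simp_all add: Dup_def)
qed

end

section \<open>The enveloping bialgebra of a magmatic algebra\<close>

lemma pbind_bmul_morphism:
  assumes "\<And>a b. a \<in> X \<Longrightarrow> b \<in> Y \<Longrightarrow> pbind (m a b) f = bmul m' (f a) (f b)" "p \<in> fs X" "q \<in> fs Y"
  shows "pbind (bmul m p q) f = bmul m' (pbind p f) (pbind q f)"
proof -
  have "pbind (bmul m p q) f = pbind p (\<lambda>a. pbind q (\<lambda>b. bmul m' (f a) (f b)))"
    unfolding pbind_assoc by (intro fs_pbind_cong[OF assms(2)] fs_pbind_cong[OF assms(3)] assms(1))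
  then show ?thesis by (simp add: pbind_assoc pbind_swap[of q])
qed

lemma Dup_simps [simp]:
  "carrier (Dup V) = carrier (free_alg dup_laws V)"
  "add (Dup V) = add (free_alg dup_laws V)"
  "zero (Dup V) = zero (free_alg dup_laws V)"
  "smult (Dup V) = smult (free_alg dup_laws V)"
  "bop (Dup V) = bop (free_alg dup_laws V)"
  "comult (Dup V) = Dup_comult V"
  by (simp_all add: Dup_def)

lemma bop_mag_of: "bop (mag_of A) op x y = (x \<prec>\<^bsub>A\<^esub> y) \<ominus>\<^bsub>A\<^esub> (x \<succ>\<^bsub>A\<^esub> y)"
  by (simp add: mag_of_def module.defs balg.defs)

lemma word_op_letters:
  "bmul (word_op \<mu> Prec) (pbind p (\<lambda>x. sg [x])) (pbind q (\<lambda>x. sg [x])) -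
    bmul (word_op \<mu> Succ) (pbind p (\<lambda>x. sg [x])) (pbind q (\<lambda>x. sg [x])) = pbind (bmul \<mu> p q) (\<lambda>x. sg [x])"
  by (simp add: pbind_assoc pbind_lin)

locale mag_coord = acoord L X c mL
  for L :: "('k::field, 'v, mag_op, 'm) balg_scheme" and X :: "'x set" and c mL
begin

abbreviation "\<mu> \<equiv> mL Dot"

definition env_letter :: "(mag_op, 'x) tm \<Rightarrow> 'x list \<Rightarrow>\<^sub>0 'k" where
  "env_letter t = pbind (ev mL sg t) (\<lambda>x. sg [x])"

sublocale env: word_morphism "nwords X" "word_op \<mu>" "tms X" "op_tm Dot" env_letter
proof
  show "dup_coord (nwords X) (word_op \<mu>)" by (rule word_op_dup_coord)
  show "word_op \<mu> op x y \<in> fs (nwords X)" if "x \<in> nwords X" "y \<in> nwords X" for op x y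
    using that m_mem by (intro word_op_mem)
  show "env_letter t \<in> fs (nwords X)" if "t \<in> tms X" for t
    unfolding env_letter_def using that m_mem
    by (intro fs_pbind[of _ X] ev_mem) (auto simp: tms_def nwords_def)
  show "pbind (op_tm Dot a b) env_letter = bmul (word_op \<mu> Prec) (env_letter a) (env_letter b) -
      bmul (word_op \<mu> Succ) (env_letter a) (env_letter b)" for a b
    unfolding env_letter_def word_op_letters by (simp add: env_letter_def pbind_assoc)
qed auto

lemma env_Gen: "w \<noteq> [] \<Longrightarrow> env.E (map Gen w) = sg w"
proof (induction w)
  case (Cons a w)
  have "env_letter (Gen a) = sg [a]" by (simp add: env_letter_def)
  with Cons show ?case by (cases "w = []") (simp_all add: env.E_Cons)
qed simp

text \<open>\<open>env.E\<close> evaluates each tree letter in \<open>L\<close> and concatenates the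
  results. It kills the generators of \<open>U_ideal\<close>, since in words over \<open>L\<close>
  the difference of \<open>\<prec>\<close> and \<open>\<succ>\<close> on letters is the product of
  \<open>L\<close>. As in \<open>model\<close>, equality with the kernel comes from factoring the
  abstract projection \<open>q\<close> through \<open>env.E\<close>, here by evaluating words over
  \<open>X\<close> in the quotient.\<close>

lemma U_quot:
  "acoord_quot (Dup L) (nwords (tms X)) dup_c dup_tm_op (U_ideal L) (nwords X) env.E (word_op \<mu>)"
proof -
  interpret D: bicoord "Dup L" "nwords (tms X)" dup_c dup_tm_op dec by (rule Dup_comult_coord(2))
  let ?g = "\<lambda>x y. free_term dup_laws L (Gen (bop L Dot x y)) \<ominus>\<^bsub>Dup L\<^esub>
        bop (mag_of (Dup L)) Dot (free_term dup_laws L (Gen x)) (free_term dup_laws L (Gen y))"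
  let ?G = "{?g x y | x y. x \<in> carrier L \<and> y \<in> carrier L}"
  have ft: "free_term dup_laws L (Gen x) \<in> carrier (Dup L)"
    "dup_c (free_term dup_laws L (Gen x)) = pbind (c x) (\<lambda>x. sg [Gen x])" if "x \<in> carrier L" for x
    using dup_free_term[of "Gen x"] that by simp_all
  have mg: "bop (mag_of (Dup L)) Dot x y \<in> carrier (Dup L)" if "x \<in> carrier (Dup L)" "y \<in> carrier (Dup L)" for x y
    unfolding bop_mag_of using that by (intro D.minus_closed D.bop_mem)
  have g: "?g x y \<in> carrier (Dup L)" "dup_c (?g x y) = pbind (bmul \<mu> (c x) (c y)) (\<lambda>x. sg [Gen x]) -
      (bmul (dup_tm_op Prec) (pbind (c x) (\<lambda>x. sg [Gen x])) (pbind (c y) (\<lambda>x. sg [Gen x])) -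
       bmul (dup_tm_op Succ) (pbind (c x) (\<lambda>x. sg [Gen x])) (pbind (c y) (\<lambda>x. sg [Gen x])))"
    if "x \<in> carrier L" "y \<in> carrier L" for x y
  proof -
    show "?g x y \<in> carrier (Dup L)" using that by (intro D.minus_closed mg ft bop_mem)
    show "dup_c (?g x y) = pbind (bmul \<mu> (c x) (c y)) (\<lambda>x. sg [Gen x]) -
      (bmul (dup_tm_op Prec) (pbind (c x) (\<lambda>x. sg [Gen x])) (pbind (c y) (\<lambda>x. sg [Gen x])) -
       bmul (dup_tm_op Succ) (pbind (c x) (\<lambda>x. sg [Gen x])) (pbind (c y) (\<lambda>x. sg [Gen x])))"
      using that mg[OF ft(1)[OF that(1)] ft(1)[OF that(2)]]
      by (simp only: D.c_minus ft bop_mem c_bop) (simp only: bop_mag_of D.c_minus D.bop_mem ft D.c_bop)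
  qed
  have idl: "binary_ideal (Dup L) (U_ideal L)"
    unfolding U_ideal_def using g(1) by (intro D.binary_ideal_hull) auto
  have GI: "?G \<subseteq> U_ideal L" unfolding U_ideal_def by (rule hull_subset)
  let ?Q = "\<lambda>x. pbind (dup_c x) env.E"
  have Q_bop: "?Q (bop (Dup L) op x y) = bmul (word_op \<mu> op) (?Q x) (?Q y)"
    if "x \<in> carrier (Dup L)" "y \<in> carrier (Dup L)" for op x y
    unfolding D.c_bop[OF that] by (rule pbind_bmul_morphism[OF env.E_word_op D.c_mem D.c_mem]) (use that in auto)
  have Q0: "?Q (?g x y) = 0" if "x \<in> carrier L" "y \<in> carrier L" for x y
  proof -
    let ?p = "\<lambda>x. pbind (c x) (\<lambda>x. sg [Gen x]) :: (mag_op, 'x) tm list \<Rightarrow>\<^sub>0 'k"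
    have xy: "?p x \<in> fs (nwords (tms X))" "?p y \<in> fs (nwords (tms X))"
      using that by (auto intro!: fs_pbind[OF c_mem] simp: nwords_def)
    have m: "pbind (bmul (dup_tm_op op) (?p x) (?p y)) env.E =
        bmul (word_op \<mu> op) (pbind (?p x) env.E) (pbind (?p y) env.E)" for op
      by (rule pbind_bmul_morphism[OF env.E_word_op xy])
    have l: "pbind (pbind p (\<lambda>x. sg [Gen x])) env.E = pbind p (\<lambda>x. sg [x])" for p
      by (simp add: pbind_assoc env_letter_def)
    show ?thesis
      unfolding g(2)[OF that] pbind_diff m unfolding l word_op_letters by simp
  qed
  obtain Y\<^sub>2 :: "(mag_op, 'x) tm list set" and q m\<^sub>2
    where q: "acoord_quot (Dup L) (nwords (tms X)) dup_c dup_tm_op (U_ideal L) Y\<^sub>2 q m\<^sub>2"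
    using D.acoord_quot_exists[OF idl] .
  interpret q: acoord_quot "Dup L" "nwords (tms X)" dup_c dup_tm_op "U_ideal L" Y\<^sub>2 q m\<^sub>2 by (rule q)
  \<comment> \<open>\<open>acoord_quot_dup\<close> wants the laws inside the ideal. In
    \<open>Dup L\<close> they already hold, so their defects are all zero.\<close>
  have "dup_laws (Dup L) \<subseteq> {\<zero>\<^bsub>Dup L\<^esub>}"
  proof -
    have "duplicial_algebra (Dup L)"
      unfolding duplicial_algebra_iff[OF D.acoord_axioms] by (rule word_op_dup_coord)
    then interpret dd: duplicial_algebra "Dup L" .
    have "x \<ominus>\<^bsub>Dup L\<^esub> x = \<zero>\<^bsub>Dup L\<^esub>" if "x \<in> carrier (Dup L)" for x
      using that by (intro D.eqI D.zero_mem D.minus_closed) (simp_all del: Dup_simps)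
    then show ?thesis unfolding dup_laws_def
      by (intro subsetI; elim UnE CollectE exE conjE;
          simp add: dd.prec_prec dd.succ_prec dd.succ_succ D.bop_mem del: Dup_simps)
  qed
  moreover have "\<zero>\<^bsub>Dup L\<^esub> \<in> U_ideal L" using idl D.binary_ideal_iff by blast
  ultimately have dup2: "dup_coord Y\<^sub>2 m\<^sub>2" by (intro acoord_quot_dup[OF q]) blast
  have m2: "m\<^sub>2 op x y \<in> fs Y\<^sub>2" if "x \<in> Y\<^sub>2" "y \<in> Y\<^sub>2" for op x y
    using q.QA.m_mem that by blast
  define f where "f x = q [Gen x]" for x
  have fx: "pbind p f = pbind (pbind p (\<lambda>x. sg [Gen x])) q" for p by (simp add: f_def[abs_def] pbind_assoc)
  interpret w: word_morphism Y\<^sub>2 m\<^sub>2 X \<mu> f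
  proof
    show "f a \<in> fs Y\<^sub>2" if "a \<in> X" for a unfolding f_def using that by (intro q.q_mem) (simp add: nwords_def)
    fix a b assume ab: "a \<in> X" "b \<in> X"
    note v = ex_mem[OF ab(1)] ex_mem[OF ab(2)]
    have "?g (vec (sg a)) (vec (sg b)) \<in> U_ideal L" using v GI by blast
    then have "pbind (dup_c (?g (vec (sg a)) (vec (sg b)))) q = 0" using q.q_ker g(1)[OF v] by blast
    then have "pbind (\<mu> a b) f = pbind (dup_tm_op Prec [Gen a] [Gen b]) q - pbind (dup_tm_op Succ [Gen a] [Gen b]) q"
      unfolding g(2)[OF v] using ab by (simp add: fx pbind_diff)
    also have "\<dots> = bmul (m\<^sub>2 Prec) (f a) (f b) - bmul (m\<^sub>2 Succ) (f a) (f b)"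
      unfolding f_def using ab by (subst (1 2) q.q_mult) (auto simp: nwords_def)
    finally show "pbind (\<mu> a b) f = bmul (m\<^sub>2 Prec) (f a) (f b) - bmul (m\<^sub>2 Succ) (f a) (f b)" .
  qed (use dup2 m2 m_mem in auto)
  \<comment> \<open>Induction on the tree: a node is the difference of \<open>\<prec>\<close> and
    \<open>\<succ>\<close> of its two subtrees as letters, both in words over \<open>L\<close> and
    under \<open>q\<close>.\<close>
  have letter: "pbind (env_letter t) w.E = q [t]" if "t \<in> tms X" for t
    using that
  proof (induction t)
    case (Gen x)
    then show ?case by (simp add: env_letter_def f_def)
  next
    case (Op op s t)
    then have st: "s \<in> tms X" "t \<in> tms X" and IH: "pbind (env_letter s) w.E = q [s]" "pbind (env_letter t) w.E = q [t]"
      by auto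
    note m = pbind_bmul_morphism[OF w.E_word_op env.f_mem[OF st(1)] env.f_mem[OF st(2)]]
    have "pbind (env_letter (Op op s t)) w.E = bmul (m\<^sub>2 Prec) (q [s]) (q [t]) - bmul (m\<^sub>2 Succ) (q [s]) (q [t])"
      using env.f_mult[OF st] by (simp only: pbind_single scl_simps mag_op_eq[of op] pbind_diff m IH)
    also have "\<dots> = pbind (dup_tm_op Prec [s] [t] - dup_tm_op Succ [s] [t]) q"
      unfolding pbind_diff using st by (subst (1 2) q.q_mult) (auto simp: nwords_def)
    also have "\<dots> = q [Op op s t]" by (simp add: mag_op_eq[of op])
    finally show ?case .
  qed
  have lift: "pbind (env.E u) w.E = q u" if "u \<in> nwords (tms X)" for u
    using that
  proof (induction u)
    case (Cons t u)
    show ?case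
    proof (cases "u = []")
      case True
      then show ?thesis using Cons.prems letter by (simp add: nwords_def)
    next
      case False
      then have tu: "t \<in> tms X" "u \<in> nwords (tms X)" using Cons.prems by (auto simp: nwords_def)
      have "pbind (env.E (t # u)) w.E = bmul (m\<^sub>2 Prec) (pbind (env_letter t) w.E) (pbind (env.E u) w.E)"
        unfolding env.E_Cons[OF False] using tu
        by (intro pbind_bmul_morphism[OF w.E_word_op env.f_mem env.E_mem]) (auto simp: nwords_def)
      also have "\<dots> = bmul (m\<^sub>2 Prec) (q [t]) (q u)" using tu Cons.IH letter by simp
      also have "\<dots> = q (t # u)" using tu by (subst q.q_mult[symmetric]) (auto simp: nwords_def)
      finally show ?thesis .
    qed
  qed (simp add: nwords_def)
  have "binary_ideal (Dup L) {x \<in> carrier (Dup L). ?Q x = 0}"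
    unfolding D.binary_ideal_iff
    by (auto simp: D.zero_mem D.add_mem D.smult_mem D.bop_mem Q_bop pbind_lin simp del: Dup_simps D.c_bop)
  then have UK: "U_ideal L \<subseteq> {x \<in> carrier (Dup L). ?Q x = 0}"
    unfolding U_ideal_def using g(1) Q0 by (intro hull_minimal) blast+
  show ?thesis
  proof (intro acoord_quot.intro D.acoord_axioms coord_quot.intro D.coord_axioms acoord_quot_axioms.intro coord_quot_axioms.intro)
    show "env.E u \<in> fs (nwords X)" if "u \<in> nwords (tms X)" for u
      using that by (intro env.E_mem) (auto simp: nwords_def)
    show "\<exists>r\<in>fs (nwords (tms X)). pbind r env.E = p" if "p \<in> fs (nwords X)" for p
    proof
      show "pbind p (\<lambda>w. sg (map Gen w)) \<in> fs (nwords (tms X))"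
        using that by (rule fs_pbind) (auto simp: nwords_def)
      have "pbind p (\<lambda>w. env.E (map Gen w)) = pbind p sg"
        using that by (rule fs_pbind_cong) (simp add: nwords_def env_Gen)
      then show "pbind (pbind p (\<lambda>w. sg (map Gen w))) env.E = p" by (simp add: pbind_assoc)
    qed
    show "?Q x = 0 \<longleftrightarrow> x \<in> U_ideal L" if x: "x \<in> carrier (Dup L)" for x
    proof
      assume "?Q x = 0"
      moreover have "pbind (dup_c x) q = pbind (?Q x) w.E"
        unfolding pbind_assoc using D.c_mem[OF x] by (rule fs_pbind_cong) (simp add: lift)
      ultimately show "x \<in> U_ideal L" using q.q_ker[OF x] by simp
    qed (use UK in auto)
    show "U_ideal L \<subseteq> carrier (Dup L)" using UK by auto
  qed (rule env.E_word_op)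
qed

definition U_c :: "((dup_op, 'v) tm \<Rightarrow>\<^sub>0 'k) set set \<Rightarrow> 'x list \<Rightarrow>\<^sub>0 'k" where
  "U_c C = the_elem ((\<lambda>x. pbind (dup_c x) env.E) ` C)"

lemma env_dec: "set w \<subseteq> tms X \<Longrightarrow> pbind (dec w) (\<lambda>ps. outer (map env.E ps)) = pbind (env.E w) dec"
  by (rule env.E_dec[OF word_comp_coord, symmetric]) (simp_all add: env_letter_def pbind_assoc)

text \<open>The coproduct of \<open>U L\<close> is read off a coset by \<open>the_elem\<close>. It
  does not depend on the representative because \<open>env.E\<close> is a morphism of coalgebras
  (\<open>env_dec\<close>), trees being sent to combinations of one-letter words, which are
  primitive. The common value is \<open>dec\<close> of the coordinates of the class.\<close>

lemma U_bicoord: "bicoord (U L) (nwords X) U_c (word_op \<mu>) dec"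
proof -
  interpret D: bicoord "Dup L" "nwords (tms X)" dup_c dup_tm_op dec by (rule Dup_comult_coord(2))
  interpret Q: acoord_quot "Dup L" "nwords (tms X)" dup_c dup_tm_op "U_ideal L" "nwords X" env.E "word_op \<mu>"
    by (rule U_quot)
  have qc: "U_c = Q.qc" by (simp add: fun_eq_iff U_c_def Q.qc_def)
  interpret A: acoord "U_alg L" "nwords X" U_c "word_op \<mu>"
    unfolding U_alg_def qc by (rule Q.QA.acoord_axioms)
  have U: "carrier (U L) = carrier (U_alg L)" "add (U L) = add (U_alg L)" "zero (U L) = zero (U_alg L)"
    "smult (U L) = smult (U_alg L)" "bop (U L) = bop (U_alg L)"
    by (simp_all add: U_def balg.defs bialg.defs)
  interpret T: coord "tensor_power 2 (U_alg L)" "words 2 (nwords X)" "tc U_c" by (rule A.coord_tensor)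
  have T: "tensor_power 2 (U L) = tensor_power 2 (U_alg L)" by (rule tensor_cong) (simp_all add: U)
  have cU: "coord (U L) (nwords X) U_c" by (rule coord_cong[OF A.coord_axioms]) (simp_all add: U)
  let ?\<pi> = "\<lambda>y. U_ideal L +>\<^bsub>Dup L\<^esub> y"
  have \<pi>: "?\<pi> y \<in> carrier (U_alg L) \<and> U_c (?\<pi> y) = pbind (dup_c y) env.E" if "y \<in> carrier (Dup L)" for y
    using Q.coset_mem_alg[OF that] Q.qc_coset[OF that] by (simp add: U_alg_def qc)
  have tm: "tensor_map (U_alg L) ?\<pi> (comult (Dup L) x) \<in> carrier (tensor_power 2 (U_alg L))"
    "tc U_c (tensor_map (U_alg L) ?\<pi> (comult (Dup L) x)) = pbind (pbind (dup_c x) env.E) dec"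
    if x: "x \<in> carrier (Dup L)" for x
  proof -
    note t = D.tensor_map_coord[OF A.coord_axioms \<pi> D.\<delta>_mem[OF x]]
    show "tensor_map (U_alg L) ?\<pi> (comult (Dup L) x) \<in> carrier (tensor_power 2 (U_alg L))" by (rule t(1))
    have "pbind (pbind (dup_c x) dec) (\<lambda>ps. outer (map env.E ps)) = pbind (pbind (dup_c x) env.E) dec"
      unfolding pbind_assoc using D.c_mem[OF x]
      by (rule fs_pbind_cong) (simp add: env_dec nwords_def)
    then show "tc U_c (tensor_map (U_alg L) ?\<pi> (comult (Dup L) x)) = pbind (pbind (dup_c x) env.E) dec"
      using t(2) D.tc_\<delta>[OF x] by simp
  qed
  have co: "comult (U L) C \<in> carrier (tensor_power 2 (U_alg L))" "tc U_c (comult (U L) C) = pbind (U_c C) dec"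
    if C: "C \<in> carrier (U_alg L)" for C
  proof -
    obtain x where x: "x \<in> carrier (Dup L)" and Cx: "C = ?\<pi> x"
      using C unfolding U_alg_def Q.carrier_quotient_alg by blast
    have "comult (U L) C = the_elem ((\<lambda>x. tensor_map (U_alg L) ?\<pi> (comult (Dup L) x)) ` C)"
      by (simp add: U_def balg.defs bialg.defs)
    also have "\<dots> = tensor_map (U_alg L) ?\<pi> (comult (Dup L) x)"
    proof (rule the_elem_image_unique)
      show "C \<noteq> {}" using x by (auto simp: Cx Q.coset_eq)
      fix y assume "y \<in> C"
      then have "y \<in> carrier (Dup L)" "pbind (dup_c y) env.E = pbind (dup_c x) env.E"
        using x unfolding Cx Q.coset_eq[OF x] by auto
      then show "tensor_map (U_alg L) ?\<pi> (comult (Dup L) y) = tensor_map (U_alg L) ?\<pi> (comult (Dup L) x)"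
        using x by (intro T.eqI tm(1)) (simp_all only: tm(2))
    qed
    finally show "comult (U L) C \<in> carrier (tensor_power 2 (U_alg L))" "tc U_c (comult (U L) C) = pbind (U_c C) dec"
      using tm[OF x] \<pi>[OF x] by (simp_all add: Cx)
  qed
  show ?thesis
    by (intro bicoord.intro acoord.intro cU acoord_axioms.intro cocoord.intro cocoord_axioms.intro)
       (simp_all add: U T co A.bop_mem)
qed

end

section \<open>The cofree coalgebra in coordinates\<close>

lemma outer_length: "outer ps \<in> fs {xs. length xs = length ps}"
proof -
  have "outer ps \<in> fs (words (length ps) UNIV)" by (rule outer_mem) simp
  then show ?thesis by (simp add: words_def)
qed

lemma dec_sum: "dec w = (\<Sum>i\<in>{1..<length w}. sg [take i w, drop i w])"
proof (induction w)
  case (Cons a w)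
  have "(\<Sum>i\<in>{1..<length (a # w)}. sg [take i (a # w), drop i (a # w)]) =
      (\<Sum>i<length w. sg [a # take i w, drop i w])"
    by (rule sum.reindex_bij_witness[of _ Suc "\<lambda>i. i - 1"]) (auto simp: drop_Cons' take_Cons')
  \<comment> \<open>After the shift, the index 0 is the cut directly behind \<open>a\<close>, which
    exists only for nonempty \<open>w\<close>.\<close>
  also have "\<dots> = (if w = [] then 0 else sg [[a], w]) + (\<Sum>i\<in>{1..<length w}. sg [a # take i w, drop i w])"
    by (cases w) (simp_all only: lessThan_atLeast0 list.size sum.atLeast_Suc_lessThan[of 0], simp_all)
  finally have S: "(\<Sum>i\<in>{1..<length (a # w)}. sg [take i (a # w), drop i (a # w)]) = \<dots>" .
  show ?case unfolding S by (simp add: Cons.IH pbind_sum)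
qed simp

lemma outer_dec: "pbind (outer ps) dec = (\<Sum>i\<in>{1..<length ps}. outer [outer (take i ps), outer (drop i ps)])"
proof -
  have "pbind (outer ps) dec = pbind (outer ps) (\<lambda>xs. \<Sum>i\<in>{1..<length ps}. sg [take i xs, drop i xs])"
    by (rule fs_pbind_cong[OF outer_length]) (simp add: dec_sum)
  also have "\<dots> = (\<Sum>i\<in>{1..<length ps}. pbind (outer ps) (\<lambda>xs. sg [take i xs, drop i xs]))"
    by (rule pbind_sum_right)
  also have "\<dots> = (\<Sum>i\<in>{1..<length ps}. outer [outer (take i ps), outer (drop i ps)])"
  proof (rule sum.cong[OF refl])
    fix i assume i: "i \<in> {1..<length ps}"
    have "pbind (outer ps) (\<lambda>xs. sg [take i xs, drop i xs]) =
        pbind (outer (take i ps)) (\<lambda>xs. pbind (outer (drop i ps)) (\<lambda>ys. sg [take i (xs @ ys), drop i (xs @ ys)]))"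
      using outer_append[of "take i ps" "drop i ps"] by (simp add: pbind_assoc)
    also have "\<dots> = pbind (outer (take i ps)) (\<lambda>xs. pbind (outer (drop i ps)) (\<lambda>ys. sg [xs, ys]))"
      using i by (intro fs_pbind_cong[OF outer_length]) auto
    finally show "pbind (outer ps) (\<lambda>xs. sg [take i xs, drop i xs]) = outer [outer (take i ps), outer (drop i ps)]"
      by (simp add: pbind_assoc)
  qed
  finally show ?thesis .
qed

context coord
begin

definition Asc_c :: "(nat \<Rightarrow> ('a list \<Rightarrow>\<^sub>0 'k) set) \<Rightarrow> 'x list \<Rightarrow>\<^sub>0 'k" where
  "Asc_c f = (\<Sum>n\<in>{n\<in>{1..}. f n \<noteq> \<zero>\<^bsub>tensor_power n V\<^esub>}. tc c (f n))"

lemma Asc_simps: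
  "f \<in> carrier (Asc V) \<longleftrightarrow> f \<in> (\<Pi>\<^sub>E n\<in>{1..}. carrier (tensor_power n V)) \<and> finite {n\<in>{1..}. f n \<noteq> \<zero>\<^bsub>tensor_power n V\<^esub>}"
  "\<zero>\<^bsub>Asc V\<^esub> = (\<lambda>n\<in>{1..}. \<zero>\<^bsub>tensor_power n V\<^esub>)"
  "f \<oplus>\<^bsub>Asc V\<^esub> g = (\<lambda>n\<in>{1..}. f n \<oplus>\<^bsub>tensor_power n V\<^esub> g n)"
  "a \<odot>\<^bsub>Asc V\<^esub> f = (\<lambda>n\<in>{1..}. a \<odot>\<^bsub>tensor_power n V\<^esub> f n)"
  by (simp_all add: Asc_def direct_sum_def)

lemma tc_mem: "t \<in> carrier (tensor_power n V) \<Longrightarrow> tc c t \<in> fs (words n X)"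
  by (rule coord.c_mem[OF coord_tensor])

lemma lookup_tc: "t \<in> carrier (tensor_power n V) \<Longrightarrow> length w \<noteq> n \<Longrightarrow> Poly_Mapping.lookup (tc c t) w = 0"
  using tc_mem[of t n] by (auto simp: fs_def words_def in_keys_iff)

text \<open>Components of different degree are supported on words of different length, so the sum
  \<open>Asc_c\<close> loses nothing: the coefficient at \<open>w\<close> sees the component of
  degree \<open>length w\<close> alone.\<close>

lemma lookup_Asc_c:
  assumes f: "f \<in> carrier (Asc V)"
  shows "Poly_Mapping.lookup (Asc_c f) w = (if w = [] then 0 else Poly_Mapping.lookup (tc c (f (length w))) w)"
proof -
  let ?N = "{n\<in>{1..}. f n \<noteq> \<zero>\<^bsub>tensor_power n V\<^esub>}"
  have fin: "finite ?N" using f by (simp add: Asc_simps)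
  have fn: "f n \<in> carrier (tensor_power n V)" if "n \<ge> 1" for n using f that by (auto simp: Asc_simps)
  have "Poly_Mapping.lookup (Asc_c f) w = (\<Sum>n\<in>?N. Poly_Mapping.lookup (tc c (f n)) w)"
    by (simp add: Asc_c_def lookup_sum)
  also have "\<dots> = (\<Sum>n\<in>?N. if n = length w then Poly_Mapping.lookup (tc c (f n)) w else 0)"
  proof (intro sum.cong refl)
    fix n assume "n \<in> ?N"
    then show "Poly_Mapping.lookup (tc c (f n)) w =
        (if n = length w then Poly_Mapping.lookup (tc c (f n)) w else 0)"
      using lookup_tc[OF fn[of n], of w] by auto
  qed
  also have "\<dots> = (if length w \<in> ?N then Poly_Mapping.lookup (tc c (f (length w))) w else 0)"
    using fin by simp
  also have "\<dots> = (if w = [] then 0 else Poly_Mapping.lookup (tc c (f (length w))) w)"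
    using coord.c_zero[OF coord_tensor] by (cases w) auto
  finally show ?thesis .
qed

lemma coord_Asc: "coord (Asc V) (nwords X) Asc_c"
proof -
  note T = coord_tensor
  have fn: "f n \<in> carrier (tensor_power n V)" if "f \<in> carrier (Asc V)" "n \<ge> 1" for f n
    using that by (auto simp: Asc_simps)
  have fin: "finite {n\<in>{1..}. f n \<noteq> \<zero>\<^bsub>tensor_power n V\<^esub>}" if "f \<in> carrier (Asc V)" for f
    using that by (auto simp: Asc_simps)
  have zero: "\<zero>\<^bsub>Asc V\<^esub> \<in> carrier (Asc V)"
    by (auto simp: Asc_simps coord.zero_mem[OF T])
  have add: "f \<oplus>\<^bsub>Asc V\<^esub> g \<in> carrier (Asc V)" if fg: "f \<in> carrier (Asc V)" "g \<in> carrier (Asc V)" for f g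
  proof -
    have "{n\<in>{1..}. (f \<oplus>\<^bsub>Asc V\<^esub> g) n \<noteq> \<zero>\<^bsub>tensor_power n V\<^esub>} \<subseteq>
        {n\<in>{1..}. f n \<noteq> \<zero>\<^bsub>tensor_power n V\<^esub>} \<union> {n\<in>{1..}. g n \<noteq> \<zero>\<^bsub>tensor_power n V\<^esub>}"
      (is "?A \<subseteq> ?B")
    proof (rule subsetI, rule ccontr)
      fix n assume "n \<in> ?A" "n \<notin> ?B"
      then have n: "n \<ge> 1" "f n = \<zero>\<^bsub>tensor_power n V\<^esub>" "g n = \<zero>\<^bsub>tensor_power n V\<^esub>"
        "(f \<oplus>\<^bsub>Asc V\<^esub> g) n \<noteq> \<zero>\<^bsub>tensor_power n V\<^esub>" by simp_all
      have "\<zero>\<^bsub>tensor_power n V\<^esub> \<oplus>\<^bsub>tensor_power n V\<^esub> \<zero>\<^bsub>tensor_power n V\<^esub> = \<zero>\<^bsub>tensor_power n V\<^esub>"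
        by (intro coord.eqI[OF T[of n]] coord.add_mem[OF T[of n]] coord.zero_mem[OF T[of n]])
           (simp add: coord.c_add[OF T] coord.zero_mem[OF T] coord.c_zero[OF T])
      then show False using n by (simp add: Asc_simps)
    qed
    then have "finite {n\<in>{1..}. (f \<oplus>\<^bsub>Asc V\<^esub> g) n \<noteq> \<zero>\<^bsub>tensor_power n V\<^esub>}"
      by (rule finite_subset) (use fin fg in auto)
    then show ?thesis unfolding Asc_simps(1) using fn fg by (auto simp: Asc_simps(3) coord.add_mem[OF T])
  qed
  have smult: "a \<odot>\<^bsub>Asc V\<^esub> f \<in> carrier (Asc V)" if f: "f \<in> carrier (Asc V)" for a f
  proof -
    have "{n\<in>{1..}. (a \<odot>\<^bsub>Asc V\<^esub> f) n \<noteq> \<zero>\<^bsub>tensor_power n V\<^esub>} \<subseteq> {n\<in>{1..}. f n \<noteq> \<zero>\<^bsub>tensor_power n V\<^esub>}"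
      (is "?A \<subseteq> ?B")
    proof (rule subsetI, rule ccontr)
      fix n assume "n \<in> ?A" "n \<notin> ?B"
      then have n: "n \<ge> 1" "f n = \<zero>\<^bsub>tensor_power n V\<^esub>" "(a \<odot>\<^bsub>Asc V\<^esub> f) n \<noteq> \<zero>\<^bsub>tensor_power n V\<^esub>" by simp_all
      have "a \<odot>\<^bsub>tensor_power n V\<^esub> \<zero>\<^bsub>tensor_power n V\<^esub> = \<zero>\<^bsub>tensor_power n V\<^esub>"
        by (intro coord.eqI[OF T[of n]] coord.smult_mem[OF T[of n]] coord.zero_mem[OF T[of n]])
           (simp add: coord.c_smult[OF T] coord.zero_mem[OF T] coord.c_zero[OF T])
      then show False using n by (simp add: Asc_simps)
    qed
    then have "finite {n\<in>{1..}. (a \<odot>\<^bsub>Asc V\<^esub> f) n \<noteq> \<zero>\<^bsub>tensor_power n V\<^esub>}"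
      by (rule finite_subset) (use fin f in auto)
    then show ?thesis unfolding Asc_simps(1) using fn f by (auto simp: Asc_simps(4) coord.smult_mem[OF T])
  qed
  have mem: "Asc_c f \<in> fs (nwords X)" if f: "f \<in> carrier (Asc V)" for f
    unfolding Asc_c_def
  proof (rule subsp_sum[OF subsp_fs])
    fix n assume "n \<in> {n \<in> {1..}. f n \<noteq> \<zero>\<^bsub>tensor_power n V\<^esub>}"
    then have "tc c (f n) \<in> fs (words n X)" "n \<ge> 1" using fn[OF f] tc_mem by auto
    then show "tc c (f n) \<in> fs (nwords X)" by (auto simp: fs_def words_def nwords_def)
  qed
  have inj: "f = g" if fg: "f \<in> carrier (Asc V)" "g \<in> carrier (Asc V)" "Asc_c f = Asc_c g" for f g
  proof (rule extensionalityI[of _ "{1..}"])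
    fix n :: nat assume n: "n \<in> {1..}"
    have "Poly_Mapping.lookup (tc c (f n)) w = Poly_Mapping.lookup (tc c (g n)) w" for w
    proof (cases "length w = n")
      case True
      then show ?thesis using lookup_Asc_c[OF fg(1), of w] lookup_Asc_c[OF fg(2), of w] fg(3) n by (cases "w = []") auto
    next
      case False
      then show ?thesis using lookup_tc[of "f n" n w] lookup_tc[of "g n" n w] fn fg n by auto
    qed
    then show "f n = g n" using fn fg n by (intro coord.eqI[OF T]) (auto intro: poly_mapping_eqI)
  qed (use fg in \<open>auto simp: Asc_simps PiE_iff\<close>)
  have surj: "\<exists>f\<in>carrier (Asc V). Asc_c f = p" if p: "p \<in> fs (nwords X)" for p
  proof -
    define r where "r n = pbind p (\<lambda>w. if length w = n then sg w else 0)" for n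
    have r: "r n \<in> fs (words n X)" for n
      unfolding r_def using p by (rule fs_pbind) (auto simp: nwords_def words_def)
    have lr: "Poly_Mapping.lookup (r n) w = (if length w = n then Poly_Mapping.lookup p w else 0)" for n w
    proof -
      have "Poly_Mapping.lookup (r n) w = (\<Sum>v\<in>Poly_Mapping.keys p. if v = w then (if length w = n then Poly_Mapping.lookup p w else 0) else 0)"
        unfolding r_def pbind_def lookup_sum by (intro sum.cong) (auto simp: lookup_single when_def)
      then show ?thesis by (auto simp: in_keys_iff)
    qed
    define f where "f = (\<lambda>n\<in>{1..}. coord.vec (tensor_power n V) (tc c) (r n))"
    have fT: "f n \<in> carrier (tensor_power n V)" "tc c (f n) = r n" if "n \<ge> 1" for n
      using that r coord.vec_mem[OF T] coord.c_vec[OF T] by (auto simp: f_def)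
    have "{n\<in>{1..}. f n \<noteq> \<zero>\<^bsub>tensor_power n V\<^esub>} \<subseteq> length ` Poly_Mapping.keys p"
    proof
      fix n assume n: "n \<in> {n\<in>{1..}. f n \<noteq> \<zero>\<^bsub>tensor_power n V\<^esub>}"
      then have "r n \<noteq> 0" using fT[of n] coord.c_eq_0_iff[OF T fT(1)[of n]] by auto
      then obtain w where "Poly_Mapping.lookup (r n) w \<noteq> 0" by (metis poly_mapping_eqI lookup_zero)
      then show "n \<in> length ` Poly_Mapping.keys p" by (auto simp: lr in_keys_iff split: if_splits)
    qed
    then have "finite {n\<in>{1..}. f n \<noteq> \<zero>\<^bsub>tensor_power n V\<^esub>}" by (rule finite_subset) simp
    then have f: "f \<in> carrier (Asc V)" unfolding Asc_simps(1) using fT by (auto simp: PiE_iff f_def)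
    have "Asc_c f = p"
    proof (rule poly_mapping_eqI)
      fix w
      have "w = [] \<Longrightarrow> Poly_Mapping.lookup p w = 0" using p by (auto simp: fs_def nwords_def in_keys_iff)
      then show "Poly_Mapping.lookup (Asc_c f) w = Poly_Mapping.lookup p w"
        using fT(2)[of "length w"] by (cases w) (auto simp: lookup_Asc_c[OF f] lr)
    qed
    then show ?thesis using f by blast
  qed
  show ?thesis
  proof
    show "bij_betw Asc_c (carrier (Asc V)) (fs (nwords X))"
      unfolding bij_betw_def inj_on_def using inj mem surj by (auto simp: image_iff) metis
    show "Asc_c \<zero>\<^bsub>Asc V\<^esub> = 0" by (simp add: Asc_c_def Asc_simps)
    show "Asc_c (x \<oplus>\<^bsub>Asc V\<^esub> y) = Asc_c x + Asc_c y" if "x \<in> carrier (Asc V)" "y \<in> carrier (Asc V)" for x y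
    proof (rule poly_mapping_eqI)
      fix w :: "'x list"
      have "w \<noteq> [] \<Longrightarrow> tc c ((x \<oplus>\<^bsub>Asc V\<^esub> y) (length w)) = tc c (x (length w)) + tc c (y (length w))"
        using that fn by (cases w) (auto simp: Asc_simps(3) coord.c_add[OF T])
      then show "Poly_Mapping.lookup (Asc_c (x \<oplus>\<^bsub>Asc V\<^esub> y)) w = Poly_Mapping.lookup (Asc_c x + Asc_c y) w"
        by (simp add: lookup_Asc_c[OF add[OF that]] lookup_add lookup_Asc_c that)
    qed
    show "Asc_c (a \<odot>\<^bsub>Asc V\<^esub> x) = scl a (Asc_c x)" if "x \<in> carrier (Asc V)" for x a
    proof (rule poly_mapping_eqI)
      fix w :: "'x list"
      have "w \<noteq> [] \<Longrightarrow> tc c ((a \<odot>\<^bsub>Asc V\<^esub> x) (length w)) = scl a (tc c (x (length w)))"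
        using that fn by (cases w) (auto simp: Asc_simps(4) coord.c_smult[OF T])
      then show "Poly_Mapping.lookup (Asc_c (a \<odot>\<^bsub>Asc V\<^esub> x)) w = Poly_Mapping.lookup (scl a (Asc_c x)) w"
        by (simp add: lookup_Asc_c[OF smult[OF that]] lookup_Asc_c that)
    qed
  qed (use zero add smult in auto)
qed

lemma Asc_word_coord:
  assumes "zs \<in> words n (carrier V)" "n \<ge> 1"
  shows "Asc_word V zs \<in> carrier (Asc V)" "Asc_c (Asc_word V zs) = outer (map c zs)"
proof -
  note T = coord_tensor
  have n: "n = length zs" using assms(1) by (simp add: words_def)
  have t: "tensor V zs \<in> carrier (tensor_power n V)" using assms by (intro tensor_mem) (auto simp: words_def)
  have sub: "{k\<in>{1..}. Asc_word V zs k \<noteq> \<zero>\<^bsub>tensor_power k V\<^esub>} \<subseteq> {n}" by (auto simp: Asc_word_def n)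
  show a: "Asc_word V zs \<in> carrier (Asc V)"
    using finite_subset[OF sub] t assms(2) by (auto simp: Asc_simps Asc_word_def n coord.zero_mem[OF T])
  show "Asc_c (Asc_word V zs) = outer (map c zs)"
  proof (rule poly_mapping_eqI)
    fix w
    have o: "length w \<noteq> n \<Longrightarrow> Poly_Mapping.lookup (outer (map c zs)) w = 0"
      using outer_length[of "map c zs"] by (auto simp: fs_def n in_keys_iff)
    have aw: "w \<noteq> [] \<Longrightarrow> Asc_word V zs (length w) =
        (if length w = n then tensor V zs else \<zero>\<^bsub>tensor_power (length w) V\<^esub>)"
      by (cases w) (auto simp: Asc_word_def n)
    show "Poly_Mapping.lookup (Asc_c (Asc_word V zs)) w = Poly_Mapping.lookup (outer (map c zs)) w"
      using o aw assms by (cases "w = []") (simp_all add: lookup_Asc_c[OF a] words_def coord.c_zero[OF T])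
  qed
qed

lemma Asc_cocoord: "cocoord (Asc V) (nwords X) Asc_c (deconcatenation V) dec"
proof -
  interpret A: coord "Asc V" "nwords X" Asc_c by (rule coord_Asc)
  interpret TA: coord "tensor_power 2 (Asc V)" "words 2 (nwords X)" "tc Asc_c" by (rule A.coord_tensor)
  let ?F = "\<lambda>zs. \<Oplus>\<^bsub>tensor_power 2 (Asc V)\<^esub> i \<in> {1..<length zs}.
             tensor (Asc V) [Asc_word V (take i zs), Asc_word V (drop i zs)]"
  have F: "?F zs \<in> carrier (tensor_power 2 (Asc V)) \<and> tc Asc_c (?F zs) = pbind (outer (map c zs)) dec"
    if zs: "zs \<in> words n (carrier V)" for zs n
  proof -
    have w: "take i zs \<in> words i (carrier V)" "drop i zs \<in> words (length zs - i) (carrier V)" "i \<ge> 1" "length zs - i \<ge> 1"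
      if "i \<in> {1..<length zs}" for i
      using that zs by (auto simp: words_def dest: in_set_takeD in_set_dropD)
    have t: "tensor (Asc V) [Asc_word V (take i zs), Asc_word V (drop i zs)] \<in> carrier (tensor_power 2 (Asc V))"
      "tc Asc_c (tensor (Asc V) [Asc_word V (take i zs), Asc_word V (drop i zs)]) =
        outer [outer (map c (take i zs)), outer (map c (drop i zs))]"
      if "i \<in> {1..<length zs}" for i
      using Asc_word_coord[OF w(1,3)[OF that]] Asc_word_coord[OF w(2,4)[OF that]]
      by (auto intro!: A.tensor_mem)
    have "tc Asc_c (?F zs) = (\<Sum>i\<in>{1..<length zs}. outer [outer (map c (take i zs)), outer (map c (drop i zs))])"
      using t by (subst TA.finsum_coord) (auto intro!: sum.cong)
    then show ?thesis using t by (auto intro!: TA.finsum_closed simp: outer_dec take_map drop_map)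
  qed
  show ?thesis
  proof
    fix f assume f: "f \<in> carrier (Asc V)"
    let ?N = "{n\<in>{1..}. f n \<noteq> \<zero>\<^bsub>tensor_power n V\<^esub>}"
    have q: "quot_lift (tensor_power 2 (Asc V)) ?F (f n) \<in> carrier (tensor_power 2 (Asc V))"
      "tc Asc_c (quot_lift (tensor_power 2 (Asc V)) ?F (f n)) = pbind (tc c (f n)) dec" if "n \<in> ?N" for n
    proof -
      have "f n \<in> carrier (tensor_power n V)" using f that by (auto simp: Asc_simps)
      from quot_lift_coord[OF A.coord_tensor this F[of _ n]]
      show "quot_lift (tensor_power 2 (Asc V)) ?F (f n) \<in> carrier (tensor_power 2 (Asc V))"
        "tc Asc_c (quot_lift (tensor_power 2 (Asc V)) ?F (f n)) = pbind (tc c (f n)) dec" by auto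
    qed
    show "deconcatenation V f \<in> carrier (tensor_power 2 (Asc V))"
      unfolding deconcatenation_def using q by (intro TA.finsum_closed) auto
    show "tc Asc_c (deconcatenation V f) = pbind (Asc_c f) dec"
      unfolding deconcatenation_def using q
      by (subst TA.finsum_coord) (auto simp: Asc_c_def pbind_sum)
  qed
qed

end

section \<open>Convolution equations on connected coalgebras\<close>

text \<open>The convolution operator that sends \<open>h\<close> to
  \<open>x \<mapsto> h(x\<^sub>1) \<cdot> R(x\<^sub>2)\<close>, where \<open>R y\<close> acts
  linearly on the target from the right.\<close>

definition conv :: "('x \<Rightarrow> 'x list \<Rightarrow>\<^sub>0 'k::field) \<Rightarrow> ('x \<Rightarrow> 'w \<Rightarrow> 'w \<Rightarrow>\<^sub>0 'k) \<Rightarrow> ('x \<Rightarrow> 'w \<Rightarrow>\<^sub>0 'k) \<Rightarrow> 'x \<Rightarrow> 'w \<Rightarrow>\<^sub>0 'k" where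
  "conv D R h x = pbind (D x) (\<lambda>xs. pbind (h (xs ! 0)) (R (xs ! 1)))"

primrec act :: "('x \<Rightarrow> 'w \<Rightarrow> 'w \<Rightarrow>\<^sub>0 'k::field) \<Rightarrow> ('w \<Rightarrow>\<^sub>0 'k) \<Rightarrow> 'x list \<Rightarrow> 'w \<Rightarrow>\<^sub>0 'k" where
  "act R p [] = p"
| "act R p (y # ys) = act R (pbind p (R y)) ys"

lemma act_pbind: "act R (pbind p g) ys = pbind p (\<lambda>w. act R (g w) ys)"
  by (induction ys arbitrary: g) (simp_all add: pbind_assoc)

locale conn_coord =
  fixes X :: "'x set" and D :: "'x \<Rightarrow> 'x list \<Rightarrow>\<^sub>0 'k::field"
  assumes D_words: "x \<in> X \<Longrightarrow> D x \<in> fs (words 2 X)"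
    and conn: "x \<in> X \<Longrightarrow> \<exists>r. D_iter D r x = 0"
begin

lemma D_iter_mem: "x \<in> X \<Longrightarrow> D_iter D r x \<in> fs (words (Suc r) X)"
proof (induction r)
  case 0
  then show ?case by (simp add: words_def)
next
  case (Suc r)
  have "D_first D xs \<in> fs (words (Suc (Suc r)) X)" if "xs \<in> words (Suc r) X" for xs
    unfolding D_first_def using words_hd_tl[OF that] words_append[of _ 2 X "tl xs" r]
    by (intro fs_pbind[OF D_words]) auto
  then show ?case using Suc by (auto intro: fs_pbind)
qed

lemma D_cong:
  assumes "x \<in> X" "\<And>a b. a \<in> X \<Longrightarrow> b \<in> X \<Longrightarrow> f [a, b] = g [a, b]"
  shows "pbind (D x) f = pbind (D x) g"
  using assms(2) by (intro fs_pbind_cong[OF D_words[OF assms(1)]]) (auto elim!: words_2E)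

lemma conv_cong: "x \<in> X \<Longrightarrow> (\<And>y. y \<in> X \<Longrightarrow> h y = h' y) \<Longrightarrow> conv D R h x = conv D R h' x"
  unfolding conv_def by (rule D_cong) auto

text \<open>\<open>conv\<close> and \<open>D_iter\<close> both recurse in the first tensor factor.
  So the n-th power evaluates \<open>h\<close> at the first factor of the iterated coproduct and
  lets the other n factors act in turn; once the iterated coproduct vanishes, so does the power, for
  every \<open>h\<close>.\<close>

lemma conv_iter:
  assumes "x \<in> X"
  shows "(conv D R ^^ n) h x = pbind (D_iter D n x) (\<lambda>xs. act R (h (hd xs)) (tl xs))"
proof (induction n arbitrary: h)
  case (Suc n)
  have "(conv D R ^^ Suc n) h x = (conv D R ^^ n) (conv D R h) x" by (simp only: funpow_Suc_right comp_def)
  also have "\<dots> = pbind (D_iter D n x) (\<lambda>xs. act R (conv D R h (hd xs)) (tl xs))" by (rule Suc)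
  also have "\<dots> = pbind (D_iter D n x) (\<lambda>xs. pbind (D_first D xs) (\<lambda>xs. act R (h (hd xs)) (tl xs)))"
  proof (rule fs_pbind_cong[OF D_iter_mem[OF assms]])
    fix xs assume "xs \<in> words (Suc n) X"
    then have "hd xs \<in> X" using words_hd_tl by blast
    then show "act R (conv D R h (hd xs)) (tl xs) = pbind (D_first D xs) (\<lambda>xs. act R (h (hd xs)) (tl xs))"
      unfolding conv_def act_pbind D_first_def pbind_assoc by (rule D_cong) (simp add: act_pbind)
  qed
  finally show ?case by (simp add: pbind_assoc)
qed simp

lemma conv_nilpotent:
  assumes "x \<in> X"
  shows "\<exists>N. \<forall>n\<ge>N. \<forall>h. (conv D R ^^ n) h x = 0"
proof -
  obtain r where r: "D_iter D r x = 0" using conn[OF assms] by blast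
  have "D_iter D n x = 0" if "n \<ge> r" for n
    using that by (induction n rule: dec_induct) (simp_all add: r)
  then show ?thesis by (intro exI[of _ r]) (simp add: conv_iter[OF assms])
qed

text \<open>A fixed point of a locally nilpotent operator is zero. To prove that two maps agree, it
  is enough to place their difference in such an equation.\<close>

lemma conv_unique:
  assumes h: "\<And>x. x \<in> X \<Longrightarrow> h x = conv D R h x" and x: "x \<in> X"
  shows "h x = 0"
proof -
  have "\<forall>x\<in>X. (conv D R ^^ n) h x = h x" for n
  proof (induction n)
    case (Suc n)
    have "(conv D R ^^ Suc n) h x = h x" if "x \<in> X" for x
      using Suc conv_cong[OF that, of "(conv D R ^^ n) h" h R] h[OF that] by simp
    then show ?case by blast
  qed simp
  moreover obtain N where "(conv D R ^^ N) h x = 0" using conv_nilpotent[OF x] by blast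
  ultimately show ?thesis using x by metis
qed

text \<open>The solution is the geometric series of the powers of \<open>conv D R\<close> applied to
  \<open>g\<close>, which is finite at every \<open>x\<close>. \<open>S\<close> records in which
  subspace the values lie.\<close>

lemma conv_exists:
  assumes S: "subsp S" and g: "\<And>x. x \<in> X \<Longrightarrow> g x \<in> S" and R: "\<And>w y. w \<in> S \<Longrightarrow> y \<in> X \<Longrightarrow> pbind w (R y) \<in> S"
  obtains h where "\<And>x. x \<in> X \<Longrightarrow> h x \<in> S" "\<And>x. x \<in> X \<Longrightarrow> h x = g x + conv D R h x"
proof -
  have "\<exists>N. \<forall>x\<in>X. \<forall>n\<ge>N x. (conv D R ^^ n) g x = 0" using conv_nilpotent by metis
  then obtain N where N: "\<And>x n. x \<in> X \<Longrightarrow> n \<ge> N x \<Longrightarrow> (conv D R ^^ n) g x = 0" by blast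
  define h where "h x = (\<Sum>n<N x. (conv D R ^^ n) g x)" for x
  have h_ge: "h x = (\<Sum>n<M. (conv D R ^^ n) g x)" if "x \<in> X" "M \<ge> N x" for x M
    unfolding h_def using that by (intro sum.mono_neutral_left) (auto simp: N)
  have it: "(conv D R ^^ n) g x \<in> S" if "x \<in> X" for n x
    using that
  proof (induction n arbitrary: x)
    case (Suc n)
    have "pbind ((conv D R ^^ n) g (xs ! 0)) (R (xs ! 1)) \<in> S" if "xs \<in> words 2 X" for xs
      using that Suc.IH R by (auto elim!: words_2E)
    moreover have "(conv D R ^^ Suc n) g x = pbind (D x) (\<lambda>xs. pbind ((conv D R ^^ n) g (xs ! 0)) (R (xs ! 1)))"
      by (simp add: conv_def[of D R "(conv D R ^^ n) g"])
    ultimately show ?case using fs_keys[OF D_words[OF Suc.prems]] by (simp only:) (rule subsp_pbind[OF S], blast)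
  qed (simp add: g)
  show ?thesis
  proof (rule that[of h])
    fix x assume x: "x \<in> X"
    show "h x \<in> S" unfolding h_def by (intro subsp_sum[OF S] it x)
    \<comment> \<open>One truncation long enough both at \<open>x\<close> and at all left factors
      occurring in \<open>D x\<close>, so that applying \<open>conv\<close> just shifts the partial
      sum.\<close>
    define M where "M = Max (insert (N x) ((\<lambda>xs. N (xs ! 0)) ` Poly_Mapping.keys (D x)))"
    have M: "M \<ge> N x" "\<And>xs. xs \<in> Poly_Mapping.keys (D x) \<Longrightarrow> M \<ge> N (xs ! 0)"
      unfolding M_def by (intro Max_ge; simp)+
    have "conv D R h x = pbind (D x) (\<lambda>xs. pbind (h (xs ! 0)) (R (xs ! 1)))"
      by (rule conv_def)
    also have "\<dots> = pbind (D x) (\<lambda>xs. pbind (\<Sum>n<M. (conv D R ^^ n) g (xs ! 0)) (R (xs ! 1)))"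
    proof (rule pbind_cong[OF refl])
      fix xs assume xs: "xs \<in> Poly_Mapping.keys (D x)"
      then have "xs \<in> words 2 X" by (rule fs_keys[OF D_words[OF x]])
      then have "xs ! 0 \<in> X" by (auto elim!: words_2E)
      then show "pbind (h (xs ! 0)) (R (xs ! 1)) = pbind (\<Sum>n<M. (conv D R ^^ n) g (xs ! 0)) (R (xs ! 1))"
        using h_ge M(2)[OF xs] by simp
    qed
    also have "\<dots> = (\<Sum>n<M. (conv D R ^^ Suc n) g x)"
      by (simp add: pbind_sum pbind_sum_right conv_def[of D R "(conv D R ^^ n) g" for n])
    finally have "g x + conv D R h x = (\<Sum>n<Suc M. (conv D R ^^ n) g x)"
      by (simp only: sum.lessThan_Suc_shift funpow_0)
    also have "\<dots> = h x" using M x by (intro h_ge[symmetric]) auto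
    finally show "h x = g x + conv D R h x" ..
  qed
qed

end

section \<open>The structure of connected duplicial bialgebras\<close>

locale conn_bialg = conn_coord X D for X :: "'x set" and D :: "'x \<Rightarrow> 'x list \<Rightarrow>\<^sub>0 'k::field" +
  fixes m :: "dup_op \<Rightarrow> 'x \<Rightarrow> 'x \<Rightarrow> 'x \<Rightarrow>\<^sub>0 'k"
  assumes m_mem: "\<lbrakk>x \<in> X; y \<in> X\<rbrakk> \<Longrightarrow> m op x y \<in> fs X"
    and dup: "dup_coord X m" and coass: "coass_coord X D" and comp: "comp_coord X m D"
begin

text \<open>Coassociativity in Sweedler form, for a function of \<open>x\<^sub>1\<close>,
  \<open>x\<^sub>2\<close>, \<open>x\<^sub>3\<close>. Allowing two expressions \<open>K\<close> and
  \<open>K'\<close> that agree on \<open>X\<close> lets an identity of the algebra be applied in the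
  same step.\<close>

lemma coass_apply:
  assumes "x \<in> X" "\<And>a b c. a \<in> X \<Longrightarrow> b \<in> X \<Longrightarrow> c \<in> X \<Longrightarrow> K a b c = K' a b c"
  shows "pbind (D x) (\<lambda>xs. pbind (D (xs ! 0)) (\<lambda>ys. K (ys ! 0) (ys ! 1) (xs ! 1))) =
    pbind (D x) (\<lambda>xs. pbind (D (xs ! 1)) (\<lambda>ys. K' (xs ! 0) (ys ! 0) (ys ! 1)))"
proof -
  have "pbind (D x) (\<lambda>xs. pbind (D (xs ! 0)) (\<lambda>ys. K (ys ! 0) (ys ! 1) (xs ! 1))) =
      pbind (D x) (\<lambda>xs. pbind (D (xs ! 0)) (\<lambda>ys. K' (ys ! 0) (ys ! 1) (xs ! 1)))"
    using assms by (intro D_cong) auto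
  also have "\<dots> = pbind (pbind (D x) (D_first D)) (\<lambda>zs. K' (zs ! 0) (zs ! 1) (zs ! 2))"
    unfolding pbind_assoc D_first_def
    by (intro D_cong assms(1)) (auto simp: pbind_assoc intro!: D_cong)
  also have "\<dots> = pbind (pbind (D x) (D_second D)) (\<lambda>zs. K' (zs ! 0) (zs ! 1) (zs ! 2))"
    using coass assms(1) by (simp add: coass_coord_def)
  also have "\<dots> = pbind (D x) (\<lambda>xs. pbind (D (xs ! 1)) (\<lambda>ys. K' (xs ! 0) (ys ! 0) (ys ! 1)))"
    unfolding pbind_assoc D_second_def
    by (intro D_cong assms(1)) (auto simp: pbind_assoc intro!: D_cong)
  finally show ?thesis .
qed

lemma prec_assoc: "x \<in> X \<Longrightarrow> y \<in> X \<Longrightarrow> z \<in> X \<Longrightarrow> pbind (m Prec x y) (\<lambda>u. m Prec u z) = pbind (m Prec y z) (m Prec x)"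
  using dup by (auto simp: dup_coord_def)

text \<open>The sign brings \<open>e(x) = x - e(x\<^sub>1) \<prec> x\<^sub>2\<close> into the
  additive form solved by \<open>conv_exists\<close>.\<close>

definition prec_right :: "'x \<Rightarrow> 'x \<Rightarrow> 'x \<Rightarrow>\<^sub>0 'k" where
  "prec_right y w = - m Prec w y"

text \<open>The projection onto the primitive part along the decomposable elements is the solution of
  \<open>e(x) = x - e(x\<^sub>1) \<prec> x\<^sub>2\<close>.\<close>

lemma projection_exists: "\<exists>e. (\<forall>x\<in>X. e x \<in> fs X) \<and> (\<forall>x\<in>X. e x = sg x + conv D prec_right e x)"
proof -
  obtain e where "\<And>x. x \<in> X \<Longrightarrow> e x \<in> fs X" "\<And>x. x \<in> X \<Longrightarrow> e x = sg x + conv D prec_right e x"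
  proof (rule conv_exists[of "fs X" sg prec_right])
    show "pbind w (prec_right y) \<in> fs X" if "w \<in> fs X" "y \<in> X" for w y
      using that m_mem by (auto simp: prec_right_def intro!: fs_pbind[of _ X] subsp_uminus)
  qed auto
  then show ?thesis by blast
qed

definition e :: "'x \<Rightarrow> 'x \<Rightarrow>\<^sub>0 'k" where
  "e = (SOME e. (\<forall>x\<in>X. e x \<in> fs X) \<and> (\<forall>x\<in>X. e x = sg x + conv D prec_right e x))"

lemma e_mem: "x \<in> X \<Longrightarrow> e x \<in> fs X"
  and e_eq': "x \<in> X \<Longrightarrow> e x = sg x + conv D prec_right e x"
  using someI_ex[OF projection_exists] unfolding e_def[symmetric] by auto

lemma conv_prec_right: "conv D prec_right h x = - pbind (D x) (\<lambda>xs. pbind (h (xs ! 0)) (\<lambda>w. m Prec w (xs ! 1)))"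
  by (simp add: conv_def prec_right_def[abs_def] pbind_uminus_right)

lemma e_eq: "x \<in> X \<Longrightarrow> pbind (D x) (\<lambda>xs. pbind (e (xs ! 0)) (\<lambda>w. m Prec w (xs ! 1))) = sg x - e x"
  using e_eq'[of x] unfolding conv_prec_right by (simp add: algebra_simps)

text \<open>Apply the coproduct to \<open>x - e(x) = e(x\<^sub>1) \<prec> x\<^sub>2\<close>. The
  term \<open>(e(x\<^sub>1) \<prec> x\<^sub>2) \<otimes> x\<^sub>3\<close> collapses, by
  coassociativity and the equation for \<open>e\<close>, to \<open>x\<^sub>1 \<otimes> x\<^sub>2 -
  e(x\<^sub>1) \<otimes> x\<^sub>2\<close>. What survives says that the coproduct of
  \<open>e(x)\<close> solves a homogeneous convolution equation, in which \<open>y\<close> acts by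
  \<open>- (_ \<prec> y)\<close> on the second tensor factor.\<close>

lemma e_prim: "x \<in> X \<Longrightarrow> pbind (e x) D = 0"
proof (rule conv_unique[where R = "\<lambda>y ab. - pbind (m Prec (ab ! 1) y) (\<lambda>z. sg [ab ! 0, z])"])
  fix x assume x: "x \<in> X"
  let ?S = "pbind (D x) (\<lambda>xs. pbind (pbind (e (xs ! 0)) D) (\<lambda>ys. pbind (m Prec (ys ! 1) (xs ! 1)) (\<lambda>z. sg [ys ! 0, z])))"
  let ?F = "pbind (D x) (\<lambda>xs. pbind (e (xs ! 0)) (\<lambda>z. sg [z, xs ! 1]))"
  have "pbind (sg x - e x) D = pbind (D x) (\<lambda>xs. pbind (bmul (m Prec) (e (xs ! 0)) (sg (xs ! 1))) D)"
    unfolding e_eq[OF x, symmetric] by (simp add: pbind_assoc)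
  also have "\<dots> = pbind (D x) (\<lambda>xs. outer [e (xs ! 0), sg (xs ! 1)] +
      pbind (pbind (e (xs ! 0)) D) (\<lambda>ys. pbind (m Prec (ys ! 1) (xs ! 1)) (\<lambda>z. sg [ys ! 0, z])) +
      pbind (D (xs ! 1)) (\<lambda>ys. pbind (e (xs ! 0)) (\<lambda>a. pbind (m Prec a (ys ! 0)) (\<lambda>z. sg [z, ys ! 1]))))"
    using x by (rule D_cong) (subst comp_coord_lift[OF comp e_mem], auto)
  also have "\<dots> = ?F + ?S + pbind (D x) (\<lambda>xs. pbind (D (xs ! 1)) (\<lambda>ys. pbind (e (xs ! 0)) (\<lambda>a. pbind (m Prec a (ys ! 0)) (\<lambda>z. sg [z, ys ! 1]))))"
    by (simp add: pbind_add_right)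
  also have "pbind (D x) (\<lambda>xs. pbind (D (xs ! 1)) (\<lambda>ys. pbind (e (xs ! 0)) (\<lambda>a. pbind (m Prec a (ys ! 0)) (\<lambda>z. sg [z, ys ! 1])))) =
     pbind (D x) (\<lambda>xs. pbind (D (xs ! 0)) (\<lambda>ys. pbind (e (ys ! 0)) (\<lambda>a. pbind (m Prec a (ys ! 1)) (\<lambda>z. sg [z, xs ! 1]))))"
    by (rule coass_apply[OF x, symmetric]) (rule refl)
  also have "\<dots> = pbind (D x) (\<lambda>xs. pbind (pbind (D (xs ! 0)) (\<lambda>ys. pbind (e (ys ! 0)) (\<lambda>a. m Prec a (ys ! 1)))) (\<lambda>z. sg [z, xs ! 1]))"
    by (simp add: pbind_assoc)
  also have "\<dots> = pbind (D x) (\<lambda>xs. sg xs - pbind (e (xs ! 0)) (\<lambda>z. sg [z, xs ! 1]))"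
    using x by (rule D_cong) (simp add: e_eq[unfolded One_nat_def] pbind_diff)
  also have "\<dots> = D x - ?F" by (simp add: pbind_diff_right)
  finally have "pbind (e x) D = - ?S" by (simp add: pbind_diff eq_neg_iff_add_eq_0 algebra_simps)
  then show "pbind (e x) D = conv D (\<lambda>y ab. - pbind (m Prec (ab ! 1) y) (\<lambda>z. sg [ab ! 0, z])) (\<lambda>x. pbind (e x) D) x"
    by (simp add: conv_def pbind_uminus_right)
qed

lemma e_lift:
  assumes "p \<in> fs X"
  shows "pbind p e = p - pbind (pbind p D) (\<lambda>xs. pbind (e (xs ! 0)) (\<lambda>w. m Prec w (xs ! 1)))"
proof -
  have "pbind p e = pbind p (\<lambda>x. sg x - pbind (D x) (\<lambda>xs. pbind (e (xs ! 0)) (\<lambda>w. m Prec w (xs ! 1))))"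
    using assms by (rule fs_pbind_cong) (simp add: e_eq[unfolded One_nat_def])
  then show ?thesis by (simp add: pbind_diff_right pbind_assoc)
qed

lemma e_id: "p \<in> fs X \<Longrightarrow> pbind p D = 0 \<Longrightarrow> pbind p e = p"
  by (simp add: e_lift)

text \<open>For fixed \<open>x\<close> the map \<open>y \<mapsto> e(x \<prec> y)\<close> solves the
  homogeneous equation belonging to \<open>e\<close>. In the coproduct of \<open>x \<prec> y\<close>
  the first term contributes \<open>e(x) \<prec> y\<close> and, by associativity, the second one
  \<open>(x - e(x)) \<prec> y\<close>; together they cancel \<open>x \<prec> y\<close> and leave
  \<open>- e(x \<prec> y\<^sub>1) \<prec> y\<^sub>2\<close>.\<close>

lemma e_prec:
  assumes x: "x \<in> X"
  shows "y \<in> X \<Longrightarrow> pbind (m Prec x y) e = 0"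
proof (rule conv_unique[where R = prec_right])
  fix y assume y: "y \<in> X"
  let ?K = "\<lambda>xs. pbind (e (xs ! 0)) (\<lambda>w. m Prec w (xs ! 1))"
  have c: "pbind (m Prec x y) D = sg [x, y] + pbind (D x) (\<lambda>xs. pbind (m Prec (xs ! 1) y) (\<lambda>z. sg [xs ! 0, z]))
     + pbind (D y) (\<lambda>xs. pbind (m Prec x (xs ! 0)) (\<lambda>z. sg [z, xs ! 1]))"
    using comp x y unfolding comp_coord_def by blast
  have 2: "pbind (D x) (\<lambda>xs. pbind (m Prec (xs ! 1) y) (\<lambda>z. pbind (e (xs ! 0)) (\<lambda>w. m Prec w z))) =
      m Prec x y - pbind (e x) (\<lambda>u. m Prec u y)"
  proof -
    have "pbind (D x) (\<lambda>xs. pbind (m Prec (xs ! 1) y) (\<lambda>z. pbind (e (xs ! 0)) (\<lambda>w. m Prec w z))) =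
      pbind (D x) (\<lambda>xs. pbind (e (xs ! 0)) (\<lambda>w. pbind (m Prec w (xs ! 1)) (\<lambda>u. m Prec u y)))"
    proof (rule D_cong[OF x])
      fix a b assume ab: "a \<in> X" "b \<in> X"
      have "pbind (m Prec b y) (\<lambda>z. pbind (e a) (\<lambda>w. m Prec w z)) = pbind (e a) (\<lambda>w. pbind (m Prec b y) (m Prec w))"
        by (rule pbind_swap)
      also have "\<dots> = pbind (e a) (\<lambda>w. pbind (m Prec w b) (\<lambda>u. m Prec u y))"
        using e_mem[OF ab(1)] by (rule fs_pbind_cong) (simp add: prec_assoc ab y)
      finally show "pbind (m Prec ([a, b] ! 1) y) (\<lambda>z. pbind (e ([a, b] ! 0)) (\<lambda>w. m Prec w z)) =
         pbind (e ([a, b] ! 0)) (\<lambda>w. pbind (m Prec w ([a, b] ! 1)) (\<lambda>u. m Prec u y))" by simp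
    qed
    also have "\<dots> = pbind (sg x - e x) (\<lambda>u. m Prec u y)"
      unfolding e_eq[OF x, symmetric] by (simp add: pbind_assoc)
    finally show ?thesis by (simp add: pbind_diff)
  qed
  show "pbind (m Prec x y) e = conv D prec_right (\<lambda>y. pbind (m Prec x y) e) y"
    unfolding e_lift[OF m_mem[OF x y]] c conv_prec_right pbind_add
    by (simp add: pbind_assoc 2[unfolded One_nat_def])
qed

lemma e_prec_lift:
  assumes "p \<in> fs X" "q \<in> fs X"
  shows "pbind (bmul (m Prec) p q) e = 0"
proof -
  have "pbind (bmul (m Prec) p q) e = pbind p (\<lambda>x. pbind q (\<lambda>y. 0))"
    unfolding pbind_assoc
    by (intro fs_pbind_cong[OF assms(1)] fs_pbind_cong[OF assms(2)] e_prec)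
  then show ?thesis by simp
qed

text \<open>The mirror image \<open>x = e(x) + x\<^sub>1 \<prec> e(x\<^sub>2)\<close> of the
  defining equation, needed because \<open>\<Theta>\<close> splits off the last letter.
  Associativity and coassociativity show that \<open>x - x\<^sub>1 \<prec> e(x\<^sub>2)\<close>
  satisfies the equation of \<open>e\<close>, so it equals \<open>e(x)\<close>.\<close>

lemma e_eq_right: "x \<in> X \<Longrightarrow> sg x = e x + pbind (D x) (\<lambda>xs. pbind (e (xs ! 1)) (m Prec (xs ! 0)))"
proof -
  define e' where "e' x = sg x - pbind (D x) (\<lambda>xs. pbind (e (xs ! 1)) (m Prec (xs ! 0)))" for x
  have e': "pbind (D x) (\<lambda>xs. pbind (e' (xs ! 0)) (\<lambda>w. m Prec w (xs ! 1))) = sg x - e' x" if x: "x \<in> X" for x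
  proof -
    have "pbind (D x) (\<lambda>xs. pbind (e' (xs ! 0)) (\<lambda>w. m Prec w (xs ! 1))) = pbind (D x) (\<lambda>xs. m Prec (xs ! 0) (xs ! 1)) -
       pbind (D x) (\<lambda>xs. pbind (D (xs ! 0)) (\<lambda>ys. pbind (e (ys ! 1)) (\<lambda>a. pbind (m Prec (ys ! 0) a) (\<lambda>w. m Prec w (xs ! 1)))))"
      by (simp add: e'_def pbind_lin pbind_assoc)
    also have "pbind (D x) (\<lambda>xs. pbind (D (xs ! 0)) (\<lambda>ys. pbind (e (ys ! 1)) (\<lambda>a. pbind (m Prec (ys ! 0) a) (\<lambda>w. m Prec w (xs ! 1))))) =
       pbind (D x) (\<lambda>xs. pbind (D (xs ! 1)) (\<lambda>ys. pbind (e (ys ! 0)) (\<lambda>a. pbind (m Prec a (ys ! 1)) (m Prec (xs ! 0)))))"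
      by (rule coass_apply[OF x]) (rule fs_pbind_cong[OF e_mem], auto intro: prec_assoc)
    also have "\<dots> = pbind (D x) (\<lambda>xs. pbind (sg (xs ! 1) - e (xs ! 1)) (m Prec (xs ! 0)))"
      using x by (rule D_cong) (subst e_eq[symmetric], simp_all add: pbind_assoc)
    finally show ?thesis by (simp add: e'_def pbind_lin)
  qed
  have "e' x - e x = 0" if "x \<in> X" for x
  proof (rule conv_unique[where R = prec_right, OF _ that])
    fix x assume x: "x \<in> X"
    show "e' x - e x = conv D prec_right (\<lambda>x. e' x - e x) x"
      unfolding conv_prec_right pbind_diff pbind_diff_right e'[OF x] e_eq[OF x] by simp
  qed
  then show "x \<in> X \<Longrightarrow> ?thesis" by (simp add: e'_def algebra_simps)
qed

end

text \<open>\<open>f\<close> embeds the primitive part, with basis \<open>B\<close>, and \<open>\<pi>\<close> is the projection \<open>e\<close> in the coordinates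
  of the primitive part.\<close>

locale conn_prim = conn_bialg X D m + word_morphism X m B \<mu> f
  for X :: "'x set" and D :: "'x \<Rightarrow> 'x list \<Rightarrow>\<^sub>0 'k::field" and m and B :: "'b set" and \<mu> f +
  fixes \<pi> :: "'x \<Rightarrow> 'b \<Rightarrow>\<^sub>0 'k"
  assumes f_prim: "b \<in> B \<Longrightarrow> pbind (f b) D = 0"
    and \<pi>_mem: "x \<in> X \<Longrightarrow> \<pi> x \<in> fs B"
    and \<pi>_f: "x \<in> X \<Longrightarrow> pbind (\<pi> x) f = e x"
    and f_inj: "p \<in> fs B \<Longrightarrow> pbind p f = 0 \<Longrightarrow> p = 0"
begin

lemma \<pi>_eqI: "p \<in> fs X \<Longrightarrow> q \<in> fs B \<Longrightarrow> pbind p e = pbind q f \<Longrightarrow> pbind p \<pi> = q"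
proof -
  assume p: "p \<in> fs X" and q: "q \<in> fs B" and pq: "pbind p e = pbind q f"
  have "pbind (pbind p \<pi>) f = pbind p e"
    unfolding pbind_assoc using p by (rule fs_pbind_cong) (rule \<pi>_f)
  then have "pbind (pbind p \<pi> - q) f = 0" using pq by (simp add: pbind_diff)
  moreover have "pbind p \<pi> \<in> fs B" using p by (rule fs_pbind) (rule \<pi>_mem)
  ultimately have "pbind p \<pi> - q = 0" using q by (intro f_inj subsp_diff[OF subsp_fs])
  then show ?thesis by simp
qed

text \<open>The right action by which \<open>y\<close> appends its primitive component as a last
  letter.\<close>

definition snoc_right :: "'x \<Rightarrow> 'b list \<Rightarrow> 'b list \<Rightarrow>\<^sub>0 'k" where
  "snoc_right y w = pbind (\<pi> y) (\<lambda>b. sg (w @ [b]))"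

lemma coordinates_exist:
  "\<exists>\<Theta>. (\<forall>x\<in>X. \<Theta> x \<in> fs (nwords B)) \<and> (\<forall>x\<in>X. \<Theta> x = pbind (\<pi> x) (\<lambda>b. sg [b]) + conv D snoc_right \<Theta> x)"
proof -
  obtain h where "\<And>x. x \<in> X \<Longrightarrow> h x \<in> fs (nwords B)" 
    "\<And>x. x \<in> X \<Longrightarrow> h x = pbind (\<pi> x) (\<lambda>b. sg [b]) + conv D snoc_right h x"
  proof (rule conv_exists[of "fs (nwords B)" "\<lambda>x. pbind (\<pi> x) (\<lambda>b. sg [b])" snoc_right])
    show "pbind w (snoc_right y) \<in> fs (nwords B)" if "w \<in> fs (nwords B)" "y \<in> X" for w y
      using that by (auto simp: snoc_right_def nwords_def intro!: fs_pbind[of w "nwords B"] fs_pbind[OF \<pi>_mem])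
    show "pbind (\<pi> x) (\<lambda>b. sg [b]) \<in> fs (nwords B)" if "x \<in> X" for x
      using \<pi>_mem[OF that] by (rule fs_pbind) (simp add: nwords_def)
  qed auto
  then show ?thesis by blast
qed

text \<open>Unrolling the recursion gives the sum over n of the words
  \<open>\<pi>(x\<^sub>1) ... \<pi>(x\<^sub>n)\<close> along the iterated coproducts, which is the
  canonical map to the cofree coalgebra induced by \<open>\<pi>\<close>.\<close>

definition \<Theta> :: "'x \<Rightarrow> 'b list \<Rightarrow>\<^sub>0 'k" where
  "\<Theta> = (SOME \<Theta>. (\<forall>x\<in>X. \<Theta> x \<in> fs (nwords B)) \<and>
    (\<forall>x\<in>X. \<Theta> x = pbind (\<pi> x) (\<lambda>b. sg [b]) + conv D snoc_right \<Theta> x))"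

lemma \<Theta>_mem: "x \<in> X \<Longrightarrow> \<Theta> x \<in> fs (nwords B)"
  and \<Theta>_eq: "x \<in> X \<Longrightarrow> \<Theta> x = pbind (\<pi> x) (\<lambda>b. sg [b]) + conv D snoc_right \<Theta> x"
  using someI_ex[OF coordinates_exist] unfolding \<Theta>_def[symmetric] by auto

lemma \<Theta>_lift: "p \<in> fs X \<Longrightarrow> pbind p \<Theta> = pbind (pbind p \<pi>) (\<lambda>b. sg [b]) +
    pbind (pbind p D) (\<lambda>xs. pbind (\<Theta> (xs ! 0)) (\<lambda>w. pbind (\<pi> (xs ! 1)) (\<lambda>b. sg (w @ [b]))))"
proof -
  assume p: "p \<in> fs X"
  have "pbind p \<Theta> = pbind p (\<lambda>x. pbind (\<pi> x) (\<lambda>b. sg [b]) + conv D snoc_right \<Theta> x)"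
    using p by (rule fs_pbind_cong) (rule \<Theta>_eq)
  then show ?thesis by (simp add: pbind_add_right pbind_assoc conv_def snoc_right_def[abs_def])
qed

lemma E_snoc: "u \<in> nwords B \<Longrightarrow> b \<in> B \<Longrightarrow> E (u @ [b]) = bmul (m Prec) (E u) (f b)"
  using E_append[of u "[b]"] by (simp add: nwords_def)

text \<open>Evaluating the recursion of \<open>\<Theta>\<close> gives the convolution equation that
  \<open>e_eq_right\<close> states for the identity, so the difference of the two maps is zero by
  \<open>conv_unique\<close>.\<close>

lemma E_\<Theta>: "x \<in> X \<Longrightarrow> pbind (\<Theta> x) E = sg x"
proof -
  let ?R = "\<lambda>y w. pbind (e y) (m Prec w)"
  have h: "pbind (\<Theta> x) E = e x + pbind (D x) (\<lambda>xs. pbind (pbind (\<Theta> (xs ! 0)) E) (?R (xs ! 1)))"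
    if x: "x \<in> X" for x
  proof -
    have "pbind (\<Theta> x) E = pbind (\<pi> x) f +
        pbind (D x) (\<lambda>xs. pbind (\<Theta> (xs ! 0)) (\<lambda>w. pbind (\<pi> (xs ! 1)) (\<lambda>b. E (w @ [b]))))"
      unfolding \<Theta>_eq[OF x] conv_def snoc_right_def[abs_def] by (simp add: pbind_lin pbind_assoc)
    also have "pbind (D x) (\<lambda>xs. pbind (\<Theta> (xs ! 0)) (\<lambda>w. pbind (\<pi> (xs ! 1)) (\<lambda>b. E (w @ [b])))) =
        pbind (D x) (\<lambda>xs. pbind (pbind (\<Theta> (xs ! 0)) E) (?R (xs ! 1)))"
    proof (rule D_cong[OF x])
      fix a b assume ab: "a \<in> X" "b \<in> X"
      have "pbind (\<Theta> a) (\<lambda>w. pbind (\<pi> b) (\<lambda>b. E (w @ [b]))) =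
          pbind (\<Theta> a) (\<lambda>w. pbind (\<pi> b) (\<lambda>b. bmul (m Prec) (E w) (f b)))"
        by (intro fs_pbind_cong[OF \<Theta>_mem[OF ab(1)]] fs_pbind_cong[OF \<pi>_mem[OF ab(2)]] E_snoc)
      also have "\<dots> = pbind (\<Theta> a) (\<lambda>w. pbind (E w) (\<lambda>u. pbind (pbind (\<pi> b) f) (m Prec u)))"
        by (simp add: pbind_assoc pbind_swap[of "\<pi> b"])
      also have "\<dots> = pbind (pbind (\<Theta> a) E) (?R b)" by (simp add: \<pi>_f ab pbind_assoc)
      finally show "pbind (\<Theta> ([a, b] ! 0)) (\<lambda>w. pbind (\<pi> ([a, b] ! 1)) (\<lambda>b. E (w @ [b]))) =
        pbind (pbind (\<Theta> ([a, b] ! 0)) E) (?R ([a, b] ! 1))" by simp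
    qed
    finally show ?thesis by (simp add: \<pi>_f x)
  qed
  have "pbind (\<Theta> x) E - sg x = 0" if "x \<in> X" for x
  proof (rule conv_unique[where R = ?R, OF _ that])
    fix x assume x: "x \<in> X"
    have s: "sg x = e x + pbind (D x) (\<lambda>xs. pbind (sg (xs ! 0)) (?R (xs ! 1)))"
      using e_eq_right[OF x] by simp
    show "pbind (\<Theta> x) E - sg x = conv D ?R (\<lambda>x. pbind (\<Theta> x) E - sg x) x"
      unfolding conv_def pbind_diff pbind_diff_right by (subst h[OF x], subst s) (simp only: add_diff_add diff_self add_0)
  qed
  then show "x \<in> X \<Longrightarrow> ?thesis" by simp
qed

text \<open>Induction from the right, since \<open>\<Theta>\<close> splits off the last letter. In
  the coproduct of \<open>E u \<prec> f b\<close> the third term vanishes as \<open>f b\<close> is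
  primitive, and the second has a product in its right factor, which \<open>\<pi>\<close>
  annihilates. Only \<open>E u \<otimes> f b\<close> remains and yields \<open>u @ [b]\<close>; the
  linear term of \<open>\<Theta>\<close> drops out because \<open>\<pi>\<close> also annihilates the
  whole product.\<close>

lemma \<Theta>_E: "w \<in> nwords B \<Longrightarrow> pbind (E w) \<Theta> = sg w"
proof (induction w rule: rev_induct)
  case (snoc b u)
  then have b: "b \<in> B" by (simp add: nwords_def)
  have \<pi>b: "pbind (f b) \<pi> = sg b"
    using e_id[OF f_mem[OF b] f_prim[OF b]] b by (intro \<pi>_eqI f_mem) simp_all
  show ?case
  proof (cases "u = []")
    case True
    then show ?thesis using \<Theta>_lift[OF f_mem[OF b]] by (simp add: \<pi>b f_prim[OF b])
  next
    case False
    then have u: "u \<in> nwords B" using snoc.prems by (simp add: nwords_def)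
    let ?p = "E u" and ?q = "f b"
    let ?K = "\<lambda>xs. pbind (\<Theta> (xs ! 0)) (\<lambda>w. pbind (\<pi> (xs ! 1)) (\<lambda>b. sg (w @ [b])))"
    have p: "?p \<in> fs X" using u by (intro E_mem) (simp add: nwords_def)
    have \<pi>0: "pbind p \<pi> = 0" if "p \<in> fs X" "pbind p e = 0" for p
      using that by (intro \<pi>_eqI) auto
    have 1: "pbind (bmul (m Prec) ?p ?q) \<pi> = 0"
      using b by (intro \<pi>0 e_prec_lift bmul_mem p f_mem)
    have 2: "pbind (pbind ?p D) (\<lambda>xs. pbind ?q (\<lambda>b. pbind (m Prec (xs ! 1) b) (\<lambda>z. ?K [xs ! 0, z]))) = 0"
    proof -
      have "pbind (m Prec a y) (\<lambda>z. ?K [c, z]) = 0" if "a \<in> X" "y \<in> X" for a y c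
      proof -
        have "pbind (m Prec a y) \<pi> = 0" using that e_prec by (intro \<pi>0 m_mem)
        then have "pbind (\<Theta> c) (\<lambda>w. pbind (pbind (m Prec a y) \<pi>) (\<lambda>b. sg (w @ [b]))) = 0" by simp
        then show ?thesis by (simp add: pbind_assoc pbind_swap[of "m Prec a y"])
      qed
      then have "pbind (pbind ?p D) (\<lambda>xs. pbind ?q (\<lambda>b. pbind (m Prec (xs ! 1) b) (\<lambda>z. ?K [xs ! 0, z]))) =
          pbind (pbind ?p D) (\<lambda>xs. pbind ?q (\<lambda>b. 0))"
        by (intro fs_pbind_cong[OF fs_pbind[OF p D_words]] fs_pbind_cong[OF f_mem[OF b]]) (auto elim!: words_2E)
      then show ?thesis by simp
    qed
    have "pbind (E (u @ [b])) \<Theta> = pbind (pbind (bmul (m Prec) ?p ?q) D) ?K"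
      unfolding E_snoc[OF u b] using \<Theta>_lift[OF bmul_mem[OF p f_mem[OF b]], of Prec] 1 by simp
    also have "\<dots> = pbind (outer [?p, ?q]) ?K"
      unfolding comp_coord_lift[OF comp p f_mem[OF b]] pbind_add f_prim[OF b]
      using 2 by (simp add: pbind_assoc)
    also have "\<dots> = pbind (pbind ?p \<Theta>) (\<lambda>w. pbind (pbind ?q \<pi>) (\<lambda>b. sg (w @ [b])))"
      by (simp add: pbind_assoc pbind_swap[of ?q "\<Theta> x" for x])
    also have "\<dots> = sg (u @ [b])" using snoc.IH u by (simp add: \<pi>b)
    finally show ?thesis .
  qed
qed (simp add: nwords_def)

end

section \<open>The structure theorem in coordinates\<close>

lemma Prim_simps [simp]:
  "carrier (Prim H) = {x \<in> carrier H. comult H x = \<zero>\<^bsub>tensor_power 2 H\<^esub>}"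
  "add (Prim H) = add H" "zero (Prim H) = zero H" "smult (Prim H) = smult H"
  "bop (Prim H) op x y = (x \<prec>\<^bsub>H\<^esub> y) \<ominus>\<^bsub>H\<^esub> (x \<succ>\<^bsub>H\<^esub> y)"
  by (simp_all add: Prim_def mag_of_def module.defs balg.defs)

context bicoord
begin

lemma Prim_iff: "x \<in> carrier (Prim H) \<longleftrightarrow> x \<in> carrier H \<and> pbind (c x) D = 0"
  using coord.c_eq_0_iff[OF coord_tensor \<delta>_mem[of x]] tc_\<delta>[of x] by auto

text \<open>For primitive \<open>x\<close> and \<open>y\<close> the coproducts of
  \<open>x \<prec> y\<close> and \<open>x \<succ> y\<close> are both \<open>x \<otimes> y\<close>,
  so the difference of the two products is again primitive.\<close>

lemma Prim_mag_coord:
  assumes "comp_coord X m D"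
  obtains B :: "'a set" and d mL where "mag_coord (Prim H) B d mL"
proof -
  let ?P = "carrier (Prim H)"
  have P: "?P \<subseteq> carrier H" by auto
  have "subspace class_ring ?P H"
    unfolding subspace_iff using P Prim_iff
    by (auto simp del: Prim_simps simp: zero_mem add_mem smult_mem pbind_lin)
  from vectorspace_coord[OF subspace_is_vs[OF this]] obtain B :: "'a set" and d
    where "coord (H\<lparr>carrier := ?P\<rparr>) B d" .
  then have co: "coord (Prim H) B d" by (rule coord_cong) simp_all
  have mem: "bop (Prim H) op x y \<in> ?P" if "x \<in> ?P" "y \<in> ?P" for op x y
  proof -
    have xy: "x \<in> carrier H" "y \<in> carrier H" "pbind (c x) D = 0" "pbind (c y) D = 0" using that Prim_iff by auto
    have "pbind (c (bop (Prim H) op x y)) D = 0"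
      using xy comp_coord_lift[OF assms c_mem[OF xy(1)] c_mem[OF xy(2)]]
      by (simp add: bop_mem pbind_diff del: outer.simps)
    moreover have "bop (Prim H) op x y \<in> carrier H" using xy by (simp add: bop_mem minus_closed)
    ultimately show ?thesis using Prim_iff by blast
  qed
  interpret P: coord "Prim H" B d by (rule co)
  have "binary_algebra (Prim H)"
  proof (intro binary_algebra.intro P.vectorspace_axioms binary_algebra_axioms.intro mem)
    fix x x' y :: 'a and op a
    show "bop (Prim H) op (x \<oplus>\<^bsub>Prim H\<^esub> x') y = bop (Prim H) op x y \<oplus>\<^bsub>Prim H\<^esub> bop (Prim H) op x' y"
      "bop (Prim H) op y (x \<oplus>\<^bsub>Prim H\<^esub> x') = bop (Prim H) op y x \<oplus>\<^bsub>Prim H\<^esub> bop (Prim H) op y x'"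
      if "x \<in> ?P" "x' \<in> ?P" "y \<in> ?P"
      using that by (auto intro!: eqI simp: add_mem bop_mem minus_closed pbind_lin)
    show "bop (Prim H) op (a \<odot>\<^bsub>Prim H\<^esub> x) y = a \<odot>\<^bsub>Prim H\<^esub> bop (Prim H) op x y"
      "bop (Prim H) op x (a \<odot>\<^bsub>Prim H\<^esub> y) = a \<odot>\<^bsub>Prim H\<^esub> bop (Prim H) op x y"
      if "x \<in> ?P" "y \<in> ?P"
      using that by (auto intro!: eqI simp: smult_mem bop_mem minus_closed pbind_lin scl_diff)
  qed
  from binary_algebra.acoord[OF this co] show ?thesis
    by (intro that mag_coord.intro)
qed

text \<open>\<open>\<Theta>\<close> after \<open>c\<close> is a change of basis with inverse
  \<open>E\<close>. In the new basis \<open>H\<close> has literally the products and the coproduct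
  of words over its primitive part: \<open>E_word_op\<close> transports the products, and
  \<open>E_dec\<close> the coproduct because \<open>f\<close> has primitive values.\<close>

lemma connected_coordinates:
  assumes H: "duplicial_bialgebra H" and con: "connected_coalgebra H (comult H)" and L: "mag_coord (Prim H) B d mL"
  obtains c' where "bicoord H (nwords B) c' (word_op (mL Dot)) dec"
proof -
  interpret L: mag_coord "Prim H" B d mL by (rule L)
  have laws: "dup_coord X m" "coass_coord X D" "comp_coord X m D" using H duplicial_bialgebra_iff by auto
  interpret K: conn_bialg X D m
  proof
    show "\<exists>r. D_iter D r x = 0" if "x \<in> X" for x
      using con[unfolded connected_iff] ex_mem[OF that] that by fastforce
  qed (auto simp: D_mem m_mem laws)
  define f where "f b = c (L.vec (sg b))" for b
  have Lm: "L.vec p \<in> carrier H" "pbind (c (L.vec p)) D = 0" if "p \<in> fs B" for p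
    using L.vec_mem[OF that] Prim_iff by blast+
  have cf: "c (L.vec p) = pbind p f" if "p \<in> fs B" for p
    using that
  proof (induction rule: fs_induct)
    case 0
    have "L.vec 0 = \<zero>" by (rule L.vec_eqI) (use L.zero_mem L.c_zero in simp_all)
    then show ?case by simp
  next
    case (add p q)
    then have "L.vec (p + q) = L.vec p \<oplus> L.vec q" using L.vec_add by simp
    then show ?case using add Lm by (simp add: pbind_add)
  next
    case (scl x a)
    then have "L.vec (scl a (sg x)) = a \<odot> L.vec (sg x)" using L.vec_scl[of "sg x" a] by (simp del: scl_single)
    then show ?case using scl Lm by (simp add: pbind_scl f_def del: scl_single)
  qed
  have cP: "pbind (d x) f = c x" if "x \<in> carrier (Prim H)" for x
    using cf[OF L.c_mem[OF that]] L.vec_c[OF that] by simp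
  define \<pi> where "\<pi> x = d (vec (K.e x))" for x
  have eP: "vec (K.e x) \<in> carrier (Prim H)" if "x \<in> X" for x
    using K.e_mem[OF that] K.e_prim[OF that] by (simp add: Prim_iff vec_mem del: Prim_simps)
  interpret C: conn_prim X D m B "mL Dot" f \<pi>
  proof
    show "dup_coord X m" by (rule laws)
    show "m op x y \<in> fs X" if "x \<in> X" "y \<in> X" for op x y using m_mem that .
    show "mL Dot a b \<in> fs B" if "a \<in> B" "b \<in> B" for a b using L.m_mem that .
    show "f a \<in> fs X" if "a \<in> B" for a unfolding f_def using that by (intro c_mem Lm) simp
    show "pbind (f b) D = 0" if "b \<in> B" for b unfolding f_def using that by (intro Lm) simp
    show "\<pi> x \<in> fs B" if "x \<in> X" for x unfolding \<pi>_def by (intro L.c_mem eP that)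
    show "pbind (\<pi> x) f = K.e x" if "x \<in> X" for x
      unfolding \<pi>_def cP[OF eP[OF that]] using K.e_mem[OF that] by simp
    show "p = 0" if "p \<in> fs B" "pbind p f = 0" for p
    proof -
      have "c (L.vec p) = 0" using cf that by simp
      then have "L.vec p = \<zero>\<^bsub>Prim H\<^esub>" using c_eq_0_iff[OF Lm(1)[OF that(1)]] by simp
      then show "p = 0" using L.c_zero L.c_vec[OF that(1)] by simp
    qed
    show "pbind (mL Dot a b) f = bmul (m Prec) (f a) (f b) - bmul (m Succ) (f a) (f b)" if "a \<in> B" "b \<in> B" for a b
    proof -
      have v: "L.vec (sg a) \<in> carrier (Prim H)" "L.vec (sg b) \<in> carrier (Prim H)" using that by (auto intro!: L.vec_mem simp del: Prim_simps)
      have "pbind (mL Dot a b) f = pbind (d (bop (Prim H) Dot (L.vec (sg a)) (L.vec (sg b)))) f"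
        using that by (simp add: L.c_bop[OF v] del: Prim_simps)
      also have "\<dots> = c (bop (Prim H) Dot (L.vec (sg a)) (L.vec (sg b)))" by (rule cP[OF L.bop_mem[OF v]])
      also have "\<dots> = bmul (m Prec) (f a) (f b) - bmul (m Succ) (f a) (f b)"
        using Lm[of "sg a"] Lm[of "sg b"] that by (simp add: f_def bop_mem)
      finally show ?thesis .
    qed
  qed
  let ?c = "\<lambda>x. pbind (c x) C.\<Theta>"
  have E\<Theta>: "pbind (pbind p C.\<Theta>) C.E = p" if "p \<in> fs X" for p
  proof -
    have "pbind p (\<lambda>x. pbind (C.\<Theta> x) C.E) = pbind p sg" using that by (rule fs_pbind_cong) (rule C.E_\<Theta>)
    then show ?thesis by (simp add: pbind_assoc)
  qed
  have \<Theta>E: "pbind (pbind p C.E) C.\<Theta> = p" if "p \<in> fs (nwords B)" for p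
  proof -
    have "pbind p (\<lambda>x. pbind (C.E x) C.\<Theta>) = pbind p sg" using that by (rule fs_pbind_cong) (rule C.\<Theta>_E)
    then show ?thesis by (simp add: pbind_assoc)
  qed
  have Em: "pbind p C.E \<in> fs X" if "p \<in> fs (nwords B)" for p
    using that by (rule fs_pbind) (auto intro: C.E_mem simp: nwords_def)
  have cm: "?c x \<in> fs (nwords B)" if "x \<in> carrier H" for x
    using c_mem[OF that] by (rule fs_pbind) (rule C.\<Theta>_mem)
  have cE: "pbind (?c x) C.E = c x" if "x \<in> carrier H" for x
    using E\<Theta>[OF c_mem[OF that]] .
  have co: "coord H (nwords B) ?c"
  proof
    show "bij_betw ?c (carrier H) (fs (nwords B))"
    proof (rule bij_betwI[where g = "\<lambda>p. vec (pbind p C.E)"])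
      show "?c \<in> carrier H \<rightarrow> fs (nwords B)" using cm by blast
      show "(\<lambda>p. vec (pbind p C.E)) \<in> fs (nwords B) \<rightarrow> carrier H" using Em vec_mem by blast
    qed (auto simp: E\<Theta> \<Theta>E c_mem Em)
  qed (auto simp: zero_mem add_mem smult_mem pbind_lin)
  have ac: "acoord H (nwords B) ?c (word_op (mL Dot))"
  proof (intro acoord.intro co acoord_axioms.intro bop_mem)
    fix op x y assume xy: "x \<in> carrier H" "y \<in> carrier H"
    let ?w = "bmul (word_op (mL Dot) op) (?c x) (?c y)"
    have "?w \<in> fs (nwords B)"
      by (intro fs_pbind[OF cm[OF xy(1)]] fs_pbind[OF cm[OF xy(2)]] word_op_mem L.m_mem)
    then have "?w = pbind (pbind ?w C.E) C.\<Theta>" using \<Theta>E by simp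
    also have "pbind ?w C.E = bmul (m op) (pbind (?c x) C.E) (pbind (?c y) C.E)"
      by (rule pbind_bmul_morphism[OF C.E_word_op cm[OF xy(1)] cm[OF xy(2)]])
    also have "\<dots> = c (bop H op x y)"
      unfolding cE[OF xy(1)] cE[OF xy(2)] using xy by simp
    finally show "?c (bop H op x y) = ?w" by simp
  qed
  have "cocoord H (nwords B) ?c (comult H) dec"
  proof (intro cocoord.intro co cocoord_axioms.intro \<delta>_mem)
    fix x assume x: "x \<in> carrier H"
    \<comment> \<open>Change of basis in the tensor square: reading any representative in the new
      coordinates applies \<open>\<Theta>\<close> to each factor.\<close>
    have "tc ?c (comult H x) = pbind (tc c (comult H x)) (\<lambda>xs. outer (map C.\<Theta> xs))"
    proof -
      note t = \<delta>_mem[OF x]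
      have r: "pbind r (\<lambda>zs. outer (map ?c zs)) = pbind (tc c (comult H x)) (\<lambda>xs. outer (map C.\<Theta> xs))"
        if "r \<in> comult H x" for r
        using tensor_elems(2)[OF t that] by (simp add: outer_map_pbind pbind_assoc[symmetric])
      obtain r where "r \<in> comult H x" using tensor_elems(1)[OF t] by blast
      then have "tc ?c (comult H x) = pbind r (\<lambda>zs. outer (map ?c zs))"
        unfolding tc_def using r by (intro the_elem_image_unique) auto
      then show ?thesis using r \<open>r \<in> comult H x\<close> by simp
    qed
    also have "tc c (comult H x) = pbind (pbind (?c x) C.E) D" by (simp add: tc_\<delta>[OF x] cE[OF x])
    also have "\<dots> = pbind (?c x) (\<lambda>w. pbind (dec w) (\<lambda>ps. outer (map C.E ps)))"
      unfolding pbind_assoc[of "?c x"] using cm[OF x]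
      by (rule fs_pbind_cong) (intro C.E_dec[OF laws(3) C.f_prim], auto simp: nwords_def)
    also have "pbind \<dots> (\<lambda>xs. outer (map C.\<Theta> xs)) =
        pbind (?c x) (\<lambda>w. pbind (dec w) (\<lambda>ps. outer (map (\<lambda>p. pbind (C.E p) C.\<Theta>) ps)))"
      by (simp only: pbind_assoc outer_map_pbind)
    also have "\<dots> = pbind (?c x) (\<lambda>w. pbind (dec w) sg)"
    proof (intro fs_pbind_cong[OF cm[OF x]] fs_pbind_cong[OF dec_mem])
      fix w ps assume "ps \<in> words 2 (nwords B)"
      then have "map (\<lambda>p. pbind (C.E p) C.\<Theta>) ps = map sg ps" by (auto simp: words_def C.\<Theta>_E)
      then show "outer (map (\<lambda>p. pbind (C.E p) C.\<Theta>) ps) = sg ps" by (simp only: outer_map_sg)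
    qed
    finally show "tc ?c (comult H x) = pbind (?c x) dec" by simp
  qed
  with ac show ?thesis by (intro that bicoord.intro)
qed

end

text \<open>Both isomorphism statements are compared with connectedness. From connectedness,
  \<open>H\<close> gets the coordinates that the two targets already have, and matching coordinates
  is the isomorphism; backwards, the coproduct \<open>dec\<close> is connected.\<close>

theorem duplicial_bialgebra_structure:
  fixes H :: "('k::field, 'a, dup_op, 'm) bialg_scheme"
  assumes H: "duplicial_bialgebra H"
  shows "connected_coalgebra H (comult H) \<longleftrightarrow> (\<exists>f. dup_bialg_iso H (U (Prim H)) f)"
    and "(\<exists>f. dup_bialg_iso H (U (Prim H)) f) \<longleftrightarrow>
         (\<exists>f. coalgebra_iso H (comult H) (Asc (Prim H)) (deconcatenation (Prim H)) f)"
proof -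
  obtain X :: "'a set" and c m D where H': "bicoord H X c m D" using duplicial_bialgebra_bicoord[OF H] .
  interpret H: bicoord H X c m D by (rule H')
  obtain B :: "'a set" and d mL where L: "mag_coord (Prim H) B d mL"
    using H.Prim_mag_coord H H.duplicial_bialgebra_iff by blast
  interpret L: mag_coord "Prim H" B d mL by (rule L)
  interpret U: bicoord "U (Prim H)" "nwords B" L.U_c "word_op (mL Dot)" dec by (rule L.U_bicoord)
  \<comment> \<open>One argument for both targets, as each carries \<open>dec\<close> on words over
    \<open>B\<close>; connectedness is checked in the coordinates pulled back to
    \<open>H\<close>.\<close>
  have con: "connected_coalgebra H (comult H)" if "coalgebra_iso H (comult H) W \<epsilon> f" "cocoord W (nwords B) w \<epsilon> dec"
    for f w and \<epsilon> and W :: "('k, 'w, 'n) module_scheme"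
    by (rule dec_connected[OF coalgebra_iso_cocoord[OF that H.\<delta>_mem]]) (auto simp: nwords_def)
  have U: "\<exists>f. dup_bialg_iso H (U (Prim H)) f" if con: "connected_coalgebra H (comult H)"
  proof -
    obtain c' where "bicoord H (nwords B) c' (word_op (mL Dot)) dec" using H.connected_coordinates[OF H con L] .
    then interpret C: bicoord H "nwords B" c' "word_op (mL Dot)" dec .
    let ?f = "\<lambda>x. U.vec (c' x)"
    have f: "?f x \<in> carrier (U (Prim H)) \<and> L.U_c (?f x) = c' x" if "x \<in> carrier H" for x
      using C.c_mem[OF that] U.vec_mem by simp
    have "?f (bop H op x y) = bop (U (Prim H)) op (?f x) (?f y)" if "x \<in> carrier H" "y \<in> carrier H" for op x y
      using that f by (intro U.vec_eqI U.bop_mem) simp_all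
    moreover have "coalgebra_iso H (comult H) (U (Prim H)) (comult (U (Prim H))) ?f"
      by (rule cocoord_iso[OF C.cocoord_axioms U.cocoord_axioms f])
    ultimately show ?thesis unfolding dup_bialg_iso_def by blast
  qed
  have A: "\<exists>f. coalgebra_iso H (comult H) (Asc (Prim H)) (deconcatenation (Prim H)) f"
    if con: "connected_coalgebra H (comult H)"
  proof -
    obtain c' where "bicoord H (nwords B) c' (word_op (mL Dot)) dec" using H.connected_coordinates[OF H con L] .
    then interpret C: bicoord H "nwords B" c' "word_op (mL Dot)" dec .
    interpret A: cocoord "Asc (Prim H)" "nwords B" L.Asc_c "deconcatenation (Prim H)" dec by (rule L.Asc_cocoord)
    have "A.vec (c' x) \<in> carrier (Asc (Prim H)) \<and> L.Asc_c (A.vec (c' x)) = c' x" if "x \<in> carrier H" for x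
      using C.c_mem[OF that] A.vec_mem by simp
    from cocoord_iso[OF C.cocoord_axioms A.cocoord_axioms this] show ?thesis by blast
  qed
  have 1: "connected_coalgebra H (comult H)" if "dup_bialg_iso H (U (Prim H)) f" for f
    using that con[OF _ U.cocoord_axioms] by (auto simp: dup_bialg_iso_def)
  have 2: "connected_coalgebra H (comult H)"
    if "coalgebra_iso H (comult H) (Asc (Prim H)) (deconcatenation (Prim H)) f" for f
    using that by (rule con[OF _ L.Asc_cocoord])
  show "connected_coalgebra H (comult H) \<longleftrightarrow> (\<exists>f. dup_bialg_iso H (U (Prim H)) f)"
    using U 1 by blast
  show "(\<exists>f. dup_bialg_iso H (U (Prim H)) f) \<longleftrightarrow>
         (\<exists>f. coalgebra_iso H (comult H) (Asc (Prim H)) (deconcatenation (Prim H)) f)"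
    using U 1 A 2 by blast
qed

section \<open>Multilinear operations\<close>

lemma set_leaves: "set (leaves t) = gens t"
  by (induction t) auto

lemma coord_relabel:
  assumes "coord V X c" "inj_on h X"
  shows "coord V (h ` X) (\<lambda>x. pbind (c x) (\<lambda>a. sg (h a)))"
proof -
  interpret coord V X c by fact
  let ?c = "\<lambda>x. pbind (c x) (\<lambda>a. sg (h a))" and ?k = "\<lambda>b. sg (inv_into X h b)"
  have 1: "pbind (pbind p (\<lambda>a. sg (h a))) ?k = p" if "p \<in> fs X" for p
  proof -
    have "pbind p (\<lambda>a. sg (inv_into X h (h a))) = pbind p sg"
      using that by (rule fs_pbind_cong) (simp add: assms(2))
    then show ?thesis by (simp add: pbind_assoc)
  qed
  have 2: "pbind (pbind p ?k) (\<lambda>a. sg (h a)) = p" if "p \<in> fs (h ` X)" for p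
  proof -
    have "pbind p (\<lambda>b. sg (h (inv_into X h b))) = pbind p sg"
      using that by (rule fs_pbind_cong) (simp add: f_inv_into_f)
    then show ?thesis by (simp add: pbind_assoc)
  qed
  have k: "pbind p ?k \<in> fs X" if "p \<in> fs (h ` X)" for p
    using that by (rule fs_pbind) (simp add: inv_into_into)
  have h: "?c x \<in> fs (h ` X)" if "x \<in> carrier V" for x
    using c_mem[OF that] by (rule fs_pbind) simp
  show ?thesis
  proof
    show "bij_betw ?c (carrier V) (fs (h ` X))"
    proof (rule bij_betwI[where g = "\<lambda>p. vec (pbind p ?k)"])
      show "?c \<in> carrier V \<rightarrow> fs (h ` X)" using h by blast
      show "(\<lambda>p. vec (pbind p ?k)) \<in> fs (h ` X) \<rightarrow> carrier V" using k vec_mem by blast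
    qed (auto simp: 1 2 c_mem k)
  qed (auto simp: zero_mem add_mem smult_mem pbind_lin)
qed

lemma (in coord) span_eq:
  assumes "G \<subseteq> carrier V" "Y \<subseteq> X" "\<And>g. g \<in> G \<Longrightarrow> c g \<in> fs Y" "\<And>y. y \<in> Y \<Longrightarrow> vec (sg y) \<in> span G"
  shows "span G = {x \<in> carrier V. c x \<in> fs Y}"
proof
  have "submodule class_ring {x \<in> carrier V. c x \<in> fs Y} V"
    using module_axioms by (auto simp: submodule_def zero_mem add_mem smult_mem intro!: subsp_add subsp_scl)
  then show "span G \<subseteq> {x \<in> carrier V. c x \<in> fs Y}"
    using assms by (intro span_is_subset) auto
  have S: "submodule class_ring (span G) V" by (rule span_is_submodule[OF assms(1)])
  have YX: "fs Y \<subseteq> fs X" using assms(2) by (auto simp: fs_def)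
  have "vec p \<in> span G" if "p \<in> fs Y" for p
    using that
  proof (induction rule: fs_induct)
    case 0
    have "vec 0 = \<zero>" by (rule vec_eqI) (simp_all add: zero_mem)
    then show ?case using submodule.zero_closed[OF S] by simp
  next
    case (add p q)
    then have "vec (p + q) = vec p \<oplus> vec q" using YX by (intro vec_add) auto
    then show ?case using add submodule.m_closed[OF S] by simp
  next
    case (scl x a)
    then have "vec (scl a (sg x)) = a \<odot> vec (sg x)" using assms(2) by (intro vec_scl) auto
    then show ?case using submodule.smult_closed[OF S, of a "vec (sg x)"] assms(4)[OF scl] by (simp del: scl_single)
  qed
  then show "{x \<in> carrier V. c x \<in> fs Y} \<subseteq> span G" by (metis (no_types, lifting) mem_Collect_eq subsetI vec_c)
qed

text \<open>The counterpart of \<open>quot_lift_coord\<close> for quotients of free spaces by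
  algebra ideals: the result depends only on the coset because the coordinates of \<open>F t\<close>
  factor through \<open>q t\<close>. It serves the substitution maps of the operads.\<close>

lemma quot_lift_quotient:
  fixes A :: "('k::field, 'x \<Rightarrow>\<^sub>0 'k, 'o, 'm) balg_scheme"
  assumes "acoord_quot A X id m I Y q m'"
    and W: "coord W Z d" and C: "C \<in> carrier (quotient_alg A I)" and A: "carrier A = fs X"
    and F: "\<And>t. t \<in> X \<Longrightarrow> F t \<in> carrier W \<and> d (F t) = pbind (q t) \<Phi>"
  shows "quot_lift W F C \<in> carrier W"
    "d (quot_lift W F C) = pbind (the_elem ((\<lambda>p. pbind (id p) q) ` C)) \<Phi>"
proof -
  interpret acoord_quot A X id m I Y q m' by fact
  interpret W: coord W Z d by fact
  obtain x where x: "x \<in> carrier A" "C = I +>\<^bsub>A\<^esub> x" using C carrier_quotient_alg by auto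
  have l: "lin_ext W F r \<in> carrier W \<and> d (lin_ext W F r) = pbind (qc C) \<Phi>" if "r \<in> C" for r
  proof -
    have r: "r \<in> fs X" "pbind r q = qc C"
      using that x(1) A coset_eq[OF x(1)] qc_coset[OF x(1)] unfolding x(2) by simp_all
    have "d (lin_ext W F r) = pbind r (\<lambda>t. d (F t))"
      using fs_keys[OF r(1)] F by (intro W.c_lin_ext) auto
    also have "\<dots> = pbind r (\<lambda>t. pbind (q t) \<Phi>)" using r(1) by (rule fs_pbind_cong) (simp add: F)
    also have "\<dots> = pbind (qc C) \<Phi>" by (simp add: r(2)[symmetric] pbind_assoc)
    finally show ?thesis using fs_keys[OF r(1)] F by (auto intro: W.lin_ext_mem)
  qed
  have xC: "x \<in> C" using x by (simp add: coset_eq)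
  have "quot_lift W F C = lin_ext W F x"
    unfolding quot_lift_def using l xC by (intro the_elem_image_unique W.eqI) auto
  then show "quot_lift W F C \<in> carrier W"
    "d (quot_lift W F C) = pbind (the_elem ((\<lambda>p. pbind (id p) q) ` C)) \<Phi>"
    using l[OF xC] unfolding qc_def by simp_all
qed

text \<open>The tree basis for the operations of arity n: each variable labels exactly one leaf.
  Every tree has a leaf, so there is nothing in arity 0.\<close>

definition mlin :: "nat \<Rightarrow> ('o, nat) tm set" where
  "mlin n = {t. distinct (leaves t) \<and> set (leaves t) = {..<n}}"

lemma mlin_tms: "mlin n \<subseteq> tms {..<n}"
  by (auto simp: mlin_def tms_def set_leaves)

text \<open>The coordinate map is the identity in every dimension, so the derived coordinates
  \<open>mc\<close> and \<open>dc\<close> carry no arity index and the different arities can be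
  compared directly.\<close>

interpretation cs: coord "coord_space n :: ('k::field, nat \<Rightarrow>\<^sub>0 'k) module" "{..<n}" "\<lambda>p. p" for n
  unfolding coord_space_def by (rule coord_free_space[unfolded id_def])

lemma coord_space_simps [simp]: "carrier (coord_space n) = fs {..<n}"
  by (simp add: coord_space_def)

abbreviation mc :: "((mag_op, nat \<Rightarrow>\<^sub>0 'k::field) tm \<Rightarrow>\<^sub>0 'k) set \<Rightarrow> (mag_op, nat) tm \<Rightarrow>\<^sub>0 'k" where
  "mc \<equiv> coord.mag_c (\<lambda>p. p)"

abbreviation dc :: "((dup_op, nat \<Rightarrow>\<^sub>0 'k::field) tm \<Rightarrow>\<^sub>0 'k) set \<Rightarrow> (mag_op, nat) tm list \<Rightarrow>\<^sub>0 'k" where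
  "dc \<equiv> coord.dup_c (\<lambda>p. p)"

abbreviation MA :: "nat \<Rightarrow> ('k::field, ((mag_op, nat \<Rightarrow>\<^sub>0 'k) tm \<Rightarrow>\<^sub>0 'k) set, mag_op) balg" where
  "MA n \<equiv> free_alg mag_laws (coord_space n)"

abbreviation DA :: "nat \<Rightarrow> ('k::field, ((dup_op, nat \<Rightarrow>\<^sub>0 'k) tm \<Rightarrow>\<^sub>0 'k) set, dup_op) balg" where
  "DA n \<equiv> free_alg dup_laws (coord_space n)"

interpretation M: acoord "MA n :: ('k::field, _, _) balg" "tms {..<n}" mc op_tm for n
  by (rule cs.mag_acoord)

interpretation D: acoord "DA n :: ('k::field, _, _) balg" "nwords (tms {..<n})" dc dup_tm_op for n
  by (rule cs.dup_acoord)

lemma var_coord: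
  assumes "j < n"
  shows "var mag_laws n j \<in> carrier (MA n)" "mc (var mag_laws n j) = sg (Gen j)"
    "var dup_laws n j \<in> carrier (DA n)" "dc (var dup_laws n j) = sg [Gen j]"
  using cs.mag_free_term[of "Gen (sg j)" n] cs.dup_free_term[of "Gen (sg j)" n] assms
  by (simp_all add: var_def cs.mag_ev_def)

section \<open>Substitution of variables in coordinates\<close>

lemma mag_ev_pbind:
  "ev op_tm (\<lambda>v. pbind v G) t = pbind (cs.mag_ev t) (ev op_tm G)"
proof (induction t)
  case (Gen v)
  then show ?case by (simp add: cs.mag_ev_def pbind_assoc)
next
  case (Op op s t)
  have o: "cs.mag_ev (Op op s t) = bmul (op_tm op) (cs.mag_ev s) (cs.mag_ev t)" by (simp add: cs.mag_ev_def)
  show ?case unfolding o using Op by (simp add: pbind_assoc pbind_swap[of "cs.mag_ev t"])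
qed

lemma eval_lin_ext:
  assumes "acoord W Z d mW" "\<And>j. j < m \<Longrightarrow> g j \<in> carrier W" "t \<in> tms (carrier (coord_space m))"
  shows "eval_tm W (lin_ext W g) t \<in> carrier W"
    "d (eval_tm W (lin_ext W g) t) = ev mW (\<lambda>v. pbind v (\<lambda>j. d (g j))) t"
proof -
  interpret W: acoord W Z d mW by fact
  have g: "lin_ext W g v \<in> carrier W" "d (lin_ext W g v) = pbind v (\<lambda>j. d (g j))" if "v \<in> gens t" for v
  proof -
    have "v \<in> fs {..<m}" using assms(3) that by (auto simp: tms_def)
    then show "lin_ext W g v \<in> carrier W" "d (lin_ext W g v) = pbind v (\<lambda>j. d (g j))"
      using assms(2) by (auto intro!: W.lin_ext_mem W.c_lin_ext dest: fs_keys)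
  qed
  have "ev mW (\<lambda>v. d (lin_ext W g v)) t = ev mW (\<lambda>v. pbind v (\<lambda>j. d (g j))) t"
    using g(2) by (induction t) auto
  then show "eval_tm W (lin_ext W g) t \<in> carrier W"
    "d (eval_tm W (lin_ext W g) t) = ev mW (\<lambda>v. pbind v (\<lambda>j. d (g j))) t"
    using W.eval_tm_coord[of t "lin_ext W g"] g(1) by simp_all
qed

lemma subst_mag:
  fixes \<mu> :: "((mag_op, nat \<Rightarrow>\<^sub>0 'k::field) tm \<Rightarrow>\<^sub>0 'k) set"
  assumes \<mu>: "\<mu> \<in> carrier (MA m)" and g: "\<And>j. j < m \<Longrightarrow> g j \<in> carrier (MA n)"
  shows "subst_vars mag_laws n g \<mu> \<in> carrier (MA n)"
    "mc (subst_vars mag_laws n g \<mu>) = pbind (mc \<mu>) (ev op_tm (\<lambda>j. mc (g j)))"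
proof -
  note e = eval_lin_ext[OF M.acoord_axioms g]
  have F: "eval_tm (MA n) (lin_ext (MA n) g) t \<in> carrier (MA n) \<and>
      mc (eval_tm (MA n) (lin_ext (MA n) g) t) = pbind (cs.mag_ev t) (ev op_tm (\<lambda>j. mc (g j)))"
    if "t \<in> tms (carrier (coord_space m))" for t
    using e[OF _ that] by (simp add: mag_ev_pbind)
  note Q = quot_lift_quotient[OF cs.mag_quot[of m] M.coord_axioms \<mu>[unfolded free_alg_def] term_alg_simps(1) F]
  show "subst_vars mag_laws n g \<mu> \<in> carrier (MA n)"
    "mc (subst_vars mag_laws n g \<mu>) = pbind (mc \<mu>) (ev op_tm (\<lambda>j. mc (g j)))"
    using Q unfolding subst_vars_def cs.mag_c_def[of \<mu>] by simp_all
qed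

abbreviation dot_op :: "mag_op \<Rightarrow> (mag_op, 'x) tm list \<Rightarrow> (mag_op, 'x) tm list \<Rightarrow> (mag_op, 'x) tm list \<Rightarrow>\<^sub>0 'k::field" where
  "dot_op \<equiv> \<lambda>_ x y. dup_tm_op Prec x y - dup_tm_op Succ x y"

text \<open>Substitution is a duplicial morphism, hence of the form \<open>word_eval\<close>: each
  tree letter is evaluated at the substituted elements with \<open>\<prec>\<close> minus
  \<open>\<succ>\<close>, and the results are multiplied by \<open>\<prec>\<close>.\<close>

lemma subst_dup:
  fixes \<mu> :: "((dup_op, nat \<Rightarrow>\<^sub>0 'k::field) tm \<Rightarrow>\<^sub>0 'k) set"
  assumes \<mu>: "\<mu> \<in> carrier (DA m)" and g: "\<And>j. j < m \<Longrightarrow> g j \<in> carrier (DA n)"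
  shows "subst_vars dup_laws n g \<mu> \<in> carrier (DA n)"
    "dc (subst_vars dup_laws n g \<mu>) = pbind (dc \<mu>) (word_eval dup_tm_op (ev dot_op (\<lambda>j. dc (g j))))"
proof -
  interpret q: acoord_quot "term_alg (coord_space m) :: ('k, (dup_op, nat \<Rightarrow>\<^sub>0 'k) tm \<Rightarrow>\<^sub>0 'k, dup_op) balg" 
    "tms (carrier (coord_space m))" id op_tm "free_alg_ideal dup_laws (coord_space m)" "nwords (tms {..<m})" cs.dup_ev dup_tm_op
    by (rule cs.dup_quot)
  let ?f = "ev dot_op (\<lambda>j. dc (g j))"
  interpret w: word_morphism "nwords (tms {..<n})" dup_tm_op "tms {..<m} :: (mag_op, nat) tm set" "op_tm Dot" ?f
  proof
    show "dup_coord (nwords (tms {..<n})) dup_tm_op" by (rule word_op_dup_coord)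
    show w: "dup_tm_op op x y \<in> fs (nwords (tms {..<n}))" if "x \<in> nwords (tms {..<n})" "y \<in> nwords (tms {..<n})" for op x y
      using that by (intro word_op_mem op_tm_mem)
    show "?f a \<in> fs (nwords (tms {..<n}))" if "a \<in> tms {..<m}" for a
      using that by (intro ev_mem subsp_diff[OF subsp_fs] w D.c_mem g) (auto simp: tms_def)
    show "pbind (op_tm Dot a b) ?f = bmul (dup_tm_op Prec) (?f a) (?f b) - bmul (dup_tm_op Succ) (?f a) (?f b)" for a b
      by (simp add: pbind_diff_right)
  qed auto
  have dm: "cs.dup_ev t \<in> fs (nwords (tms {..<m}))" if "t \<in> tms (carrier (coord_space m))"
    for t :: "(dup_op, nat \<Rightarrow>\<^sub>0 'k) tm"
    using q.q_mem[OF that] .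
  have l: "ev dup_tm_op (\<lambda>v. pbind v (\<lambda>j. dc (g j))) t = pbind (cs.dup_ev t) w.E"
    if "t \<in> tms (carrier (coord_space m))" for t
    using that
  proof (induction t)
    case (Gen v)
    then show ?case by (simp add: pbind_assoc)
  next
    case (Op op s t)
    then show ?case
      using pbind_bmul_morphism[OF w.E_word_op dm dm, of s t op] by (simp del: word_op.simps)
  qed
  note e = eval_lin_ext[OF D.acoord_axioms g]
  have F: "eval_tm (DA n) (lin_ext (DA n) g) t \<in> carrier (DA n) \<and>
      dc (eval_tm (DA n) (lin_ext (DA n) g) t) = pbind (cs.dup_ev t) w.E"
    if "t \<in> tms (carrier (coord_space m))" for t
    using e[OF _ that] l[OF that] by simp
  note Q = quot_lift_quotient[OF cs.dup_quot[of m] D.coord_axioms \<mu>[unfolded free_alg_def] term_alg_simps(1) F]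
  show "subst_vars dup_laws n g \<mu> \<in> carrier (DA n)"
    "dc (subst_vars dup_laws n g \<mu>) = pbind (dc \<mu>) (word_eval dup_tm_op ?f)"
    using Q unfolding subst_vars_def cs.dup_c_def[of \<mu>] by simp_all
qed

section \<open>The operad of primitive operations\<close>

text \<open>The isomorphism of operads: in coordinates a tree becomes a one-letter word. It is
  defined on the whole free algebra and restricted to multilinear elements later.\<close>

definition mag_dup :: "nat \<Rightarrow> ((mag_op, nat \<Rightarrow>\<^sub>0 'k::field) tm \<Rightarrow>\<^sub>0 'k) set \<Rightarrow> ((dup_op, nat \<Rightarrow>\<^sub>0 'k) tm \<Rightarrow>\<^sub>0 'k) set" where
  "mag_dup n x = coord.vec (DA n) dc (pbind (mc x) (\<lambda>t. sg [t]))"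

lemma mag_dup_coord:
  assumes "x \<in> carrier (MA n)"
  shows "mag_dup n x \<in> carrier (DA n)" "dc (mag_dup n x) = pbind (mc x) (\<lambda>t. sg [t])"
proof -
  have "pbind (mc x) (\<lambda>t. sg [t]) \<in> fs (nwords (tms {..<n}))"
    using M.c_mem[OF assms] by (rule fs_pbind) (simp add: nwords_def)
  then show "mag_dup n x \<in> carrier (DA n)" "dc (mag_dup n x) = pbind (mc x) (\<lambda>t. sg [t])"
    unfolding mag_dup_def by (simp_all add: D.vec_mem)
qed

lemma mag_dup_eqI: "x \<in> carrier (MA n) \<Longrightarrow> y \<in> carrier (DA n) \<Longrightarrow> dc y = pbind (mc x) (\<lambda>t. sg [t]) \<Longrightarrow> mag_dup n x = y"
  by (intro D.eqI[of _ n]) (simp_all add: mag_dup_coord)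

lemma mag_dup_var: "j < n \<Longrightarrow> mag_dup n (var mag_laws n j) = var dup_laws n j"
  by (rule mag_dup_eqI) (simp_all add: var_coord)

text \<open>Partial composition and the action of permutations are both built from
  \<open>subst_vars\<close>, so this covers all the operad structure. It holds because
  \<open>\<prec>\<close> minus \<open>\<succ>\<close> on one-letter words is the tree product
  (\<open>word_op_letters\<close>): a tree evaluated on combinations of one-letter words stays such
  a combination.\<close>

lemma mag_dup_subst:
  assumes \<mu>: "\<mu> \<in> carrier (MA m)" and g: "\<And>j. j < m \<Longrightarrow> g j \<in> carrier (MA n)" "\<And>j. j < m \<Longrightarrow> g' j = mag_dup n (g j)"
  shows "mag_dup n (subst_vars mag_laws n g \<mu>) = subst_vars dup_laws n g' (mag_dup m \<mu>)"
proof (rule mag_dup_eqI)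
  have g': "g' j \<in> carrier (DA n)" "dc (g' j) = pbind (mc (g j)) (\<lambda>t. sg [t])" if "j < m" for j
    using g(2)[OF that] mag_dup_coord[OF g(1)[OF that]] by simp_all
  note d = subst_dup[OF mag_dup_coord(1)[OF \<mu>] g'(1)]
  show "subst_vars mag_laws n g \<mu> \<in> carrier (MA n)" by (rule subst_mag[OF \<mu> g(1)])
  show "subst_vars dup_laws n g' (mag_dup m \<mu>) \<in> carrier (DA n)" by (rule d(1))
  have "ev dot_op (\<lambda>j. dc (g' j)) t = pbind (ev op_tm (\<lambda>j. mc (g j)) t) (\<lambda>t. sg [t])" if "t \<in> tms {..<m}" for t
    using that
  proof (induction t)
    case (Op op s t)
    let ?s = "ev op_tm (\<lambda>j. mc (g j)) s" and ?t = "ev op_tm (\<lambda>j. mc (g j)) t"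
    have "ev dot_op (\<lambda>j. dc (g' j)) (Op op s t) =
        bmul (dup_tm_op Prec) (pbind ?s (\<lambda>x. sg [x])) (pbind ?t (\<lambda>x. sg [x])) -
        bmul (dup_tm_op Succ) (pbind ?s (\<lambda>x. sg [x])) (pbind ?t (\<lambda>x. sg [x]))"
      using Op by (simp add: pbind_diff_right)
    also have "\<dots> = pbind (ev op_tm (\<lambda>j. mc (g j)) (Op op s t)) (\<lambda>x. sg [x])"
      unfolding word_op_letters by (simp add: mag_op_eq[of op])
    finally show ?case .
  qed (simp add: g')
  then have "pbind (mc \<mu>) (\<lambda>t. ev dot_op (\<lambda>j. dc (g' j)) t) =
      pbind (mc \<mu>) (\<lambda>t. pbind (ev op_tm (\<lambda>j. mc (g j)) t) (\<lambda>t. sg [t]))"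
    by (rule fs_pbind_cong[OF M.c_mem[OF \<mu>]])
  then show "dc (subst_vars dup_laws n g' (mag_dup m \<mu>)) = pbind (mc (subst_vars mag_laws n g \<mu>)) (\<lambda>t. sg [t])"
    using d(2) subst_mag(2)[OF \<mu> g(1)] mag_dup_coord(2)[OF \<mu>] by (simp add: pbind_assoc)
qed

lemma multilinear_mag:
  "multilinear_part mag_laws n = {x \<in> carrier (MA n :: ('k::field, _, _) balg). mc x \<in> fs (mlin n)}"
  unfolding multilinear_part_def
proof (rule M.span_eq)
  let ?m = "map_gens (\<lambda>j. sg j) :: (mag_op, nat) tm \<Rightarrow> (mag_op, nat \<Rightarrow>\<^sub>0 'k) tm"
  let ?G = "{free_term mag_laws (coord_space n) (?m t) | t. distinct (leaves t) \<and> set (leaves t) = {..<n}}"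
  have ft: "free_term mag_laws (coord_space n) (?m t) \<in> carrier (MA n) \<and>
      mc (free_term mag_laws (coord_space n) (?m t)) = sg t" if "t \<in> mlin n" for t
  proof -
    have "gens t = {..<n}" using that set_leaves[of t] by (simp add: mlin_def)
    then have "gens (?m t) \<subseteq> carrier (coord_space n)" by (simp add: tm.set_map image_subset_iff)
    moreover have "cs.mag_ev (?m t) = sg t" unfolding cs.mag_ev_def by (induction t) auto
    ultimately show ?thesis using cs.mag_free_term by metis
  qed
  show G: "?G \<subseteq> carrier (MA n)" using ft by (auto simp: mlin_def)
  show "mlin n \<subseteq> tms {..<n}" by (rule mlin_tms)
  show "mc g \<in> fs (mlin n)" if "g \<in> ?G" for g using that ft by (auto simp: mlin_def)
  fix t :: "(mag_op, nat) tm" assume t: "t \<in> mlin n"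
  then have "free_term mag_laws (coord_space n) (?m t) \<in> ?G" by (auto simp: mlin_def)
  moreover have "coord.vec (MA n) mc (sg t) = free_term mag_laws (coord_space n) (?m t)"
    using ft[OF t] by (intro M.vec_eqI) auto
  ultimately show "coord.vec (MA n) mc (sg t) \<in> M.span n ?G" using M.in_own_span[OF G] by auto
qed

section \<open>Order of leaves and the multilinear part of the duplicial operad\<close>

definition word_leaves :: "('o, 'x) tm list \<Rightarrow> 'x list" where
  "word_leaves w = concat (map leaves w)"

lemma word_leaves_simps [simp]: "word_leaves [] = []" "word_leaves (t # w) = leaves t @ word_leaves w"
  "word_leaves (v @ w) = word_leaves v @ word_leaves w"
  by (simp_all add: word_leaves_def)

text \<open>Merging two trees regroups leaves but never permutes them. So each duplicial product
  concatenates the leaf lists of its factors, and multilinearity can be read off the leaves.\<close>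

lemma letter_succ_leaves:
  "letter_succ (op_tm Dot) a y \<in> fs {w. word_leaves w = leaves a @ word_leaves y}"
  by (cases y) (auto intro!: subsp_diff)

lemma word_succ_leaves:
  fixes x y :: "(mag_op, 'x) tm list"
  shows "(word_succ (op_tm Dot) x y :: _ \<Rightarrow>\<^sub>0 'k::field) \<in> fs {w. word_leaves w = word_leaves x @ word_leaves y}"
proof (induction "length x" arbitrary: x rule: less_induct)
  case less
  consider "x = []" | a where "x = [a]" | a b w where "x = a # b # w"
    by (metis list.exhaust)
  then show ?case
  proof cases
    case 2
    then show ?thesis using letter_succ_leaves[of a y] by simp
  next
    case 3
    have "pbind (word_succ (op_tm Dot) (b # w) y :: _ \<Rightarrow>\<^sub>0 'k) (letter_succ (op_tm Dot) a) \<in> fs {u. word_leaves u = word_leaves x @ word_leaves y}"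
    proof (rule fs_pbind[OF less[of "b # w"]])
      fix u :: "(mag_op, 'x) tm list" assume "u \<in> {u. word_leaves u = word_leaves (b # w) @ word_leaves y}"
      then show "letter_succ (op_tm Dot) a u \<in> fs {u. word_leaves u = word_leaves x @ word_leaves y}"
        using letter_succ_leaves[of a u] 3 by simp
    qed (use 3 in simp)
    then show ?thesis using less[of "Op Dot a b # w"] 3 by (auto intro!: subsp_add)
  qed simp
qed

lemma dup_tm_op_leaves: "dup_tm_op op x y \<in> fs {w. word_leaves w = word_leaves x @ word_leaves y}"
  by (cases op) (simp_all add: word_succ_leaves)

lemma dup_ev_leaves:
  "(ev dup_tm_op (\<lambda>j. sg [Gen j]) t :: _ \<Rightarrow>\<^sub>0 'k::field) \<in> fs {w. word_leaves w = leaves t}"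
proof (induction t)
  case (Op op s t)
  have "(dup_tm_op op x y :: _ \<Rightarrow>\<^sub>0 'k) \<in> fs {w. word_leaves w = leaves s @ leaves t}"
    if "x \<in> {w. word_leaves w = leaves s}" "y \<in> {w. word_leaves w = leaves t}" for x y
    using dup_tm_op_leaves[of op x y] that by simp
  then show ?case unfolding ev.simps leaves.simps by (intro fs_pbind[OF Op(1)] fs_pbind[OF Op(2)])
qed simp

text \<open>\<open>dup_ev_surj\<close> with control of the leaves: the preimage consists of terms
  with the same leaf list as the word, so a multilinear word comes from multilinear terms.\<close>

lemma dup_ev_leaves_surj:
  fixes w :: "(mag_op, nat) tm list"
  assumes "w \<noteq> []"
  shows "\<exists>r\<in>fs {t. leaves t = word_leaves w}. pbind r (ev dup_tm_op (\<lambda>j. sg [Gen j])) = (sg w :: _ \<Rightarrow>\<^sub>0 'k::field)"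
proof -
  let ?e = "ev dup_tm_op (\<lambda>j. sg [Gen j]) :: (dup_op, nat) tm \<Rightarrow> (mag_op, nat) tm list \<Rightarrow>\<^sub>0 'k"
  define R where "R ls = (\<lambda>r. pbind r ?e) ` fs {t. leaves t = ls}" for ls
  have diff: "p - q \<in> R ls" if "p \<in> R ls" "q \<in> R ls" for p q ls
    using that unfolding R_def by (auto simp: pbind_lin[symmetric] intro!: imageI fs_intros)
  have bm: "bmul (dup_tm_op op) p q \<in> R (ls @ ls')" if pq: "p \<in> R ls" "q \<in> R ls'" for p q op ls ls'
  proof -
    obtain r s where rs: "r \<in> fs {t. leaves t = ls}" "p = pbind r ?e" "s \<in> fs {t. leaves t = ls'}" "q = pbind s ?e"
      using pq by (auto simp: R_def)
    have "bmul (dup_tm_op op) p q = pbind (bmul (op_tm op) r s) ?e"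
      by (simp add: rs pbind_assoc pbind_swap[of s])
    moreover have "bmul (op_tm op) r s \<in> fs {t. leaves t = ls @ ls'}" 
      by (rule fs_pbind[OF rs(1)], rule fs_pbind[OF rs(3)]) simp
    ultimately show ?thesis unfolding R_def by blast
  qed
  have letter: "sg [t] \<in> R (leaves t)" for t
  proof (induction t)
    case (Gen x)
    have "pbind (sg (Gen x)) ?e = sg [Gen x]" "sg (Gen x) \<in> fs {t. leaves t = [x]}" by auto
    then show ?case unfolding R_def by (intro image_eqI[of _ _ "sg (Gen x)"]) simp_all
  next
    case (Op op s t)
    then have "bmul (dup_tm_op Prec) (sg [s]) (sg [t]) - bmul (dup_tm_op Succ) (sg [s]) (sg [t]) \<in> R (leaves s @ leaves t)"
      by (intro diff bm) auto
    then show ?case by (simp add: mag_op_eq[of op])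
  qed
  have "sg w \<in> R (word_leaves w)" using assms
  proof (induction w)
    case (Cons t w)
    show ?case
    proof (cases "w = []")
      case True
      then show ?thesis using letter by simp
    next
      case False
      then have "bmul (dup_tm_op Prec) (sg [t]) (sg w) \<in> R (leaves t @ word_leaves w)"
        using Cons by (intro bm letter) auto
      then show ?thesis by simp
    qed
  qed simp
  then show ?thesis by (auto simp: R_def)
qed

definition mlin_words :: "nat \<Rightarrow> (mag_op, nat) tm list set" where
  "mlin_words n = {w. w \<noteq> [] \<and> distinct (word_leaves w) \<and> set (word_leaves w) = {..<n}}"

lemma mlin_words_nwords: "mlin_words n \<subseteq> nwords (tms {..<n})"
  by (auto simp: mlin_words_def nwords_def tms_def word_leaves_def set_leaves)

lemma multilinear_dup:
  "multilinear_part dup_laws n = {x \<in> carrier (DA n :: ('k::field, _, _) balg). dc x \<in> fs (mlin_words n)}"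
  unfolding multilinear_part_def
proof (rule D.span_eq)
  let ?m = "map_gens (\<lambda>j. sg j) :: (dup_op, nat) tm \<Rightarrow> (dup_op, nat \<Rightarrow>\<^sub>0 'k) tm"
  let ?G = "{free_term dup_laws (coord_space n) (?m t) | t. distinct (leaves t) \<and> set (leaves t) = {..<n}}"
  let ?e = "ev dup_tm_op (\<lambda>j. sg [Gen j]) :: (dup_op, nat) tm \<Rightarrow> (mag_op, nat) tm list \<Rightarrow>\<^sub>0 'k"
  have ft: "free_term dup_laws (coord_space n) (?m t) \<in> carrier (DA n) \<and>
      dc (free_term dup_laws (coord_space n) (?m t)) = ?e t" if "t \<in> mlin n" for t
  proof -
    have "gens t = {..<n}" using that set_leaves[of t] by (simp add: mlin_def)
    then have "gens (?m t) \<subseteq> carrier (coord_space n)" by (simp add: tm.set_map image_subset_iff)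
    moreover have "cs.dup_ev (?m t) = ?e t" unfolding cs.dup_ev_def by (induction t) auto
    ultimately show ?thesis using cs.dup_free_term by metis
  qed
  show G: "?G \<subseteq> carrier (DA n)" using ft by (auto simp: mlin_def)
  show "mlin_words n \<subseteq> nwords (tms {..<n})" by (rule mlin_words_nwords)
  show "dc g \<in> fs (mlin_words n)" if g: "g \<in> ?G" for g
  proof -
    obtain t where t: "g = free_term dup_laws (coord_space n) (?m t)" "t \<in> mlin n" using g by (auto simp: mlin_def)
    have "?e t \<in> fs (nwords (tms {..<n}))" using ft[OF t(2)] D.c_mem by metis
    moreover have "?e t \<in> fs {w. word_leaves w = leaves t}" by (rule dup_ev_leaves)
    ultimately have "?e t \<in> fs (mlin_words n)"
      using t(2) by (auto simp: fs_def mlin_words_def mlin_def nwords_def)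
    then show ?thesis using ft[OF t(2)] t(1) by simp
  qed
  fix w assume w: "w \<in> mlin_words n"
  then obtain r :: "(dup_op, nat) tm \<Rightarrow>\<^sub>0 'k" where r: "r \<in> fs {t. leaves t = word_leaves w}" "pbind r ?e = sg w"
    using dup_ev_leaves_surj[of w] by (auto simp: mlin_words_def)
  \<comment> \<open>Terms with the leaf list of \<open>w\<close> are multilinear themselves, so
    \<open>r\<close> is supported on the terms whose classes span the multilinear part.\<close>
  have r': "r \<in> fs (mlin n)" using r(1) w by (auto simp: fs_def mlin_words_def mlin_def)
  have S: "submodule class_ring (D.span n ?G) (DA n)" by (rule D.span_is_submodule[OF G])
  have em: "pbind p ?e \<in> fs (nwords (tms {..<n}))" if "p \<in> fs (mlin n)" for p
    using that by (rule fs_pbind) (use ft D.c_mem in metis)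
  have "coord.vec (DA n) dc (pbind r ?e) \<in> D.span n ?G"
    using r'
  proof (induction rule: fs_induct)
    case 0
    have "coord.vec (DA n) dc (0 :: (mag_op, nat) tm list \<Rightarrow>\<^sub>0 'k) = \<zero>\<^bsub>DA n\<^esub>" by (rule D.vec_eqI) (simp_all add: D.zero_mem)
    then show ?case using submodule.zero_closed[OF S] by simp
  next
    case (add p q)
    then have "coord.vec (DA n) dc (pbind p ?e + pbind q ?e) =
        coord.vec (DA n) dc (pbind p ?e) \<oplus>\<^bsub>DA n\<^esub> coord.vec (DA n) dc (pbind q ?e)" by (intro D.vec_add em)
    then show ?case using add submodule.m_closed[OF S] by (simp add: pbind_add)
  next
    case (scl t a)
    have "coord.vec (DA n) dc (?e t) = free_term dup_laws (coord_space n) (?m t)"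
      using ft[OF scl] by (intro D.vec_eqI) auto
    moreover have "free_term dup_laws (coord_space n) (?m t) \<in> ?G" using scl by (auto simp: mlin_def)
    ultimately have "coord.vec (DA n) dc (?e t) \<in> D.span n ?G" using D.in_own_span[OF G] by auto
    moreover have "?e t \<in> fs (nwords (tms {..<n}))" using ft[OF scl] D.c_mem by metis
    then have "coord.vec (DA n) dc (scl a (?e t)) = a \<odot>\<^bsub>DA n\<^esub> coord.vec (DA n) dc (?e t)"
      by (rule D.vec_scl)
    ultimately show ?case using submodule.smult_closed[OF S, of a] by (simp add: pbind_scl del: scl_single)
  qed
  then show "coord.vec (DA n) dc (sg w) \<in> D.span n ?G" unfolding r(2) .
qed

lemma lookup_pbind_filter:
  "Poly_Mapping.lookup (pbind p (\<lambda>w. if P w then sg w else 0)) x = (if P x then Poly_Mapping.lookup p x else 0)"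
proof -
  have "Poly_Mapping.lookup (pbind p (\<lambda>w. if P w then sg w else 0)) x =
      (\<Sum>y\<in>Poly_Mapping.keys p. if y = x then (if P x then Poly_Mapping.lookup p x else 0) else 0)"
    unfolding pbind_def lookup_sum by (intro sum.cong) (auto simp: lookup_single when_def)
  then show ?thesis by (auto simp: in_keys_iff)
qed

text \<open>Gluing the first letter back shows that deconcatenation is injective on words of length at least two.\<close>

lemma dec_kernel:
  assumes "p \<in> fs {w. w \<noteq> []}"
  shows "pbind p dec = 0 \<longleftrightarrow> p \<in> fs {w. length w = 1}"
proof
  assume 0: "pbind p dec = 0"
  let ?g = "\<lambda>ps :: 'a list list. if length (ps ! 0) = 1 then sg (concat ps) else 0"
  have g: "pbind (dec w) ?g = (if length w \<noteq> 1 then sg w else 0)" if w: "w \<noteq> []" for w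
  proof (cases w)
    case (Cons a v)
    have "pbind (dec v) (\<lambda>ps. if ps ! 0 = [] then sg (concat [a # ps ! 0, ps ! Suc 0]) else 0) = pbind (dec v) (\<lambda>ps. 0)"
      by (rule dec_cong) simp
    then show ?thesis using Cons by (auto simp: pbind_add pbind_assoc)
  qed (use w in simp)
  have "pbind p (\<lambda>w. if length w \<noteq> 1 then sg w else 0) = pbind (pbind p dec) ?g"
    unfolding pbind_assoc using assms by (rule fs_pbind_cong) (simp add: g[unfolded One_nat_def])
  then have "Poly_Mapping.lookup p w = 0" if "length w \<noteq> 1" for w
    using lookup_pbind_filter[of p "\<lambda>w. length w \<noteq> 1" w] 0 that by simp
  then show "p \<in> fs {w. length w = 1}" unfolding fs_def in_keys_iff by blast
next
  assume "p \<in> fs {w. length w = 1}"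
  then have "pbind p dec = pbind p (\<lambda>w. 0)" by (rule fs_pbind_cong) (auto simp: length_Suc_conv)
  then show "pbind p dec = 0" by simp
qed

lemma primitive_operations_eq:
  "primitive_operations n = {x \<in> carrier (DA n :: ('k::field, _, _) balg). dc x \<in> fs ((\<lambda>t. [t]) ` mlin n)}"
proof -
  interpret B: bicoord "Dup (coord_space n)" "nwords (tms {..<n})" dc dup_tm_op dec
    by (rule cs.Dup_comult_coord(2))
  have *: "comult (Dup (coord_space n)) x = \<zero>\<^bsub>tensor_power 2 (Dup (coord_space n))\<^esub> \<longleftrightarrow> dc x \<in> fs {w. length w = 1}"
    if x: "x \<in> carrier (DA n)" for x :: "((dup_op, nat \<Rightarrow>\<^sub>0 'k) tm \<Rightarrow>\<^sub>0 'k) set"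
  proof -
    have x': "x \<in> carrier (Dup (coord_space n))" using x by simp
    have "comult (Dup (coord_space n)) x = \<zero>\<^bsub>tensor_power 2 (Dup (coord_space n))\<^esub> \<longleftrightarrow> pbind (dc x) dec = 0"
      using coord.c_eq_0_iff[OF B.coord_tensor B.\<delta>_mem[OF x']] B.tc_\<delta>[OF x'] by simp
    also have "\<dots> \<longleftrightarrow> dc x \<in> fs {w. length w = 1}"
      using B.c_mem[OF x'] by (intro dec_kernel) (auto simp: fs_def nwords_def)
    finally show ?thesis .
  qed
  have mem: "[t] \<in> mlin_words n \<longleftrightarrow> t \<in> mlin n" for t
    by (simp add: mlin_words_def mlin_def)
  have "w \<in> mlin_words n \<and> w \<in> {w. length w = 1} \<longleftrightarrow> w \<in> (\<lambda>t. [t]) ` mlin n" for w :: "(mag_op, nat) tm list"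
  proof (cases "\<exists>t. w = [t]")
    case True
    then obtain t where "w = [t]" by blast
    then show ?thesis using mem[of t] by (simp add: image_iff)
  next
    case False
    then show ?thesis by (auto simp: length_Suc_conv)
  qed
  then have I: "mlin_words n \<inter> {w. length w = 1} = (\<lambda>t. [t]) ` mlin n" by blast
  have "p \<in> fs (mlin_words n) \<and> p \<in> fs {w. length w = 1} \<longleftrightarrow> p \<in> fs ((\<lambda>t. [t]) ` mlin n)"
    for p :: "(mag_op, nat) tm list \<Rightarrow>\<^sub>0 'k" unfolding I[symmetric] fs_def by simp
  then show ?thesis
    unfolding primitive_operations_def using *
    by (auto simp: operad_of_def multilinear_dup)
qed

lemma mag_dup_prim: "x \<in> multilinear_part mag_laws n \<Longrightarrow> mag_dup n x \<in> primitive_operations n"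
  unfolding multilinear_mag primitive_operations_eq
  by (auto simp: mag_dup_coord intro!: fs_pbind[of _ "mlin n"])

lemma ops_simps [simp]:
  "carrier (ops (operad_of laws) n) = multilinear_part laws n"
  "add (ops (operad_of laws) n) = add (free_alg laws (coord_space n))"
  "zero (ops (operad_of laws) n) = zero (free_alg laws (coord_space n))"
  "smult (ops (operad_of laws) n) = smult (free_alg laws (coord_space n))"
  by (simp_all add: operad_of_def module.defs)

lemma coord_ops_mag: "coord (ops (Mag_operad :: ('k::field, _) operad) n) (mlin n) mc"
proof (rule coord_subspace[OF M.coord_axioms, where S = "multilinear_part mag_laws n"])
  have "p \<in> mc ` multilinear_part mag_laws n" if "p \<in> fs (mlin n)" for p :: "(mag_op, nat) tm \<Rightarrow>\<^sub>0 'k"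
  proof -
    have "p \<in> fs (tms {..<n})" using that mlin_tms[of n] by (auto simp: fs_def)
    then show ?thesis using that M.vec_mem[of p n] M.c_vec[of p n] by (auto simp: multilinear_mag image_iff intro!: bexI)
  qed
  then show "mc ` multilinear_part mag_laws n = (fs (mlin n) :: ((mag_op, nat) tm \<Rightarrow>\<^sub>0 'k) set)" by (auto simp: multilinear_mag)
qed (auto simp: multilinear_mag)

lemma coord_ops_prim: "coord (ops (Prim_As_Dup :: ('k::field, _) operad) n) ((\<lambda>t. [t]) ` mlin n) dc"
proof (rule coord_subspace[OF D.coord_axioms, where S = "primitive_operations n"])
  have "p \<in> dc ` primitive_operations n" if "p \<in> fs ((\<lambda>t. [t]) ` mlin n)" for p :: "(mag_op, nat) tm list \<Rightarrow>\<^sub>0 'k"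
  proof -
    have "(\<lambda>t. [t]) ` mlin n \<subseteq> nwords (tms {..<n} :: (mag_op, nat) tm set)" using mlin_tms[of n] by (auto simp: nwords_def)
    then have "p \<in> fs (nwords (tms {..<n}))" using that by (simp add: fs_def)
    then show ?thesis using that D.vec_mem[of p n] D.c_vec[of p n] by (auto simp: primitive_operations_eq image_iff intro!: bexI)
  qed
  then show "dc ` primitive_operations n = (fs ((\<lambda>t. [t]) ` mlin n) :: ((mag_op, nat) tm list \<Rightarrow>\<^sub>0 'k) set)" by (auto simp: primitive_operations_eq)
qed (auto simp: primitive_operations_eq Prim_As_Dup_def restrict_operad_def)

lemma linear_iso_mag_dup: "linear_iso (ops (Mag_operad :: ('k::field, _) operad) n) (ops Prim_As_Dup n) (mag_dup n)"
proof (rule coord_linear_iso[OF coord_relabel[OF coord_ops_mag] coord_ops_prim])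
  show "inj_on (\<lambda>t. [t]) (mlin n)" by (simp add: inj_on_def)
  fix x :: "((mag_op, nat \<Rightarrow>\<^sub>0 'k) tm \<Rightarrow>\<^sub>0 'k) set" assume x: "x \<in> carrier (ops Mag_operad n)"
  then have "x \<in> carrier (MA n)" by (simp add: multilinear_mag)
  with x show "mag_dup n x \<in> carrier (ops Prim_As_Dup n) \<and> dc (mag_dup n x) = pbind (mc x) (\<lambda>t. sg [t])"
    using mag_dup_prim[of x n] by (simp add: mag_dup_coord Prim_As_Dup_def restrict_operad_def)
qed

section \<open>Partial composition and permutations of tree operations\<close>

lemma ev_mlin:
  assumes "\<And>j. j \<in> set (leaves t) \<Longrightarrow> G j \<in> fs {s. distinct (leaves s) \<and> set (leaves s) = A j}"
    and "\<And>i j. i \<in> set (leaves t) \<Longrightarrow> j \<in> set (leaves t) \<Longrightarrow> i \<noteq> j \<Longrightarrow> A i \<inter> A j = {}"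
    and "distinct (leaves t)"
  shows "ev op_tm G t \<in> fs {s. distinct (leaves s) \<and> set (leaves s) = (\<Union>j\<in>set (leaves t). A j)}"
  using assms
proof (induction t)
  case (Op op s t)
  have s: "ev op_tm G s \<in> fs {u. distinct (leaves u) \<and> set (leaves u) = (\<Union>j\<in>set (leaves s). A j)}"
    using Op.prems by (intro Op.IH(1)) auto
  have t: "ev op_tm G t \<in> fs {u. distinct (leaves u) \<and> set (leaves u) = (\<Union>j\<in>set (leaves t). A j)}"
    using Op.prems by (intro Op.IH(2)) auto
  have "(\<Union>j\<in>set (leaves s). A j) \<inter> (\<Union>j\<in>set (leaves t). A j) = {}"
  proof -
    have "A i \<inter> A j = {}" if "i \<in> set (leaves s)" "j \<in> set (leaves t)" for i j
      using Op.prems(2)[of i j] Op.prems(3) that by auto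
    then show ?thesis by blast
  qed
  then show ?case unfolding ev.simps by (intro fs_pbind[OF s] fs_pbind[OF t]) auto
qed simp

lemma subst_mag_multilinear:
  assumes \<mu>: "\<mu> \<in> multilinear_part mag_laws m"
    and g: "\<And>j. j < m \<Longrightarrow> g j \<in> carrier (MA n) \<and> mc (g j) \<in> fs {s. distinct (leaves s) \<and> set (leaves s) = A j}"
    and A: "\<And>i j. i < m \<Longrightarrow> j < m \<Longrightarrow> i \<noteq> j \<Longrightarrow> A i \<inter> A j = {}"
  shows "subst_vars mag_laws n g \<mu> \<in> carrier (MA n)"
    "mc (subst_vars mag_laws n g \<mu>) \<in> fs {s. distinct (leaves s) \<and> set (leaves s) = (\<Union>j<m. A j)}"
proof -
  have m: "\<mu> \<in> carrier (MA m)" "mc \<mu> \<in> fs (mlin m)" using \<mu> by (auto simp: multilinear_mag)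
  show "subst_vars mag_laws n g \<mu> \<in> carrier (MA n)" using m g by (intro subst_mag) auto
  have "ev op_tm (\<lambda>j. mc (g j)) t \<in> fs {s. distinct (leaves s) \<and> set (leaves s) = (\<Union>j<m. A j)}" if "t \<in> mlin m" for t
    using ev_mlin[of t "\<lambda>j. mc (g j)" A] that g A by (simp add: mlin_def)
  then show "mc (subst_vars mag_laws n g \<mu>) \<in> fs {s. distinct (leaves s) \<and> set (leaves s) = (\<Union>j<m. A j)}"
    using subst_mag(2)[OF m(1), of g n] g m(2) by (auto intro: fs_pbind)
qed

lemma var_mlin: "j < n \<Longrightarrow> mc (var mag_laws n j) \<in> fs {s. distinct (leaves s) \<and> set (leaves s) = {j}}"
  by (simp add: var_coord)

lemma pcomp_mag:
  fixes \<mu> \<nu> :: "((mag_op, nat \<Rightarrow>\<^sub>0 'k::field) tm \<Rightarrow>\<^sub>0 'k) set"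
  assumes \<mu>: "\<mu> \<in> multilinear_part mag_laws m" and \<nu>: "\<nu> \<in> multilinear_part mag_laws n" and i: "i < m"
  shows "pcomp Mag_operad m n i \<mu> \<nu> \<in> multilinear_part mag_laws (m + n - 1)"
    "mag_dup (m + n - 1) (pcomp Mag_operad m n i \<mu> \<nu>) = pcomp Dup_operad m n i (mag_dup m \<mu>) (mag_dup n \<nu>)"
proof -
  let ?N = "m + n - 1"
  let ?s = "subst_vars mag_laws ?N (\<lambda>l. var mag_laws ?N (i + l)) \<nu>"
  let ?s' = "subst_vars dup_laws ?N (\<lambda>l. var dup_laws ?N (i + l)) (mag_dup n \<nu>)"
  let ?g = "\<lambda>j. if j < i then var mag_laws ?N j else if j = i then ?s else var mag_laws ?N (j + n - 1)"
  let ?g' = "\<lambda>j. if j < i then var dup_laws ?N j else if j = i then ?s' else var dup_laws ?N (j + n - 1)"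
  \<comment> \<open>\<open>A j\<close> is the block of variables that input \<open>j\<close> of
    \<open>\<mu>\<close> occupies after the insertion: inputs before \<open>i\<close> stay, input
    \<open>i\<close> opens into n consecutive variables, and later inputs move up by n - 1. The
    proof needs these blocks to partition the variables below \<open>m + n - 1\<close>.\<close>
  define A where "A j = (if j < i then {j} else if j = i then {i..<i + n} else {j + n - 1})" for j
  have \<mu>': "\<mu> \<in> carrier (MA m)" and \<nu>': "\<nu> \<in> carrier (MA n)" using \<mu> \<nu> by (auto simp: multilinear_mag)
  have gv: "(var mag_laws ?N l :: ((mag_op, nat \<Rightarrow>\<^sub>0 'k) tm \<Rightarrow>\<^sub>0 'k) set) \<in> carrier (MA ?N) \<and>
      mc (var mag_laws ?N l :: ((mag_op, nat \<Rightarrow>\<^sub>0 'k) tm \<Rightarrow>\<^sub>0 'k) set) \<in> fs {s. distinct (leaves s) \<and> set (leaves s) = {l}}"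
    if "l < ?N" for l
    using that by (simp add: var_coord)
  have v: "(var mag_laws ?N (i + l) :: ((mag_op, nat \<Rightarrow>\<^sub>0 'k) tm \<Rightarrow>\<^sub>0 'k) set) \<in> carrier (MA ?N)" if "l < n" for l
    using that i gv[of "i + l"] by simp
  have "?s \<in> carrier (MA ?N)" "mc ?s \<in> fs {s. distinct (leaves s) \<and> set (leaves s) = (\<Union>l<n. {i + l})}"
    using i by (auto intro!: subst_mag_multilinear[OF \<nu>] var_coord var_mlin)
  moreover have "(\<Union>l<n. {i + l}) = {i..<i + n}"
    using image_add_atLeastLessThan[of i 0 n] by (simp add: lessThan_atLeast0 UNION_singleton_eq_range add.commute)
  ultimately have s: "?s \<in> carrier (MA ?N)" "mc ?s \<in> fs {s. distinct (leaves s) \<and> set (leaves s) = {i..<i + n}}" by auto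
  have g: "?g j \<in> carrier (MA ?N) \<and> mc (?g j) \<in> fs {s. distinct (leaves s) \<and> set (leaves s) = A j}" if "j < m" for j
  proof -
    consider "j < i" | "j = i" | "i < j" by linarith
    then show ?thesis
    proof cases
      case 1
      then show ?thesis using gv[of j] i by (simp add: A_def)
    next
      case 2
      then show ?thesis using s by (simp add: A_def)
    next
      case 3
      then show ?thesis using gv[of "j + n - 1"] that by (simp add: A_def)
    qed
  qed
  have dis: "A j \<inter> A k = {}" if "j < m" "k < m" "j \<noteq> k" for j k
    using that by (auto simp: A_def split: if_splits)
  have un: "(\<Union>j<m. A j) = {..<?N}"
  proof (rule Set.set_eqI)
    fix x
    have "x \<in> (\<Union>j<m. A j) \<longleftrightarrow> (\<exists>j<m. x \<in> A j)" by blast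
    also have "\<dots> \<longleftrightarrow> x < ?N"
    proof
      assume "\<exists>j<m. x \<in> A j"
      then show "x < ?N" using i by (auto simp: A_def split: if_splits)
    next
      assume x: "x < ?N"
      consider "x < i" | "i \<le> x" "x < i + n" | "i + n \<le> x" by linarith
      then show "\<exists>j<m. x \<in> A j"
      proof cases
        case 1
        then show ?thesis using i by (intro exI[of _ x]) (simp add: A_def)
      next
        case 2
        then show ?thesis using i by (intro exI[of _ i]) (simp add: A_def)
      next
        case 3
        \<comment> \<open>The witness inverts the shift \<open>j \<mapsto> j + n - 1\<close> of the
          inputs after \<open>i\<close>; \<open>i + n \<le> x\<close> makes it larger than
          \<open>i\<close>.\<close>
        then show ?thesis using i x by (intro exI[of _ "x + 1 - n"]) (auto simp: A_def)
      qed
    qed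
    finally show "x \<in> (\<Union>j<m. A j) \<longleftrightarrow> x \<in> {..<?N}" by simp
  qed
  have pc: "pcomp Mag_operad m n i \<mu> \<nu> = subst_vars mag_laws ?N ?g \<mu>"
    "pcomp Dup_operad m n i (mag_dup m \<mu>) (mag_dup n \<nu>) = subst_vars dup_laws ?N ?g' (mag_dup m \<mu>)"
    by (simp_all add: operad_of_def)
  show "pcomp Mag_operad m n i \<mu> \<nu> \<in> multilinear_part mag_laws ?N"
    unfolding pc multilinear_mag[of ?N] using subst_mag_multilinear[where g = ?g and n = ?N and A = A, OF \<mu> g dis]
    by (simp add: un mlin_def)
  have s': "?s' = mag_dup ?N ?s"
    using i v by (intro mag_dup_subst[OF \<nu>', symmetric]) (auto simp: mag_dup_var)
  show "mag_dup ?N (pcomp Mag_operad m n i \<mu> \<nu>) = pcomp Dup_operad m n i (mag_dup m \<mu>) (mag_dup n \<nu>)"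
    unfolding pc
  proof (rule mag_dup_subst[OF \<mu>'])
    show "?g j \<in> carrier (MA ?N)" if "j < m" for j using g[OF that] by blast
    show "?g' j = mag_dup ?N (?g j)" if "j < m" for j
      using that i s' by (auto simp: mag_dup_var)
  qed
qed

lemma perm_act_mag:
  fixes \<mu> :: "((mag_op, nat \<Rightarrow>\<^sub>0 'k::field) tm \<Rightarrow>\<^sub>0 'k) set"
  assumes \<mu>: "\<mu> \<in> multilinear_part mag_laws n" and \<sigma>: "\<sigma> permutes {..<n}"
  shows "perm_act Mag_operad n \<sigma> \<mu> \<in> multilinear_part mag_laws n"
    "mag_dup n (perm_act Mag_operad n \<sigma> \<mu>) = perm_act Dup_operad n \<sigma> (mag_dup n \<mu>)"
proof -
  have lt: "\<sigma> j < n" if "j < n" for j using permutes_in_image[OF \<sigma>, of j] that by simp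
  have un: "(\<Union>j<n. {\<sigma> j}) = {..<n}" using permutes_image[OF \<sigma>] by auto
  have dis: "{\<sigma> i} \<inter> {\<sigma> j} = {}" if "i \<noteq> j" for i j using permutes_inj[OF \<sigma>] that by (auto dest: injD)
  have pa: "perm_act (operad_of laws) n \<sigma> = subst_vars laws n (\<lambda>j. var laws n (\<sigma> j))" for laws :: "('k, 'o, nat \<Rightarrow>\<^sub>0 'k) laws"
    by (simp add: operad_of_def)
  show "perm_act Mag_operad n \<sigma> \<mu> \<in> multilinear_part mag_laws n"
    unfolding pa multilinear_mag[of n]
    using subst_mag_multilinear[OF \<mu>, of "\<lambda>j. var mag_laws n (\<sigma> j)" n "\<lambda>j. {\<sigma> j}"] lt dis
    by (simp add: un mlin_def var_coord)
  have "\<mu> \<in> carrier (MA n)" using \<mu> by (simp add: multilinear_mag)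
  then show "mag_dup n (perm_act Mag_operad n \<sigma> \<mu>) = perm_act Dup_operad n \<sigma> (mag_dup n \<mu>)"
    unfolding pa using lt by (intro mag_dup_subst) (auto simp: var_coord mag_dup_var)
qed

lemma ident_mag:
  "var mag_laws 1 0 \<in> multilinear_part mag_laws 1" "mag_dup 1 (var mag_laws 1 0) = var dup_laws 1 0"
  by (auto simp: multilinear_mag var_coord mlin_def mag_dup_var)

lemma Prim_As_Dup_simps:
  "carrier (ops Prim_As_Dup n) = primitive_operations n" "ident Prim_As_Dup = var dup_laws 1 0"
  "pcomp Prim_As_Dup = pcomp Dup_operad" "perm_act Prim_As_Dup = perm_act Dup_operad"
  by (simp_all add: Prim_As_Dup_def restrict_operad_def) (simp add: operad_of_def)

lemma prim_obtain:
  fixes x :: "((dup_op, nat \<Rightarrow>\<^sub>0 'k::field) tm \<Rightarrow>\<^sub>0 'k) set"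
  assumes "x \<in> primitive_operations n"
  obtains y where "y \<in> multilinear_part mag_laws n" "x = mag_dup n y"
proof -
  have "bij_betw (mag_dup n) (carrier (ops (Mag_operad :: ('k, _) operad) n)) (carrier (ops Prim_As_Dup n))"
    using linear_iso_mag_dup unfolding linear_iso_def by (rule conjunct2)
  then have "bij_betw (mag_dup n) (multilinear_part (mag_laws :: ('k, _, _) laws) n) (primitive_operations n)"
    unfolding Prim_As_Dup_simps ops_simps .
  then show ?thesis using assms that by (auto simp: bij_betw_def)
qed

lemma operad_iso_mag_dup: "operad_iso Mag_operad Prim_As_Dup mag_dup"
  unfolding operad_iso_def Prim_As_Dup_simps ops_simps
proof (intro conjI allI ballI impI)
  show "mag_dup 1 (ident Mag_operad) = var dup_laws 1 0" using ident_mag(2) by (simp add: operad_of_def)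
qed (rule linear_iso_mag_dup, (rule pcomp_mag(2); assumption), (rule perm_act_mag(2); assumption))

text \<open>Closure under composition and permutations is inherited from the magmatic side: every
  primitive operation has the form \<open>mag_dup n y\<close> with \<open>y\<close> multilinear
  (\<open>prim_obtain\<close>), and \<open>mag_dup\<close> commutes with the operad structure. The
  duplicial compositions need no expansion.\<close>

lemma suboperad_primitive: "suboperad primitive_operations (Dup_operad :: ('k::field, _) operad)"
proof -
  have "subspace class_ring (primitive_operations n) (ops (Dup_operad :: ('k, _) operad) n)" for n
  proof -
    have "coord (ops (Dup_operad :: ('k, _) operad) n) (mlin_words n) dc"
    proof (rule coord_subspace[OF D.coord_axioms, where S = "multilinear_part dup_laws n"])
      have "p \<in> dc ` multilinear_part dup_laws n" if "p \<in> fs (mlin_words n)" for p :: "(mag_op, nat) tm list \<Rightarrow>\<^sub>0 'k"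
      proof -
        have "p \<in> fs (nwords (tms {..<n}))" using that mlin_words_nwords[of n] by (auto simp: fs_def)
        then show ?thesis using that D.vec_mem[of p n] D.c_vec[of p n] by (auto simp: multilinear_dup image_iff intro!: bexI)
      qed
      then show "dc ` multilinear_part dup_laws n = (fs (mlin_words n) :: ((mag_op, nat) tm list \<Rightarrow>\<^sub>0 'k) set)" by (auto simp: multilinear_dup)
    qed (auto simp: multilinear_dup)
    then interpret O: coord "ops (Dup_operad :: ('k, _) operad) n" "mlin_words n" dc .
    have sub: "primitive_operations n \<subseteq> multilinear_part (dup_laws :: ('k, _, _) laws) n"
      by (auto simp: primitive_operations_def)
    show ?thesis unfolding O.subspace_iff using sub
      by (auto simp: primitive_operations_eq D.zero_mem D.add_mem D.smult_mem intro!: subsp_add subsp_scl)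
  qed
  moreover have "ident (Dup_operad :: ('k, _) operad) \<in> primitive_operations 1"
    by (simp add: operad_of_def mag_dup_prim[OF ident_mag(1), unfolded ident_mag(2)] del: One_nat_def)
  moreover have "pcomp Dup_operad m n i \<mu> \<nu> \<in> primitive_operations (m + n - 1)"
    if "\<mu> \<in> primitive_operations m" "\<nu> \<in> primitive_operations n" "i < m" for m n i and \<mu> \<nu> :: "((dup_op, nat \<Rightarrow>\<^sub>0 'k) tm \<Rightarrow>\<^sub>0 'k) set"
    using that pcomp_mag mag_dup_prim by (metis prim_obtain)
  moreover have "perm_act Dup_operad n \<sigma> \<mu> \<in> primitive_operations n"
    if "\<mu> \<in> primitive_operations n" "\<sigma> permutes {..<n}" for n \<sigma> and \<mu> :: "((dup_op, nat \<Rightarrow>\<^sub>0 'k) tm \<Rightarrow>\<^sub>0 'k) set"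
    using that perm_act_mag mag_dup_prim by (metis prim_obtain)
  ultimately show ?thesis unfolding suboperad_def by blast
qed

text \<open>This pins the isomorphism down as the one in which the magmatic generator is the
  operation \<open>x \<prec> y - x \<succ> y\<close>.\<close>

lemma mag_dup_dot:
  "mag_dup 2 (bop (MA 2) Dot (var mag_laws 2 0) (var mag_laws 2 1)) =
    bop (mag_of (DA 2)) Dot (var dup_laws 2 0) (var dup_laws 2 1)"
proof (rule mag_dup_eqI)
  have "0 < (2 :: nat)" "1 < (2 :: nat)" by simp_all
  note v = var_coord[OF this(1)] var_coord[OF this(2)]
  show "bop (MA 2) Dot (var mag_laws 2 0) (var mag_laws 2 1) \<in> carrier (MA 2)"
    by (intro M.bop_mem v)
  show "bop (mag_of (DA 2)) Dot (var dup_laws 2 0) (var dup_laws 2 1) \<in> carrier (DA 2)"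
    unfolding bop_mag_of by (intro D.minus_closed D.bop_mem v)
  show "dc (bop (mag_of (DA 2)) Dot (var dup_laws 2 0) (var dup_laws 2 1)) =
      pbind (mc (bop (MA 2) Dot (var mag_laws 2 0) (var mag_laws 2 1))) (\<lambda>t. sg [t])"
    unfolding bop_mag_of D.c_minus[OF D.bop_mem[OF v(3,7)] D.bop_mem[OF v(3,7)]]
      D.c_bop[OF v(3,7)] M.c_bop[OF v(1,5)] v by simp
qed

theorem corollary5p2p6:
  shows
    "suboperad primitive_operations (Dup_operad :: ('k::field, _) operad) \<and>
     (\<exists>\<phi>. operad_iso (Mag_operad :: ('k, _) operad) Prim_As_Dup \<phi> \<and>
          \<phi> 2 (bop (free_alg mag_laws (coord_space 2)) Dot (var mag_laws 2 0) (var mag_laws 2 1)) =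
          bop (mag_of (free_alg dup_laws (coord_space 2))) Dot (var dup_laws 2 0) (var dup_laws 2 1)) \<and>
     (\<forall>H :: ('k, 'a, dup_op) bialg. duplicial_bialgebra H \<longrightarrow>
        (connected_coalgebra H (comult H) \<longleftrightarrow> (\<exists>f. dup_bialg_iso H (U (Prim H)) f)) \<and>
        ((\<exists>f. dup_bialg_iso H (U (Prim H)) f) \<longleftrightarrow>
         (\<exists>f. coalgebra_iso H (comult H) (Asc (Prim H)) (deconcatenation (Prim H)) f)))"
  using suboperad_primitive operad_iso_mag_dup mag_dup_dot duplicial_bialgebra_structure by blast

end
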